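(* Let $q=p^e$ be a prime power, $\lambda\in\mathbb{F}_q^*$ of order $g$, and $N=p^vn$ a positive integer with $v=v_p(N)\geq0$ and $\gcd(n,p)=1$. Let $\lambda'\in\mathbb{F}_q^*$ be the element with $(\lambda')^{p^v}=\lambda$ (namely $\lambda'=\lambda^b$ with $bp^v\equiv1\pmod g$), and let $h$ be an integer coprime to $ng$ with $\zeta_{ng}^{hn}=\lambda'$. Write $g=g_1^{e_1}\cdots g_u^{e_u}$ and $n=g_1^{f_1}\cdots g_u^{f_u}p_1^{j_1}\cdots p_s^{j_s}$, where $g_1,\dots,g_u,p_1,\dots,p_s$ are pairwise distinct primes different from $p$, $g_1<\cdots<g_u$, $p_1<\cdots<p_s$, the $e_k,j_k$ are positive integers and the $f_k$ are nonnegative integers; put $n_1=g_1^{f_1}\cdots g_u^{f_u}$. Then the irreducible factorization of $X^N-\lambda$ over $\mathbb{F}_q$ is $$X^N-\lambda=\prod_{\mathbf{x}\in[0,g_1^{y_1}-1]\times\cdots\times[0,g_u^{y_u}-1]}\ \prod_{I\in\mathcal{I}_{ng/n_1g}(\gamma_{\mathbf{x}})}M_{h\gamma_{\mathbf{x},I}}(X)^{p^v}.$$ Moreover, for every such $\mathbf{x}$ and every $I=(\mathfrak{m},\mathfrak{a},\mathfrak{t})\in\mathcal{I}_{ng/n_1g}(\gamma_{\mathbf{x}})$, the irreducible polynomial $M_{h\gamma_{\mathbf{x},I}}(X)$ is $$M_{h\gamma_{\mathbf{x},I}}(X)=\sum_{k=0}^{\omega_{\mathfrak{m}}}(-1)^{\omega_{\mathfrak{m}}-k}\,\sigma_{\omega_{\mathfrak{m}}-k}\bigl(\zeta_{d_{\mathfrak{m}}}^{h\gamma_{\mathbf{x},I}},\zeta_{d_{\mathfrak{m}}}^{h\gamma_{\mathbf{x},I}q},\dots,\zeta_{d_{\mathfrak{m}}}^{h\gamma_{\mathbf{x},I}q^{\omega_{\mathfrak{m}}-1}}\bigr)\,X^{\frac{\tau_s(\mathfrak{m})k}{\omega_{\mathfrak{m}}}},$$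 where $\sigma_i$ denotes the $i$-th elementary symmetric polynomial in $\omega_{\mathfrak m}$ variables.
   Context: Notation: $\mathbb{N}=\{0,1,\dots\}$; $[a,b]$ is the set of integers from $a$ to $b$; $v_\ell$ is the $\ell$-adic valuation; $\mathrm{rad}$ is the product of the distinct prime divisors; $\mathrm{ord}_M(q)$ is the multiplicative order of $q$ modulo $M$; $\overline{[0,j_k-1]}=[0,j_k-1]\cup\{\infty\}$. The cases $u=0$ and $s=0$ are allowed, with empty products $1$ and empty tuples. A family $\{\zeta_M:\gcd(M,q)=1\}$ of primitive $M$-th roots of unity in an algebraic closure of $\mathbb{F}_q$ is fixed, with $\zeta_M^{M/M'}=\zeta_{M'}$ whenever $M'\mid M$. For $M\geq1$ coprime to $q$, $c_M(\gamma)=\{\gamma,\gamma q,\dots,\gamma q^{\tau-1}\}\subseteq\mathbb{Z}/M\mathbb{Z}$ is the $q$-cyclotomic coset containing $\gamma$, $\tau$ the least positive integer with $\gamma q^\tau\equiv\gamma\pmod M$, called its size. For $\delta\in\mathbb{Z}$, $M_\delta(X)=\prod_{i\in c_{ng}(\delta)}(X-\zeta_{ng}^i)\in\mathbb{F}_q[X]$. The exponents $y_k$ and integers $\gamma_{\mathbf{x}}$. If $g_1=2$ and $q\equiv3\pmod4$, $y_1=\max\{0,\min\{f_1-1,v_{g_1}(q+1)-e_1\}\}$; otherwise $y_1=\min\{f_1,v_{g_1}(q-1)-e_1\}$. For $2\leq k\leq u$, $y_k=\min\{f_k,v_{g_k}(q-1)-e_k\}$. For $\mathbf{x}=(x_1,\dots,x_u)$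 with $x_k\in[0,g_k^{y_k}-1]$: $\gamma_{\mathbf{x}}=1+g(g_1x_1+g_1^{f_1}x_2+\cdots+g_1^{f_1}\cdots g_{u-1}^{f_{u-1}}x_u)$ if $g_1=2$ and $q\equiv3\pmod4$, and $\gamma_{\mathbf{x}}=1+g(x_1+g_1^{f_1}x_2+\cdots+g_1^{f_1}\cdots g_{u-1}^{f_{u-1}}x_u)$ otherwise. The general construction below is applied with base modulus $N_0=n_1g$, $\gamma=\gamma_{\mathbf{x}}$ and $n'=p_1^{j_1}\cdots p_s^{j_s}$ (so $N_0n'=ng$ and $\tau=|c_{n_1g}(\gamma_{\mathbf{x}})|$); $\gamma_{\mathbf{x},I}:=(\gamma_{\mathbf{x}})_I$. For $s=0$, $\mathcal{I}$ has one element $I$, $\gamma_I=\gamma$ and $\tau_0=\tau$. Let $N_0$ be a positive integer coprime to $q$ and to $p_1\cdots p_s$, $\gamma\in\mathbb{Z}$, $\tau=|c_{N_0}(\gamma)|$. For $\mathfrak{m}=(m_1,\dots,m_s)$ with $m_k\in\overline{[0,j_k-1]}$, write $\mathfrak{m}_{\leq k}=(m_1,\dots,m_k)$ and define recursively: $\bullet$ $k=1$: $r_1=[(\mathbb{Z}/p_1\mathbb{Z})^*:\langle q^\tau\rangle]$; $v_1=v_2(q^\tau+1)$ if $p_1=2$ and $q^\tau\equiv3\pmod4$, and $v_1=v_{p_1}(q^{\tau(p_1-1)/r_1}-1)$ otherwise. If $p_1=2$ and $q^\tau\equiv3\pmod 4$: $\tau_1(\mathfrak{m}_{\leq1})=\tau$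 if $m_1\in\{j_1-1,\infty\}$ and $2^{\max\{1,j_1-m_1-v_1\}}\tau$ if $0\leq m_1\leq j_1-2$. Otherwise: $\tau_1(\mathfrak{m}_{\leq1})=\tau$ if $m_1=\infty$ and $p_1^{\max\{0,j_1-m_1-v_1\}}\frac{p_1-1}{r_1}\tau$ if $0\leq m_1\leq j_1-1$. $\bullet$ $2\leq k\leq s$: $r_k(\mathfrak{m}_{\leq k-1})=[(\mathbb{Z}/p_k\mathbb{Z})^*:\langle q^{\tau_{k-1}(\mathfrak{m}_{\leq k-1})}\rangle]$, $\widetilde\tau_k=\frac{\tau_{k-1}(\mathfrak{m}_{\leq k-1})(p_k-1)}{r_k(\mathfrak{m}_{\leq k-1})}$, $v_k(\mathfrak{m}_{\leq k-1})=v_{p_k}(q^{\widetilde\tau_k}-1)$; $\tau_k(\mathfrak{m}_{\leq k})=\tau_{k-1}(\mathfrak{m}_{\leq k-1})$ if $m_k=\infty$, and $\tau_k(\mathfrak{m}_{\leq k})=p_k^{\max\{0,j_k-m_k-v_k(\mathfrak{m}_{\leq k-1})\}}\frac{p_k-1}{r_k(\mathfrak{m}_{\leq k-1})}\tau_{k-1}(\mathfrak{m}_{\leq k-1})$ if $0\leq m_k\leq j_k-1$. Index set. $\mathcal{I}_{N_0n'/N_0}(\gamma)$ is the set of triples $(\mathfrak{m},\mathfrak{a},\mathfrak{t})$ with $\mathfrak{m}\in\overline{[0,j_1-1]}\times\cdots\times\overline{[0,j_s-1]}$ and $\mathfrak{a},\mathfrak{t}\in\mathbb{N}^s$ such that: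 (i) for every $k$, if $m_k=\infty$ then $a_k=t_k=0$; (ii) if $m_1\in[0,j_1-1]$: when $p_1=2$ and $q^\tau\equiv3\pmod4$, $a_1=1$ and $t_1\in[0,2^{\max\{0,\min\{v_1-1,j_1-m_1-2\}\}}-1]$; otherwise $a_1\in[1,r_1]$ and $t_1\in[0,p_1^{\min\{v_1,j_1-m_1\}-1}-1]$; (iii) for $2\leq k\leq s$, if $m_k\in[0,j_k-1]$ then $a_k\in[1,r_k(\mathfrak{m}_{\leq k-1})]$ and $t_k\in[0,p_k^{\min\{v_k(\mathfrak{m}_{\leq k-1}),j_k-m_k\}-1}-1]$. The integers $\varphi$ and $U$. For a positive integer $B$, a prime $\ell\nmid B$, $\ell\neq p$, and $\delta\in\mathbb{Z}$, let $\varphi_B^\ell(\delta)=-\delta/B=\sum_{k\geq0}\phi_k\ell^k\in\mathbb{Z}_\ell$ ($\phi_k\in[0,\ell-1]$) and $\varphi_B^\ell(\delta)_{\leq i}=\sum_{k=0}^i\phi_k\ell^k$. Let $\theta$ be the size of $c_B(\delta)$ and $r=[(\mathbb{Z}/\ell\mathbb{Z})^*:\langle q^\theta\rangle]$. For $m\in\mathbb{N}$, $a\in[1,r]$, put $U_B^\ell(\delta;m,a)=\sum_{k=0}^{m-1}\phi_k\ell^k+u\,\ell^m$, where: if $\ell\mid q^\theta-1$ (so $r=\ell-1$), $u=\sigma^m_a$ with $[0,\ell-1]\setminus\{\phi_m\}=\{\sigma_1^m<\cdots<\sigma_{\ell-1}^m\}$; if $\ell\nmid q^\theta-1$, $u\in[0,\ell-1]$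 with $u\equiv\phi_m+\sigma_a\pmod\ell$, where $\{\sigma_1<\dots<\sigma_r\}\subseteq[1,\ell-1]$ is a fixed full set of representatives of $(\mathbb{Z}/\ell\mathbb{Z})^*/\langle q^\theta\rangle$. For $\ell=2$ write $U_B^2(\delta;m)=U_B^2(\delta;m,1)=\sum_{k<m}\phi_k2^k+(1-\phi_m)2^m$. The representative $\gamma_I$. For $I=(\mathfrak{m},\mathfrak{a},\mathfrak{t})$ put $\gamma_I=\gamma_{I,s}$, where: $\bullet$ $\gamma_{I,1}=\gamma+N_0\,\varphi_{N_0}^{p_1}(\gamma)_{\leq j_1-1}$ if $m_1=\infty$; $\gamma_{I,1}=\gamma+N_0(U_{N_0}^2(\gamma;m_1)+2^{m_1+2}t_1)$ if $0\leq m_1\leq j_1-1$, $p_1=2$ and $q^\tau\equiv3\pmod4$; $\gamma_{I,1}=\gamma+N_0(U_{N_0}^{p_1}(\gamma;m_1,a_1)+p_1^{m_1+1}t_1)$ otherwise. $\bullet$ For $2\leq k\leq s$, with $B_k=p_1^{j_1}\cdots p_{k-1}^{j_{k-1}}N_0$: $\gamma_{I,k}=\gamma_{I,k-1}+B_k\,\varphi_{B_k}^{p_k}(\gamma_{I,k-1})_{\leq j_k-1}$ if $m_k=\infty$; $\gamma_{I,k}=\gamma_{I,k-1}+B_k\bigl(U_{B_k}^{p_k}(\gamma_{I,k-1};m_k,a_k)+p_k^{m_k+1}t_k\bigr)$ if $0\leq m_k\leq j_k-1$. (Here the size $\theta$ of $c_{B_k}(\gamma_{I,k-1})$ used in forming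 $U$ is $\tau_{k-1}(\mathfrak{m}_{\leq k-1})$.) The numbers $\omega_{\mathfrak{m}},d_{\mathfrak{m}}$. For $\mathfrak{m}=(m_1,\dots,m_s)\in\overline{[0,j_1-1]}\times\cdots\times\overline{[0,j_s-1]}$, in the following formulas $m_k=\infty$ is read as $m_k=j_k$ (so $j_k-m_k=0$). Put $z_k=\min\{j_k-m_k,1\}$ and $w=\mathrm{ord}_{\mathrm{rad}(g)p_1^{z_1}\cdots p_s^{z_s}}(q)$. Then $\omega_{\mathfrak{m}}=2w$ if $q^w\equiv3\pmod4$ and $8\mid n_1g\,p_1^{j_1-m_1}\cdots p_s^{j_s-m_s}$, and $\omega_{\mathfrak{m}}=w$ otherwise. Finally $d_{\mathfrak{m}}=\dfrac{ng\,\omega_{\mathfrak{m}}}{\tau_s(\mathfrak{m})}$. *)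

theory Defs
  imports
    "HOL-Number_Theory.Number_Theory"
    "HOL-Algebra.Generated_Groups"
    "HOL-Algebra.Algebraic_Closure_Type"
    "HOL-Library.FuncSet"
    "HOL-Library.Extended_Nat"
begin

hide_const (open) Divisibility.prime Divisibility.irreducible

text \<open>
  Families indexed by \<open>1, \<dots>, r\<close> are functions on \<open>nat\<close> of which only the values on
  \<open>{1..r}\<close> are used; tuples that are ranged over live in \<open>PiE {1..r} _\<close>, so that there is exactly
  one empty tuple.
\<close>

section \<open>Roots of unity and cyclotomic cosets\<close>

definition has_mult_order :: "'b::field \<Rightarrow> nat \<Rightarrow> bool" where
  "has_mult_order z M \<longleftrightarrow> M > 0 \<and> z ^ M = 1 \<and> (\<forall>k. 0 < k \<and> k < M \<longrightarrow> z ^ k \<noteq> 1)"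

text \<open>An element of multiplicative order \<open>M\<close> is the same thing as a primitive \<open>M\<close>-th root of unity.\<close>

definition compatible_roots :: "nat \<Rightarrow> (nat \<Rightarrow> 'b::field) \<Rightarrow> bool" where
  "compatible_roots q \<zeta> \<longleftrightarrow>
     (\<forall>M. M > 0 \<and> coprime M q \<longrightarrow> has_mult_order (\<zeta> M) M) \<and>
     (\<forall>M M'. M > 0 \<and> coprime M q \<and> M' dvd M \<longrightarrow> \<zeta> M ^ (M div M') = \<zeta> M')"

definition cyc_size :: "nat \<Rightarrow> nat \<Rightarrow> int \<Rightarrow> nat" where
  "cyc_size q M \<gamma> = (LEAST t. t > 0 \<and> [\<gamma> * int q ^ t = \<gamma>] (mod int M))"

text \<open>Residue classes modulo \<open>M\<close> are represented by their least nonnegative representatives.\<close>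

definition cyc_coset :: "nat \<Rightarrow> nat \<Rightarrow> int \<Rightarrow> int set" where
  "cyc_coset q M \<gamma> = (\<lambda>i. (\<gamma> * int q ^ i) mod int M) ` {..<cyc_size q M \<gamma>}"

definition cyc_poly :: "nat \<Rightarrow> (nat \<Rightarrow> 'b::field) \<Rightarrow> nat \<Rightarrow> int \<Rightarrow> 'b poly" where
  "cyc_poly q \<zeta> M \<delta> = (\<Prod>i\<in>cyc_coset q M \<delta>. [:- (\<zeta> M powi i), 1:])"

definition elem_sym :: "nat \<Rightarrow> nat \<Rightarrow> (nat \<Rightarrow> 'b::comm_ring_1) \<Rightarrow> 'b" where
  "elem_sym i w z = (\<Sum>S | S \<subseteq> {..<w} \<and> card S = i. \<Prod>j\<in>S. z j)"

definition rad :: "nat \<Rightarrow> nat" where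
  "rad n = \<Prod>(prime_factors n)"


section \<open>Subgroups of the units modulo a prime\<close>

abbreviation unit_group :: "nat \<Rightarrow> int monoid" where
  "unit_group l \<equiv> units_of (residue_ring (int l))"

definition powers_mod :: "nat \<Rightarrow> nat \<Rightarrow> int set" where
  "powers_mod l a = generate (unit_group l) {int a mod int l}"

definition unit_index :: "nat \<Rightarrow> nat \<Rightarrow> nat" where
  "unit_index l a = card (rcosets\<^bsub>unit_group l\<^esub> (powers_mod l a))"

definition full_reps :: "nat \<Rightarrow> nat \<Rightarrow> nat set \<Rightarrow> bool" where
  "full_reps l a R \<longleftrightarrow> R \<subseteq> {1..l - 1} \<and>
     (\<forall>C \<in> rcosets\<^bsub>unit_group l\<^esub> (powers_mod l a). \<exists>!\<sigma>. \<sigma> \<in> R \<and> int \<sigma> \<in> C)"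

text \<open>The \<open>a\<close>-th smallest element, counting from 1.\<close>

definition nth_smallest :: "nat set \<Rightarrow> nat \<Rightarrow> nat" where
  "nth_smallest S a = sorted_list_of_set S ! (a - 1)"


section \<open>The integers \<open>\<phi>\<close> and \<open>U\<close>\<close>

text \<open>
  The \<open>l\<close>-adic digits of \<open>- \<delta> / B\<close>: since the \<open>l\<close>-adic integers are the inverse limit of the
  residue rings modulo \<open>l ^ (i + 1)\<close>, a digit sequence represents \<open>- \<delta> / B\<close> iff \<open>B\<close> times each
  truncation is congruent to \<open>- \<delta>\<close>.
\<close>

definition is_ladic_digits :: "nat \<Rightarrow> nat \<Rightarrow> int \<Rightarrow> (nat \<Rightarrow> nat) \<Rightarrow> bool" where
  "is_ladic_digits l B \<delta> \<phi> \<longleftrightarrow>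
     (\<forall>k. \<phi> k < l) \<and>
     (\<forall>i. [int B * (\<Sum>k\<le>i. int (\<phi> k) * int l ^ k) = - \<delta>] (mod int l ^ (i + 1)))"

definition ladic_digit :: "nat \<Rightarrow> nat \<Rightarrow> int \<Rightarrow> nat \<Rightarrow> nat" where
  "ladic_digit l B \<delta> = (THE \<phi>. is_ladic_digits l B \<delta> \<phi>)"

definition ladic_upto :: "nat \<Rightarrow> nat \<Rightarrow> int \<Rightarrow> nat \<Rightarrow> int" where
  "ladic_upto l B \<delta> i = (\<Sum>k\<le>i. int (ladic_digit l B \<delta> k) * int l ^ k)"

text \<open>
  \<open>R B l \<delta>\<close> is the chosen set of representatives of the units modulo \<open>l\<close> by the powers of
  \<open>q ^ cyc_size q B \<delta>\<close>; the choice may depend on all of \<open>B\<close>, \<open>l\<close> and \<open>\<delta>\<close>.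
\<close>

definition U_int ::
  "nat \<Rightarrow> (nat \<Rightarrow> nat \<Rightarrow> int \<Rightarrow> nat set) \<Rightarrow> nat \<Rightarrow> nat \<Rightarrow> int \<Rightarrow> nat \<Rightarrow> nat \<Rightarrow> int" where
  "U_int q R l B \<delta> m a =
     (let \<phi> = ladic_digit l B \<delta>;
          u = (if l dvd q ^ cyc_size q B \<delta> - 1
               then nth_smallest ({0..l - 1} - {\<phi> m}) a
               else (\<phi> m + nth_smallest (R B l \<delta>) a) mod l)
      in (\<Sum>k<m. int (\<phi> k) * int l ^ k) + int u * int l ^ m)"


section \<open>The recursive construction\<close>

text \<open>
  For strictly increasing primes \<open>ps\<close> only \<open>ps 1\<close> can be \<open>2\<close>, hence the exceptional case can occur
  only in the first step, and otherwise the first step follows the pattern of the later ones.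
  In the definitions below \<open>\<tau>\<close> is the size of the coset reached so far; truncated subtraction on
  \<open>nat\<close> takes the place of \<open>max 0\<close>.
\<close>

definition exceptional :: "nat \<Rightarrow> nat \<Rightarrow> nat \<Rightarrow> bool" where
  "exceptional l q \<tau> \<longleftrightarrow> l = 2 \<and> q ^ \<tau> mod 4 = 3"

definition r_step :: "nat \<Rightarrow> nat \<Rightarrow> nat \<Rightarrow> nat" where
  "r_step q l \<tau> = unit_index l (q ^ \<tau>)"

definition v_step :: "nat \<Rightarrow> nat \<Rightarrow> nat \<Rightarrow> nat" where
  "v_step q l \<tau> =
     (if exceptional l q \<tau> then multiplicity 2 (q ^ \<tau> + 1)
      else multiplicity l (q ^ (\<tau> * (l - 1) div r_step q l \<tau>) - 1))"

definition tau_step :: "nat \<Rightarrow> nat \<Rightarrow> nat \<Rightarrow> nat \<Rightarrow> enat \<Rightarrow> nat" where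
  "tau_step q l j \<tau> m =
     (case m of
        \<infinity> \<Rightarrow> \<tau>
      | enat i \<Rightarrow>
          if exceptional l q \<tau>
          then (if i = j - 1 then \<tau> else 2 ^ max 1 (j - i - v_step q l \<tau>) * \<tau>)
          else l ^ (j - i - v_step q l \<tau>) * ((l - 1) div r_step q l \<tau>) * \<tau>)"

text \<open>\<open>tau_seq q ps js \<tau> m k\<close> only depends on the entries \<open>m 1, \<dots>, m k\<close>.\<close>

primrec tau_seq ::
  "nat \<Rightarrow> (nat \<Rightarrow> nat) \<Rightarrow> (nat \<Rightarrow> nat) \<Rightarrow> nat \<Rightarrow> (nat \<Rightarrow> enat) \<Rightarrow> nat \<Rightarrow> nat" where
  "tau_seq q ps js \<tau> m 0 = \<tau>"
| "tau_seq q ps js \<tau> m (Suc k) =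
     tau_step q (ps (Suc k)) (js (Suc k)) (tau_seq q ps js \<tau> m k) (m (Suc k))"

type_synonym index = "(nat \<Rightarrow> enat) \<times> (nat \<Rightarrow> nat) \<times> (nat \<Rightarrow> nat)"

definition index_ok :: "nat \<Rightarrow> nat \<Rightarrow> nat \<Rightarrow> nat \<Rightarrow> enat \<Rightarrow> nat \<Rightarrow> nat \<Rightarrow> bool" where
  "index_ok q l j \<tau> m a t \<longleftrightarrow>
     (case m of
        \<infinity> \<Rightarrow> a = 0 \<and> t = 0
      | enat i \<Rightarrow>
          if exceptional l q \<tau>
          then a = 1 \<and> t \<in> {0..2 ^ min (v_step q l \<tau> - 1) (j - i - 2) - 1}
          else a \<in> {1..r_step q l \<tau>} \<and> t \<in> {0..l ^ (min (v_step q l \<tau>) (j - i) - 1) - 1})"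

definition index_set ::
  "nat \<Rightarrow> nat \<Rightarrow> (nat \<Rightarrow> nat) \<Rightarrow> (nat \<Rightarrow> nat) \<Rightarrow> nat \<Rightarrow> int \<Rightarrow> index set" where
  "index_set q s ps js N0 \<gamma> =
     {(m, a, t).
        m \<in> PiE {1..s} (\<lambda>k. enat ` {0..js k - 1} \<union> {\<infinity>}) \<and>
        a \<in> PiE {1..s} (\<lambda>_. UNIV) \<and> t \<in> PiE {1..s} (\<lambda>_. UNIV) \<and>
        (\<forall>k\<in>{1..s}. index_ok q (ps k) (js k)
                      (tau_seq q ps js (cyc_size q N0 \<gamma>) m (k - 1)) (m k) (a k) (t k))}"

text \<open>
  One step of the construction of the representatives, with modulus \<open>B\<close>. In the exceptional case
  the integer \<open>U\<close> is taken at \<open>a = 1\<close>.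
\<close>

definition rep_step ::
  "nat \<Rightarrow> (nat \<Rightarrow> nat \<Rightarrow> int \<Rightarrow> nat set) \<Rightarrow> nat \<Rightarrow> nat \<Rightarrow> nat \<Rightarrow> int \<Rightarrow> enat \<Rightarrow> nat \<Rightarrow> nat \<Rightarrow> int"
  where
  "rep_step q R l j B \<delta> m a t =
     (case m of
        \<infinity> \<Rightarrow> \<delta> + int B * ladic_upto l B \<delta> (j - 1)
      | enat i \<Rightarrow>
          if exceptional l q (cyc_size q B \<delta>)
          then \<delta> + int B * (U_int q R 2 B \<delta> i 1 + 2 ^ (i + 2) * int t)
          else \<delta> + int B * (U_int q R l B \<delta> i a + int l ^ (i + 1) * int t))"

primrec rep_seq ::
  "nat \<Rightarrow> (nat \<Rightarrow> nat \<Rightarrow> int \<Rightarrow> nat set) \<Rightarrow> (nat \<Rightarrow> nat) \<Rightarrow> (nat \<Rightarrow> nat) \<Rightarrow> nat \<Rightarrow> int \<Rightarrow> index \<Rightarrow> nat \<Rightarrow> int"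
  where
  "rep_seq q R ps js N0 \<gamma> I 0 = \<gamma>"
| "rep_seq q R ps js N0 \<gamma> I (Suc k) =
     (case I of (m, a, t) \<Rightarrow>
        rep_step q R (ps (Suc k)) (js (Suc k)) ((\<Prod>i=1..k. ps i ^ js i) * N0)
          (rep_seq q R ps js N0 \<gamma> I k) (m (Suc k)) (a (Suc k)) (t (Suc k)))"


section \<open>The exponents \<open>y\<close> and the integers \<open>\<gamma>\<^sub>x\<close>\<close>

definition y_exp ::
  "nat \<Rightarrow> (nat \<Rightarrow> nat) \<Rightarrow> (nat \<Rightarrow> nat) \<Rightarrow> (nat \<Rightarrow> nat) \<Rightarrow> nat \<Rightarrow> nat" where
  "y_exp q gs es fs k =
     (if k = 1 \<and> gs 1 = 2 \<and> q mod 4 = 3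
      then min (fs 1 - 1) (multiplicity 2 (q + 1) - es 1)
      else min (fs k) (multiplicity (gs k) (q - 1) - es k))"

definition x_set ::
  "nat \<Rightarrow> nat \<Rightarrow> (nat \<Rightarrow> nat) \<Rightarrow> (nat \<Rightarrow> nat) \<Rightarrow> (nat \<Rightarrow> nat) \<Rightarrow> (nat \<Rightarrow> nat) set" where
  "x_set q u gs es fs = PiE {1..u} (\<lambda>k. {0..gs k ^ y_exp q gs es fs k - 1})"

definition gamma_x ::
  "nat \<Rightarrow> nat \<Rightarrow> nat \<Rightarrow> (nat \<Rightarrow> nat) \<Rightarrow> (nat \<Rightarrow> nat) \<Rightarrow> (nat \<Rightarrow> nat) \<Rightarrow> int" where
  "gamma_x q g u gs fs x =
     1 + int g * (\<Sum>k=1..u. (if k = 1 \<and> gs 1 = 2 \<and> q mod 4 = 3 then int (gs 1) else 1) *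
                    (\<Prod>i=1..<k. int (gs i) ^ fs i) * int (x k))"


section \<open>The numbers \<open>\<omega>\<close> and \<open>d\<close>\<close>

text \<open>\<open>j - m\<close>, where \<open>m = \<infinity>\<close> is read as \<open>m = j\<close>.\<close>

definition co_exp :: "nat \<Rightarrow> enat \<Rightarrow> nat" where
  "co_exp j m = (case m of \<infinity> \<Rightarrow> 0 | enat i \<Rightarrow> j - i)"

definition omega ::
  "nat \<Rightarrow> nat \<Rightarrow> nat \<Rightarrow> nat \<Rightarrow> (nat \<Rightarrow> nat) \<Rightarrow> (nat \<Rightarrow> nat) \<Rightarrow> (nat \<Rightarrow> enat) \<Rightarrow> nat" where
  "omega q g n1 s ps js m =
     (let w = ord (rad g * (\<Prod>k=1..s. ps k ^ min (co_exp (js k) (m k)) 1)) q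
      in if q ^ w mod 4 = 3 \<and> 8 dvd n1 * g * (\<Prod>k=1..s. ps k ^ co_exp (js k) (m k))
         then 2 * w else w)"


section \<open>Existence and uniqueness of the digits\<close>

lemma ladic_truncation_bounds:
  assumes "\<And>k. \<phi> k < l"
  shows "(\<Sum>k\<le>i. int (\<phi> k) * int l ^ k) \<in> {0..<int l ^ (i + 1)}"
proof (induction i)
  case 0
  then show ?case using assms[of 0] by simp
next
  case (Suc i)
  have "int (\<phi> (Suc i)) * int l ^ Suc i \<le> (int l - 1) * int l ^ Suc i"
    using assms[of "Suc i"] by (intro mult_right_mono) auto
  then show ?case using Suc by (auto simp: algebra_simps intro!: add_nonneg_nonneg)
qed

lemma ladic_digits_unique:
  assumes "coprime l B" "is_ladic_digits l B \<delta> \<phi>" "is_ladic_digits l B \<delta> \<psi>"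
  shows "\<phi> = \<psi>"
proof -
  define S where "S f i = (\<Sum>k\<le>i. int (f k) * int l ^ k)" for f :: "nat \<Rightarrow> nat" and i
  have l: "l > 0" using assms(2) unfolding is_ladic_digits_def by (metis not_less_zero gr0I)
  have S: "S \<phi> i = S \<psi> i" for i
  proof -
    have "[int B * S \<phi> i = int B * S \<psi> i] (mod int l ^ (i + 1))"
      using assms(2,3) unfolding is_ladic_digits_def S_def by (meson cong_sym cong_trans)
    moreover have "coprime (int B) (int l ^ (i + 1))"
      using assms(1) by (simp add: coprime_commute)
    ultimately have "[S \<phi> i = S \<psi> i] (mod int l ^ (i + 1))"
      using cong_mult_lcancel by blast
    moreover have "S \<phi> i \<in> {0..<int l ^ (i + 1)}" "S \<psi> i \<in> {0..<int l ^ (i + 1)}"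
      using assms(2,3) ladic_truncation_bounds unfolding is_ladic_digits_def S_def by blast+
    ultimately show ?thesis
      by (metis atLeastLessThan_iff cong_less_imp_eq_int)
  qed
  have "\<phi> k = \<psi> k" for k
  proof (cases k)
    case 0
    then show ?thesis using S[of 0] by (simp add: S_def)
  next
    case (Suc i)
    then show ?thesis using S[of "Suc i"] S[of i] l by (simp add: S_def)
  qed
  then show ?thesis by auto
qed

lemma ladic_digits_exist:
  assumes "coprime l B" "l > 0"
  shows "\<exists>\<phi>. is_ladic_digits l B \<delta> \<phi>"
proof -
  have "\<exists>x. [int B * x = - \<delta>] (mod int l ^ (i + 1))" for i
  proof -
    have "coprime (int B) (int l ^ (i + 1))"
      using assms(1) by (simp add: coprime_commute)
    then obtain y where "[int B * y = 1] (mod int l ^ (i + 1))"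
      using cong_solve_coprime_int by blast
    then have "[int B * y * (- \<delta>) = 1 * (- \<delta>)] (mod int l ^ (i + 1))"
      by (rule cong_scalar_right)
    then show ?thesis by (metis mult.assoc mult_1)
  qed
  then obtain f where f: "\<And>i. [int B * f i = - \<delta>] (mod int l ^ (i + 1))" by metis
  define s where "s i = f i mod int l ^ (i + 1)" for i
  have s: "[int B * s i = - \<delta>] (mod int l ^ (i + 1))" for i
    using f[of i] unfolding s_def cong_def by (simp add: mod_mult_right_eq)
  have bd: "0 \<le> s i" "s i < int l ^ (i + 1)" for i
    using assms(2) by (auto simp: s_def)
  have step: "s (Suc i) mod int l ^ (i + 1) = s i" for i
  proof -
    have "[int B * s (Suc i) = - \<delta>] (mod int l ^ (i + 1))"
      using s[of "Suc i"] by (rule cong_dvd_modulus) (simp add: le_imp_power_dvd)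
    then have "[int B * s (Suc i) = int B * s i] (mod int l ^ (i + 1))"
      using s[of i] by (meson cong_sym cong_trans)
    moreover have "coprime (int B) (int l ^ (i + 1))"
      using assms(1) by (simp add: coprime_commute)
    ultimately have "[s (Suc i) = s i] (mod int l ^ (i + 1))"
      using cong_mult_lcancel by blast
    then show ?thesis using bd[of i] by (simp add: cong_def)
  qed
  define \<phi> where "\<phi> k = nat (s k div int l ^ k)" for k
  have \<phi>: "int (\<phi> k) = s k div int l ^ k" for k
    using bd[of k] assms(2) by (simp add: \<phi>_def pos_imp_zdiv_nonneg_iff)
  have sum: "(\<Sum>k\<le>i. int (\<phi> k) * int l ^ k) = s i" for i
  proof (induction i)
    case 0
    then show ?case by (simp add: \<phi>)
  next
    case (Suc i)
    have "(\<Sum>k\<le>Suc i. int (\<phi> k) * int l ^ k) = s i + s (Suc i) div int l ^ Suc i * int l ^ Suc i"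
      using Suc \<phi> by simp
    then show ?case using step[of i] by (metis Suc_eq_plus1 mod_div_mult_eq)
  qed
  have "\<phi> k < l" for k
  proof -
    have "s k div int l ^ k * int l ^ k + s k mod int l ^ k = s k"
      by (rule div_mult_mod_eq)
    moreover have "s k mod int l ^ k \<ge> 0"
      using assms(2) by simp
    ultimately have "int (\<phi> k) * int l ^ k \<le> s k"
      unfolding \<phi> by linarith
    then have "int (\<phi> k) * int l ^ k < int l * int l ^ k" using bd(2)[of k] by simp
    then show ?thesis by (simp add: assms(2))
  qed
  then have "is_ladic_digits l B \<delta> \<phi>"
    using s sum by (simp add: is_ladic_digits_def)
  then show ?thesis by blast
qed

lemma is_ladic_digits_ladic_digit:
  assumes "prime l" "\<not> l dvd B"
  shows "is_ladic_digits l B \<delta> (ladic_digit l B \<delta>)"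
proof -
  have "coprime l B" using assms by (simp add: prime_imp_coprime)
  moreover have "l > 0" using assms(1) prime_gt_0_nat by blast
  ultimately have "\<exists>!\<phi>. is_ladic_digits l B \<delta> \<phi>"
    using ladic_digits_exist ladic_digits_unique by metis
  then show ?thesis unfolding ladic_digit_def by (rule theI')
qed

end

theory Submission imports Defs begin

text \<open>
  The roots of \<open>X^n - \<lambda>'\<close> are the \<open>\<zeta>^(h z)\<close> with \<open>z \<equiv> 1 mod g\<close>, where \<open>\<zeta>\<close> has order \<open>n g\<close>, and
  Frobenius permutes them by \<open>z \<mapsto> q z\<close>; so one needs representatives of the orbits of
  multiplication by \<open>q\<close> on these residue classes \<open>z\<close>.

  Modulo \<open>n\<^sub>1 g\<close> the classes form a subgroup of the units, in which \<open>q\<close> generates exactly the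
  classes that are 1 modulo \<open>gcd (n\<^sub>1 g) (q - 1)\<close>, as lifting the exponent shows; if
  \<open>q \<equiv> 3 mod 4\<close> and the modulus is divisible by 4, the same holds for \<open>q\<^sup>2\<close>, and every coset
  contains a class that is 1 modulo 4. When a further prime power \<open>l^j\<close> is added to a modulus
  \<open>B\<close>, the lifts of \<open>\<delta>\<close> are \<open>\<delta> + B x\<close> with \<open>x\<close> modulo \<open>l^j\<close>. The stabilizer of \<open>\<delta>\<close> is generated
  by \<open>Q = q^\<theta>\<close>, which acts on \<open>x\<close> as an affine map with the fixed point \<open>\<phi> = - \<delta> / B\<close>, that
  is, as multiplication by \<open>Q\<close> on \<open>x - \<phi>\<close>. Its orbits are described by the valuation \<open>m\<close> of
  \<open>x - \<phi>\<close>, the class of its leading digit modulo the powers of \<open>Q\<close> (the index \<open>a\<close>) and the next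
  digits (the index \<open>t\<close>).

  For the explicit form, let \<open>M'\<close> be the order of the root \<open>\<alpha>\<close>. Then \<open>\<tau>\<close> is the order of \<open>q\<close> modulo
  \<open>M'\<close>, and lifting the exponent gives that \<open>M'\<close> divides \<open>t (q^\<omega> - 1)\<close> for \<open>t = \<tau> / \<omega>\<close>. So all
  conjugates of \<open>\<alpha>\<close> are roots of the product of the \<open>X^t - \<alpha>^(t q^i)\<close> over \<open>i < \<omega>\<close>, which has
  degree \<open>\<tau>\<close>.
\<close>

section \<open>Orders of integers congruent to 1\<close>


text \<open>The prime 2 shapes the proof. If l divides Q - 1, then \<open>Q ^ t - 1\<close> gains
  one factor l for each factor l of t, except when l = 2 and Q is 3 modulo 4. For moduli not
  divisible by 8 the exception is harmless, since \<open>4 dvd Q ^ t - 1\<close> and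
  \<open>4 dvd t * (Q - 1)\<close> then both say that t is even; this is the origin of the condition
  on 8 in \<omega>. Elsewhere the remedy is to pass to the square of Q, which is 1 modulo 4.

  The order of a root is carried through the recursion as an annihilator: that the modulus divides
  \<open>\<delta> * w\<close> is reduced to the base modulus and to powers of the new primes
  dividing w. This invariant separates the values of m in the uniqueness proof and also yields M'.

  Identities of polynomials are proved by counting: a monic polynomial whose degree is the number of
  its known roots is the product of their linear factors. Surjectivity onto residue classes is
  mostly obtained by counting as well.\<close>

lemma nat_power_minus_one: "Q > 0 \<Longrightarrow> (Q::nat) ^ t - 1 = (Q - 1) * (\<Sum>i<t. Q ^ i)"
proof -
  assume "Q > 0"
  then have "int (Q ^ t - 1) = int ((Q - 1) * (\<Sum>i<t. Q ^ i))"
    using power_diff_1_eq[of "int Q" t] by (simp add: of_nat_diff)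
  then show ?thesis by linarith
qed

lemma geometric_sum_cong:
  fixes x :: nat
  assumes "[x = 1] (mod m)"
  shows "[(\<Sum>i<t. x ^ i) = t] (mod m)"
proof -
  have "[(\<Sum>i<t. x ^ i) = (\<Sum>i<t. 1)] (mod m)"
    by (rule cong_sum) (use cong_pow[OF assms] in auto)
  then show ?thesis by simp
qed

lemma power_one_plus_cong: "[(1 + l * k) ^ i = 1 + i * (l * k)] (mod l ^ 2)" for l :: nat
proof (induction i)
  case (Suc i)
  have "[(1 + l * k) ^ Suc i = (1 + l * k) * (1 + i * (l * k))] (mod l ^ 2)"
    unfolding power_Suc by (rule cong_scalar_left[OF Suc])
  also have "(1 + l * k) * (1 + i * (l * k)) = l ^ 2 * (i * k * k) + (1 + Suc i * (l * k))"
    by (simp add: algebra_simps power2_eq_square)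
  also have "[\<dots> = 1 + Suc i * (l * k)] (mod l ^ 2)" by (simp add: cong_def)
  finally show ?case .
qed simp

text \<open>Modulo \<open>l ^ 2\<close> only the linear term of each power of
  \<open>Q = 1 + l * k\<close> survives, and these terms add up to \<open>l * k\<close> times the
  sum of the \<open>i < l\<close>, which is divisible by l for odd l. For l = 2 that sum is 1, so
  the hypothesis on 4 has to make \<open>1 + Q\<close> congruent to 2 modulo 4.\<close>

lemma multiplicity_geometric_sum:
  fixes Q l :: nat
  assumes "prime l" "Q > 0" "l dvd Q - 1" "l = 2 \<longrightarrow> 4 dvd Q - 1"
  shows "multiplicity l (\<Sum>i<l. Q ^ i) = 1"
proof -
  obtain k where k: "Q = 1 + l * k" using assms(2,3) proof -
    from assms(3) obtain k where "Q - 1 = l * k" by blast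
    then have "Q = 1 + l * k" using assms(2) by simp
    then show ?thesis using that by blast
  qed
  have "[(\<Sum>i<l. Q ^ i) = l] (mod l ^ 2)"
  proof (cases "l = 2")
    case True
    then obtain c where "Q - 1 = 4 * c" using assms(4) by (auto simp: dvd_def)
    then have "Q = 4 * c + 1" using assms(2) by simp
    then have "(\<Sum>i<l. Q ^ i) = 4 * c + 2" using True by (simp add: lessThan_nat_numeral)
    then show ?thesis using True by (simp add: cong_def) presburger
  next
    case False
    then have "l > 2" using prime_ge_2_nat[OF assms(1)] by simp
    then have "odd l" using assms(1) prime_odd_nat by blast
    then obtain c where c: "l = 2 * c + 1" by (auto elim: oddE)
    have s: "(\<Sum>i<l. i) = l * c"
    proof -
      have "2 * (\<Sum>i<k. i) = k * (k - 1)" for k :: nat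
        proof (induction k)
        case (Suc k)
        then show ?case by (cases k) (auto simp: algebra_simps)
      qed simp
      from this[of l]
      show ?thesis using c by simp
    qed
    have "[(\<Sum>i<l. Q ^ i) = (\<Sum>i<l. 1 + i * (l * k))] (mod l ^ 2)"
      unfolding k by (intro cong_sum power_one_plus_cong)
    also have "(\<Sum>i<l. 1 + i * (l * k)) = l + (\<Sum>i<l. i) * (l * k)"
      by (simp add: sum_distrib_right sum_Suc)
    also have "\<dots> = l ^ 2 * (c * k) + l" unfolding s by (simp add: power2_eq_square)
    also have "[\<dots> = l] (mod l ^ 2)" by (simp add: cong_def)
    finally show ?thesis .
  qed
  then have m: "(\<Sum>i<l. Q ^ i) mod l ^ 2 = l mod l ^ 2" by (simp add: cong_def)
  have l: "l > 1" using assms(1) prime_gt_1_nat by blast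
  then have "l mod l ^ 2 = l" by (simp add: power2_eq_square)
  with m have m: "(\<Sum>i<l. Q ^ i) mod l ^ 2 = l" by simp
  show ?thesis
  proof (rule multiplicity_eqI)
    have "l dvd (\<Sum>i<l. Q ^ i) mod l ^ 2" using m by simp
    then show "l ^ 1 dvd (\<Sum>i<l. Q ^ i)" by (simp add: dvd_mod_iff power2_eq_square)
    show "\<not> l ^ Suc 1 dvd (\<Sum>i<l. Q ^ i)"
    proof
      assume "l ^ Suc 1 dvd (\<Sum>i<l. Q ^ i)"
      then have "(\<Sum>i<l. Q ^ i) mod l ^ 2 = 0" by (simp add: power2_eq_square)
      then show False using m l by simp
    qed
  qed
qed

text \<open>Lifting the exponent. Each factor l of t contributes a geometric sum of length l, of
  valuation 1; for t prime to l the whole sum is congruent to t modulo l and contributes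
  nothing.\<close>

lemma multiplicity_power_minus_one:
  fixes Q l t :: nat
  assumes "prime l" "Q > 1" "l dvd Q - 1" "l = 2 \<longrightarrow> 4 dvd Q - 1" "t > 0"
  shows "multiplicity l (Q ^ t - 1) = multiplicity l (Q - 1) + multiplicity l t"
  using assms(5)
proof (induction t rule: less_induct)
  case (less t)
  have l: "prime_elem l" "l > 1" using assms(1) prime_gt_1_nat by auto
  show ?case
  proof (cases "l dvd t")
    case False
    have "[Q = 1] (mod l)" using assms(2,3) by (simp add: cong_iff_dvd_diff cong_to_1_nat cong_altdef_nat)
    then have "[(\<Sum>i<t. Q ^ i) = t] (mod l)" by (rule geometric_sum_cong)
    then have "\<not> l dvd (\<Sum>i<t. Q ^ i)" using False cong_dvd_iff by blast
    moreover have "(\<Sum>i<t. Q ^ i) \<noteq> 0" using calculation by (metis dvd_0_right)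
    ultimately show ?thesis using False assms(2) l
      by (subst nat_power_minus_one) (auto simp: prime_elem_multiplicity_mult_distrib not_dvd_imp_multiplicity_0)
  next
    case True
    then obtain s where s: "t = l * s" by (auto simp: dvd_def)
    with less.prems l have s0: "s > 0" "s < t" by auto
    let ?P = "Q ^ s"
    have P: "?P > 1" using one_less_power[OF assms(2) s0(1)] .
    have dv: "Q - 1 dvd ?P - 1" using nat_power_minus_one[of Q s] assms(2) by simp
    have "Q ^ t - 1 = ?P ^ l - 1" by (simp only: s power_mult[symmetric] mult.commute[of s])
    also have "\<dots> = (?P - 1) * (\<Sum>i<l. ?P ^ i)" by (rule nat_power_minus_one) (use P in linarith)
    finally have e: "Q ^ t - 1 = (?P - 1) * (\<Sum>i<l. ?P ^ i)" .
    have S: "multiplicity l (\<Sum>i<l. ?P ^ i) = 1"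
    proof (rule multiplicity_geometric_sum)
      show "l dvd ?P - 1" using assms(3) dv by (rule dvd_trans)
      show "l = 2 \<longrightarrow> 4 dvd ?P - 1" using assms(4) dv dvd_trans by blast
    qed (use assms(1) P in linarith)+
    then have "(\<Sum>i<l. ?P ^ i) \<noteq> 0" by (metis multiplicity_zero zero_neq_one)
    then show ?thesis unfolding e using less.IH[OF s0(2,1)] S P l s s0
      by (simp add: prime_elem_multiplicity_mult_distrib)
  qed
qed

lemma dvd_iff_prime_power_dvd:
  fixes M Y :: nat
  assumes "M > 0"
  shows "M dvd Y \<longleftrightarrow> (\<forall>l. prime l \<longrightarrow> l ^ multiplicity l M dvd Y)"
proof
  assume "M dvd Y" then show "\<forall>l. prime l \<longrightarrow> l ^ multiplicity l M dvd Y"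
    by (meson dvd_trans multiplicity_dvd)
next
  assume H: "\<forall>l. prime l \<longrightarrow> l ^ multiplicity l M dvd Y"
  show "M dvd Y"
  proof (cases "Y = 0")
    case False
    show ?thesis
    proof (rule multiplicity_le_imp_dvd)
      fix l :: nat assume "prime l"
      then show "multiplicity l M \<le> multiplicity l Y"
        using H False by (intro multiplicity_geI) (auto simp: prime_gt_1_nat)
    qed (use assms in auto)
  qed simp
qed

text \<open>At each prime where lifting the exponent applies, both sides have the same valuation.
  The hypothesis asks for 4 only if 8 divides M: for Q congruent to 3 modulo 4 the valuations at 2
  may differ, but not as far as divisibility by 2 or 4 is concerned.\<close>

lemma dvd_power_minus_one_iff:
  fixes Q M t :: nat
  assumes "M > 0" "Q > 1" and rad: "\<And>l. prime l \<Longrightarrow> l dvd M \<Longrightarrow> l dvd Q - 1"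
    and four: "8 dvd M \<Longrightarrow> 4 dvd Q - 1"
  shows "M dvd Q ^ t - 1 \<longleftrightarrow> M dvd t * (Q - 1)"
proof (cases "t = 0")
  case False
  have "l ^ multiplicity l M dvd Q ^ t - 1 \<longleftrightarrow> l ^ multiplicity l M dvd t * (Q - 1)"
    if l: "prime l" for l
  proof (cases "l dvd M \<and> (l = 2 \<longrightarrow> 4 dvd Q - 1)")
    case True
    have "multiplicity l (Q ^ t - 1) = multiplicity l (t * (Q - 1))"
      using True l rad[OF l] assms(2) False
      by (subst multiplicity_power_minus_one) (auto simp: prime_elem_multiplicity_mult_distrib)
    moreover have "Q ^ t - 1 \<noteq> 0" "t * (Q - 1) \<noteq> 0"
      using assms(2) False one_less_power[of Q t] by auto
    moreover have "\<not> is_unit l" using l by auto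
    ultimately show ?thesis by (simp add: power_dvd_iff_le_multiplicity)
  next
    case F: False
    show ?thesis
    proof (cases "l dvd M")
      case False
      then show ?thesis by (simp add: not_dvd_imp_multiplicity_0)
    next
      case True
      \<comment> \<open>The one prime without lifting is 2, with Q congruent to 3 modulo 4. Here 8
        does not divide M, so only divisibility by 2 and by 4 has to be compared.\<close>
      with F have l2: "l = 2" "\<not> 4 dvd Q - 1" by auto
      then have "\<not> 2 ^ 3 dvd M" using four by auto
      then have "multiplicity 2 M < 3" using assms(1)
        by (meson linorder_not_less multiplicity_dvd' )
      moreover have "multiplicity 2 M \<noteq> 0" using True l2 assms(1)
        by (simp add: multiplicity_eq_zero_iff)
      ultimately have a: "multiplicity 2 M = 1 \<or> multiplicity 2 M = 2" by linarith
      have "2 dvd Q - 1" using rad[OF l] True l2 by simp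
      have Q: "Q mod 4 = 3" using \<open>2 dvd Q - 1\<close> l2(2) assms(2) by presburger
      have P: "Q ^ t mod 4 = (if even t then 1 else 3)"
      proof (induction t)
        case (Suc t)
        have "Q ^ Suc t mod 4 = (Q mod 4) * (Q ^ t mod 4) mod 4" by (simp add: mod_mult_eq)
        then show ?case using Suc Q by (auto split: if_splits)
      qed auto
      have "4 dvd Q ^ t - 1 \<longleftrightarrow> even t" "2 dvd Q ^ t - 1"
      proof -
        define Z where "Z = Q ^ t"
        have "(4 dvd Z - 1 \<longleftrightarrow> even t) \<and> 2 dvd Z - 1"
        proof (cases "even t")
          case True
          then have "Z mod 4 = 1" using P by (simp add: Z_def)
          then have "4 dvd Z - 1" "2 dvd Z - 1" by presburger+
          then show ?thesis using True by simp
        next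
          case False
          then have "Z mod 4 = 3" using P by (simp add: Z_def)
          then have "\<not> 4 dvd Z - 1" "2 dvd Z - 1" by presburger+
          then show ?thesis using False by simp
        qed
        then show "4 dvd Q ^ t - 1 \<longleftrightarrow> even t" "2 dvd Q ^ t - 1" by (simp_all add: Z_def)
      qed
      moreover have "4 dvd t * (Q - 1) \<longleftrightarrow> even t" 
      proof -
        obtain c where c: "Q - 1 = 2 * c" using \<open>2 dvd Q - 1\<close> unfolding dvd_def by blast
        then have "odd c" using l2(2) by auto
        have "4 dvd 2 * x \<longleftrightarrow> 2 dvd x" for x :: nat by presburger
        then have "4 dvd t * (Q - 1) \<longleftrightarrow> 2 dvd t * c" unfolding c mult.left_commute[of t 2] by auto
        then show ?thesis using \<open>odd c\<close> by auto
      qed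
      moreover have "2 dvd t * (Q - 1)" using \<open>2 dvd Q - 1\<close> by simp
      ultimately show ?thesis using a l2 by auto
    qed
  qed
  then show ?thesis using dvd_iff_prime_power_dvd[OF assms(1)] by blast
qed simp


lemma ord_eq_div_gcd:
  fixes Q M :: nat
  assumes "M > 0" "Q > 1" "\<And>l. prime l \<Longrightarrow> l dvd M \<Longrightarrow> l dvd Q - 1" "8 dvd M \<Longrightarrow> 4 dvd Q - 1"
  shows "ord M Q = M div gcd M (Q - 1)"
proof -
  have "ord M Q dvd t \<longleftrightarrow> M div gcd M (Q - 1) dvd t" for t
  proof -
    have "ord M Q dvd t \<longleftrightarrow> [Q ^ t = 1] (mod M)" unfolding ord_divides ..
    also have "\<dots> \<longleftrightarrow> M dvd Q ^ t - 1"
      using assms(2) by (simp add: cong_altdef_nat)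
    also have "\<dots> \<longleftrightarrow> M dvd t * (Q - 1)" by (rule dvd_power_minus_one_iff) (use assms in auto)
    also have "\<dots> \<longleftrightarrow> M div gcd M (Q - 1) dvd t"
    proof -
      define G where "G = gcd M (Q - 1)"
      have G: "G > 0" "G dvd M" "G dvd Q - 1" using assms(1) by (auto simp: G_def)
      obtain m r where m: "M = G * m" "Q - 1 = G * r" using G(2,3) by (meson dvdE)
      have "coprime (M div G) ((Q - 1) div G)"
        unfolding G_def using assms(1,2) by (intro div_gcd_coprime) simp
      then have "coprime m r" using G(1) unfolding m by simp
      then have "m dvd t * r \<longleftrightarrow> m dvd t" by (rule coprime_dvd_mult_left_iff)
      moreover have "M div G = m" using G(1) m(1) by simp
      moreover have "M dvd t * (Q - 1) \<longleftrightarrow> m dvd t * r"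
        unfolding m mult.left_commute[of t G] using G(1) by simp
      ultimately show ?thesis unfolding G_def[symmetric] by simp
    qed
    finally show ?thesis .
  qed
  from this[of "ord M Q"] this[of "M div gcd M (Q - 1)"] show ?thesis by (simp add: dvd_antisym)
qed

text \<open>Counting: all powers of Q are 1 modulo \<open>gcd M (Q - 1)\<close>, the formula for the
  order gives \<open>M div gcd M (Q - 1)\<close> of them modulo M, and there are no more residues of
  that kind.\<close>

lemma power_cong_one_mod_gcd:
  fixes Q M :: nat and x :: int
  assumes "M > 0" "Q > 1" "\<And>l. prime l \<Longrightarrow> l dvd M \<Longrightarrow> l dvd Q - 1" "8 dvd M \<Longrightarrow> 4 dvd Q - 1"
    and x: "[x = 1] (mod int (gcd M (Q - 1)))"
  shows "\<exists>i. [int Q ^ i = x] (mod int M)"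
proof -
  define D where "D = gcd M (Q - 1)"
  have D: "D > 0" "D dvd M" "D dvd Q - 1" using assms(1) by (auto simp: D_def)
  define A where "A = {z \<in> {0..<int M}. [z = 1] (mod int D)}"
  define f where "f i = int Q ^ i mod int M" for i
  have ord: "ord M Q = M div D" unfolding D_def by (rule ord_eq_div_gcd) (use assms in auto)
  have "coprime M Q"
  proof (rule ccontr)
    assume "\<not> coprime M Q"
    then have "gcd M Q \<noteq> 1" unfolding coprime_iff_gcd_eq_1 .
    then obtain l where "prime l" "l dvd gcd M Q" using prime_factor_nat by blast
    then have "l dvd M" "l dvd Q" by auto
    with assms(3)[OF \<open>prime l\<close>] have "l dvd Q - (Q - 1)" using dvd_diff_nat by blast
    then have "l dvd 1" using assms(2) by simp
    with \<open>prime l\<close> show False by auto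
  qed
  have "inj_on f {..<ord M Q}"
  proof -
    have "inj_on (\<lambda>i. Q ^ i mod M) {..<ord M Q}" using inj_power_mod[OF \<open>coprime M Q\<close>] .
    moreover have "f i = int (Q ^ i mod M)" for i by (simp add: f_def zmod_int)
    ultimately show ?thesis by (auto simp: inj_on_def)
  qed
  moreover have sub: "f ` {..<ord M Q} \<subseteq> A"
  proof -
    have "[int Q ^ i = 1] (mod int D)" for i
    proof -
      have "int D dvd int (Q - 1)" using D(3) by (simp only: int_dvd_int_iff)
      then have "[int Q = 1] (mod int D)" using assms(2) by (simp add: cong_iff_dvd_diff of_nat_diff)
      from cong_pow[OF this, of i] show ?thesis by simp
    qed
    then have "[f i = 1] (mod int D)" for i
      unfolding f_def using D(2) by (simp add: cong_def mod_mod_cancel)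
    then show ?thesis using assms(1) by (auto simp: A_def f_def)
  qed
  moreover have "card A \<le> M div D"
  proof -
    have "A \<subseteq> (\<lambda>k. (1 + int D * k) mod int M) ` {0..<int (M div D)}"
    proof
      fix z assume "z \<in> A"
      then have z: "0 \<le> z" "z < int M" "[z = 1] (mod int D)" by (auto simp: A_def)
      from cong_sym[OF z(3)] obtain k where k: "z = 1 + int D * k" unfolding cong_iff_lin by blast
      let ?k = "k mod int (M div D)"
      have M: "int M = int D * int (M div D)" unfolding of_nat_mult[symmetric] using D(2) by simp
      have "[1 + int D * ?k = 1 + int D * k] (mod int M)"
        unfolding M using D(1) by (intro cong_add cong_refl) (simp add: cong_def mod_mult_mult1)
      then have "z = (1 + int D * ?k) mod int M" using z k by (simp add: cong_def)
      moreover have "?k \<in> {0..<int (M div D)}" using D assms(1) by (auto simp: dvd_imp_le div_greater_zero_iff)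
      ultimately show "z \<in> (\<lambda>k. (1 + int D * k) mod int M) ` {0..<int (M div D)}" by blast
    qed
    then have "card A \<le> card {0..<int (M div D)}" by (rule surj_card_le[rotated]) simp
    then show ?thesis by simp
  qed
  moreover have "finite A" by (rule finite_subset[of _ "{0..<int M}"]) (auto simp: A_def)
  ultimately have "f ` {..<ord M Q} = A"
    using ord by (intro card_seteq) (auto simp: card_image)
  moreover have "x mod int M \<in> A"
    using x D(2) assms(1) unfolding A_def D_def[symmetric] by (auto simp: cong_def mod_mod_cancel)
  ultimately show ?thesis by (auto simp: f_def cong_def image_iff)
qed

section \<open>Cyclotomic cosets\<close>


text \<open>The relation is encoded by an exponent, not by equality of sets, so that it passes to
  divisors of the modulus and to multiples of both sides without conditions. Only symmetry asks q to
  be a unit.\<close>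

definition same_coset :: "nat \<Rightarrow> nat \<Rightarrow> int \<Rightarrow> int \<Rightarrow> bool" where
  "same_coset q M x y \<longleftrightarrow> (\<exists>i. [x * int q ^ i = y] (mod int M))"

lemma same_cosetI: "[x * int q ^ i = y] (mod int M) \<Longrightarrow> same_coset q M x y"
  by (auto simp: same_coset_def)

lemma same_coset_cong: "[x = y] (mod int M) \<Longrightarrow> same_coset q M x y"
  by (rule same_cosetI[of _ _ 0]) simp

lemma same_coset_refl [simp]: "same_coset q M x x"
  by (rule same_coset_cong) simp

lemma same_coset_trans:
  assumes "same_coset q M x y" "same_coset q M y z"
  shows "same_coset q M x z"
proof -
  obtain i j where i: "[x * int q ^ i = y] (mod int M)" and j: "[y * int q ^ j = z] (mod int M)"
    using assms by (auto simp: same_coset_def)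
  have "[x * int q ^ i * int q ^ j = y * int q ^ j] (mod int M)" using i by (rule cong_scalar_right)
  from cong_trans[OF this j] have "[x * int q ^ (i + j) = z] (mod int M)"
    by (simp add: mult.assoc power_add)
  then show ?thesis by (rule same_cosetI)
qed

lemma int_power_ord_cong: "[int q ^ ord M q = 1] (mod int M)"
  using ord[of q M] by (metis cong_int_iff of_nat_1 of_nat_power)

lemma same_coset_sym:
  assumes "coprime M q" "same_coset q M x y"
  shows "same_coset q M y x"
proof -
  obtain i where i: "[x * int q ^ i = y] (mod int M)"
    using assms by (auto simp: same_coset_def)
  \<comment> \<open>This exponent completes i to a multiple of the order of q, so it undoes
    multiplication by \<open>q ^ i\<close>.\<close>
  let ?j = "(ord M q - 1) * i"
  have "ord M q > 0" using assms(1) by (simp add: ord_gt_0_iff)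
  then have e: "i + ?j = ord M q * i" by (metis Suc_diff_1 mult_Suc)
  have "[y * int q ^ ?j = x * int q ^ i * int q ^ ?j] (mod int M)"
    using cong_sym[OF i] by (rule cong_scalar_right)
  also have "x * int q ^ i * int q ^ ?j = x * (int q ^ ord M q) ^ i"
    using e by (simp only: mult.assoc power_add[symmetric] power_mult[symmetric])
  also have "[\<dots> = x * 1 ^ i] (mod int M)"
    by (intro cong_mult cong_pow cong_refl int_power_ord_cong)
  finally have "[y * int q ^ ?j = x] (mod int M)" by simp
  then show ?thesis by (rule same_cosetI)
qed

lemma same_coset_dvd_modulus:
  "same_coset q M x y \<Longrightarrow> M' dvd M \<Longrightarrow> same_coset q M' x y"
  unfolding same_coset_def by (meson cong_dvd_modulus int_dvd_int_iff)

lemma same_coset_mult: "same_coset q M x y \<Longrightarrow> same_coset q M (h * x) (h * y)"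
proof -
  assume "same_coset q M x y"
  then obtain i where "[x * int q ^ i = y] (mod int M)" by (auto simp: same_coset_def)
  then have "[h * (x * int q ^ i) = h * y] (mod int M)" by (rule cong_scalar_left)
  then show ?thesis by (intro same_cosetI[of _ _ i]) (simp only: mult.assoc)
qed

lemma same_coset_mult_cancel:
  assumes "coprime h (int M)"
  shows "same_coset q M (h * x) (h * y) \<longleftrightarrow> same_coset q M x y"
proof
  assume "same_coset q M (h * x) (h * y)"
  then obtain i where "[h * (x * int q ^ i) = h * y] (mod int M)"
    by (auto simp: same_coset_def mult.assoc)
  then have "[x * int q ^ i = y] (mod int M)" using assms by (simp add: cong_mult_lcancel)
  then show "same_coset q M x y" by (rule same_cosetI)
qed (rule same_coset_mult)

lemma cyc_size_props:
  assumes "coprime M q"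
  shows "cyc_size q M \<gamma> > 0" "[\<gamma> * int q ^ cyc_size q M \<gamma> = \<gamma>] (mod int M)"
proof -
  have "[\<gamma> * int q ^ ord M q = \<gamma> * 1] (mod int M)"
    by (intro cong_mult cong_refl int_power_ord_cong)
  then have "ord M q > 0 \<and> [\<gamma> * int q ^ ord M q = \<gamma>] (mod int M)"
    using assms by (simp add: ord_gt_0_iff)
  from LeastI[of "\<lambda>t. t > 0 \<and> [\<gamma> * int q ^ t = \<gamma>] (mod int M)", OF this]
  show "cyc_size q M \<gamma> > 0" "[\<gamma> * int q ^ cyc_size q M \<gamma> = \<gamma>] (mod int M)"
    by (auto simp: cyc_size_def)
qed

lemma cong_power_mult:
  fixes \<gamma> :: int
  assumes "[\<gamma> * a = \<gamma>] (mod m)"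
  shows "[\<gamma> * a ^ k = \<gamma>] (mod m)"
proof (induction k)
  case (Suc k)
  have "[\<gamma> * a ^ k * a = \<gamma> * a] (mod m)" using Suc by (rule cong_scalar_right)
  from cong_trans[OF this assms] show ?case by (simp add: mult.left_commute mult.commute)
qed simp

lemma cyc_size_dvd_iff:
  assumes "coprime M q"
  shows "[\<gamma> * int q ^ t = \<gamma>] (mod int M) \<longleftrightarrow> cyc_size q M \<gamma> dvd t"
proof
  let ?c = "cyc_size q M \<gamma>"
  have c: "[\<gamma> * int q ^ (?c * k) = \<gamma>] (mod int M)" for k
    using cong_power_mult[OF cyc_size_props(2)[OF assms]] by (simp add: power_mult)
  {
    assume t: "[\<gamma> * int q ^ t = \<gamma>] (mod int M)"
    have "[\<gamma> * int q ^ (t mod ?c) = \<gamma> * int q ^ (?c * (t div ?c)) * int q ^ (t mod ?c)] (mod int M)"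
      using cong_sym[OF c] by (rule cong_scalar_right)
    also have "\<gamma> * int q ^ (?c * (t div ?c)) * int q ^ (t mod ?c) = \<gamma> * int q ^ t"
      unfolding mult.assoc power_add[symmetric] by simp
    also note t
    finally have "[\<gamma> * int q ^ (t mod ?c) = \<gamma>] (mod int M)" .
    moreover have "t mod ?c < ?c" using cyc_size_props(1)[OF assms] by simp
    moreover have "?c \<le> k" if "k > 0 \<and> [\<gamma> * int q ^ k = \<gamma>] (mod int M)" for k
      using that unfolding cyc_size_def by (rule Least_le)
    ultimately have "t mod ?c = 0" by (meson not_gr_zero not_less)
    then show "?c dvd t" by (rule mod_0_imp_dvd)
  }
  show "?c dvd t \<Longrightarrow> [\<gamma> * int q ^ t = \<gamma>] (mod int M)" using c by auto
qed

text \<open>A coset size is pinned down by all its periods at once; later sizes are computed from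
  equivalences, with no argument about minimality.\<close>

lemma cyc_size_eqI:
  assumes "coprime M q" "\<And>t. [\<gamma> * int q ^ t = \<gamma>] (mod int M) \<longleftrightarrow> c dvd t"
  shows "cyc_size q M \<gamma> = c"
proof -
  have "cyc_size q M \<gamma> dvd t \<longleftrightarrow> c dvd t" for t
    using assms(2) cyc_size_dvd_iff[OF assms(1)] by blast
  from this[of c] this[of "cyc_size q M \<gamma>"] show ?thesis by (simp add: dvd_antisym)
qed

lemma cyc_coset_eq:
  assumes "coprime M q" "M > 0"
  shows "cyc_coset q M \<gamma> = {z \<in> {0..<int M}. same_coset q M \<gamma> z}"
proof safe
  fix z assume "z \<in> {0..<int M}" "same_coset q M \<gamma> z"
  then obtain i where i: "[\<gamma> * int q ^ i = z] (mod int M)" "z \<in> {0..<int M}"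
    by (auto simp: same_coset_def)
  let ?c = "cyc_size q M \<gamma>"
  have "[\<gamma> * int q ^ (?c * (i div ?c)) * int q ^ (i mod ?c) = \<gamma> * int q ^ (i mod ?c)] (mod int M)"
    by (rule cong_scalar_right) (simp add: cyc_size_dvd_iff[OF assms(1)])
  then have "[\<gamma> * int q ^ i = \<gamma> * int q ^ (i mod ?c)] (mod int M)"
    unfolding mult.assoc power_add[symmetric] mult_div_mod_eq .
  then have "z = (\<gamma> * int q ^ (i mod ?c)) mod int M"
    using i by (simp add: cong_def)
  then show "z \<in> cyc_coset q M \<gamma>" using cyc_size_props(1)[OF assms(1)] by (auto simp: cyc_coset_def)
qed (use assms in \<open>auto simp: cyc_coset_def same_coset_def cong_def\<close>)

lemma inj_on_cyc_coset:
  assumes "coprime M q"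
  shows "inj_on (\<lambda>i. (\<gamma> * int q ^ i) mod int M) {..<cyc_size q M \<gamma>}"
proof -
  have *: "i = j" if "i \<le> j" "j < cyc_size q M \<gamma>" "[\<gamma> * int q ^ i = \<gamma> * int q ^ j] (mod int M)" for i j
  proof -
    have "int q ^ j = int q ^ i * int q ^ (j - i)" using that(1) by (simp flip: power_add)
    then have "[int q ^ i * \<gamma> = int q ^ i * (\<gamma> * int q ^ (j - i))] (mod int M)"
      using that(3) by (simp only: mult.commute mult.left_commute)
    moreover have "coprime (int q ^ i) (int M)" using assms by (simp add: coprime_commute)
    ultimately have "[\<gamma> * int q ^ (j - i) = \<gamma>] (mod int M)"
      using cong_mult_lcancel cong_sym by blast
    then have "cyc_size q M \<gamma> dvd j - i" using cyc_size_dvd_iff[OF assms] by blast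
    then show ?thesis using that by (auto dest: dvd_imp_le)
  qed
  show ?thesis
  proof (rule inj_onI)
    fix i j assume "i \<in> {..<cyc_size q M \<gamma>}" "j \<in> {..<cyc_size q M \<gamma>}"
      "(\<gamma> * int q ^ i) mod int M = (\<gamma> * int q ^ j) mod int M"
    then show "i = j" using *[of i j] *[of j i] by (cases "i \<le> j") (auto simp: cong_def)
  qed
qed

lemma card_cyc_coset: "coprime M q \<Longrightarrow> card (cyc_coset q M \<gamma>) = cyc_size q M \<gamma>"
  unfolding cyc_coset_def by (simp add: card_image inj_on_cyc_coset)

lemma bij_betw_nth_smallest:
  assumes "finite S"
  shows "bij_betw (nth_smallest S) {1..card S} S"
proof -
  have "bij_betw (\<lambda>a. a - 1) {1..card S} {..<card S}"
    by (rule bij_betwI[of _ _ _ Suc]) auto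
  moreover have "bij_betw (\<lambda>i. sorted_list_of_set S ! i) {..<card S} S"
    using assms by (intro bij_betw_nth) auto
  ultimately have "bij_betw ((\<lambda>i. sorted_list_of_set S ! i) \<circ> (\<lambda>a. a - 1)) {1..card S} S"
    by (rule bij_betw_trans)
  then show ?thesis by (simp add: nth_smallest_def[abs_def] comp_def)
qed

section \<open>Cosets of the powers of an integer in the units modulo a prime\<close>

context
  fixes l a :: nat
  assumes l: "prime l" and a: "\<not> l dvd a"
begin

interpretation rp: residues_prime l "residue_ring (int l)"
  using l by unfold_locales auto

interpretation ug: group "unit_group l"
  by (rule rp.units_group)

lemma carrier_unit_group: "carrier (unit_group l) = {1..int l - 1}"
  using prime_gt_0_nat[OF l] by (simp add: units_of_carrier rp.res_prime_units_eq of_nat_diff)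

lemma finite_unit_group: "finite (carrier (unit_group l))"
  by (simp add: units_of_carrier)

lemma mod_in_unit_group: "\<not> int l dvd x \<Longrightarrow> x mod int l \<in> carrier (unit_group l)"
  unfolding carrier_unit_group atLeastAtMost_iff dvd_eq_mod_eq_0
  using pos_mod_sign[of "int l" x] pos_mod_bound[of "int l" x] prime_gt_0_nat[OF l] by linarith

lemma powers_mod_eq: "powers_mod l a = (\<lambda>i. int a ^ i mod int l) ` UNIV"
proof -
  have c: "int a mod int l \<in> carrier (unit_group l)" using a by (intro mod_in_unit_group) auto
  have "(int a mod int l) [^]\<^bsub>unit_group l\<^esub> i = int a ^ i mod int l" for i :: nat
    using rp.units_of_pow[of "int a mod int l" i] c rp.pow_cong[of "int a" i]
    by (simp add: units_of_carrier)
  then show ?thesis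
    unfolding powers_mod_def ug.generate_pow_on_finite_carrier[OF finite_unit_group c] by auto
qed

lemma subgroup_powers_mod: "subgroup (powers_mod l a) (unit_group l)"
  unfolding powers_mod_def
  by (intro ug.generate_is_subgroup) (use a mod_in_unit_group[of "int a"] in auto)

lemma card_powers_mod: "card (powers_mod l a) = ord l a"
proof -
  have cop: "coprime l a" using l a by (simp add: prime_imp_coprime)
  have "powers_mod l a = int ` (\<lambda>i. a ^ i mod l) ` {..<ord l a}"
  proof -
    have "a ^ i mod l \<in> (\<lambda>i. a ^ i mod l) ` {..<ord l a}" for i
    proof -
      have "[a ^ i = a ^ (i mod ord l a)] (mod l)"
        unfolding order_divides_expdiff[OF cop] by (simp add: cong_def)
      moreover have "i mod ord l a < ord l a" using cop by (simp add: ord_gt_0_iff)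
      ultimately show ?thesis by (auto simp: cong_def)
    qed
    then have "(\<lambda>i. a ^ i mod l) ` UNIV = (\<lambda>i. a ^ i mod l) ` {..<ord l a}" by blast
    then show ?thesis unfolding powers_mod_eq image_image
      by (metis (mono_tags, lifting) image_cong image_image of_nat_power zmod_int)
  qed
  also have "card \<dots> = ord l a"
    by (subst card_image; (subst card_image)?) (use inj_power_mod[OF cop] in \<open>auto simp: inj_on_def\<close>)
  finally show ?thesis .
qed

text \<open>Lagrange's theorem. It turns the quotients of l - 1 by the index r in the construction
  into orders modulo l.\<close>

lemma unit_index_mult_ord: "unit_index l a * ord l a = l - 1"
  using ug.lagrange_finite[OF finite_unit_group subgroup_powers_mod] prime_gt_0_nat[OF l]
  by (simp add: unit_index_def card_powers_mod Coset.order_def carrier_unit_group nat_diff_distrib)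

lemma mem_rcoset_iff:
  assumes "x \<in> {1..int l - 1}"
  shows "y \<in> powers_mod l a #>\<^bsub>unit_group l\<^esub> x \<longleftrightarrow>
    y \<in> {1..int l - 1} \<and> (\<exists>i. [x * int a ^ i = y] (mod int l))"
proof -
  have "y \<in> powers_mod l a #>\<^bsub>unit_group l\<^esub> x \<longleftrightarrow> (\<exists>i. y = x * int a ^ i mod int l)"
    by (auto simp: r_coset_def powers_mod_eq units_of_mult rp.res_mult_eq mod_mult_left_eq mult.commute[of x])
  moreover have "x * int a ^ i mod int l \<in> {1..int l - 1}" for i
  proof -
    have "\<not> int l dvd x" using assms by (auto simp: zdvd_not_zless)
    moreover have "\<not> int l dvd int a ^ i"
      using a l by (metis int_dvd_int_iff of_nat_power prime_dvd_power)
    ultimately have "\<not> int l dvd x * int a ^ i" using l by (simp add: prime_dvd_mult_iff)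
    then show ?thesis using mod_in_unit_group carrier_unit_group by blast
  qed
  ultimately show ?thesis by (auto simp: cong_def)
qed

text \<open>Replaces the group-theoretic description of the representatives by congruences. Their
  number is the index because sending an element to its coset is a bijection from R onto the set of
  cosets.\<close>

lemma full_repsD:
  assumes "full_reps l a R"
  shows "card R = unit_index l a" "finite R"
    "\<And>y. \<not> int l dvd y \<Longrightarrow> \<exists>!\<sigma>. \<sigma> \<in> R \<and> (\<exists>i. [int \<sigma> * int a ^ i = y] (mod int l))"
proof -
  let ?H = "powers_mod l a" and ?G = "unit_group l"
  have R: "R \<subseteq> {1..l - 1}" and ex: "\<And>C. C \<in> rcosets\<^bsub>?G\<^esub> ?H \<Longrightarrow> \<exists>!\<sigma>. \<sigma> \<in> R \<and> int \<sigma> \<in> C"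
    using assms by (auto simp: full_reps_def)
  then show fin: "finite R" using finite_subset by blast
  have Rc: "int \<sigma> \<in> {1..int l - 1}" if "\<sigma> \<in> R" for \<sigma>
  proof -
    have "\<sigma> \<in> {1..l - 1}" using R that by blast
    then show ?thesis using prime_gt_0_nat[OF l] by auto
  qed
  then have Rc': "int \<sigma> \<in> carrier ?G" if "\<sigma> \<in> R" for \<sigma> using that carrier_unit_group by blast
  have "bij_betw (\<lambda>\<sigma>. ?H #>\<^bsub>?G\<^esub> int \<sigma>) R (rcosets\<^bsub>?G\<^esub> ?H)"
  proof (rule bij_betwI')
    fix \<sigma> \<rho> assume *: "\<sigma> \<in> R" "\<rho> \<in> R"
    have self: "int \<sigma> \<in> ?H #>\<^bsub>?G\<^esub> int \<sigma>" "int \<rho> \<in> ?H #>\<^bsub>?G\<^esub> int \<rho>"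
      using * Rc' ug.rcos_self subgroup_powers_mod by auto
    have "?H #>\<^bsub>?G\<^esub> int \<sigma> \<in> rcosets\<^bsub>?G\<^esub> ?H" using Rc'[OF *(1)] by (auto simp: RCOSETS_def)
    from ex[OF this] self * show "(?H #>\<^bsub>?G\<^esub> int \<sigma> = ?H #>\<^bsub>?G\<^esub> int \<rho>) = (\<sigma> = \<rho>)" by metis
  next
    fix \<sigma> assume "\<sigma> \<in> R"
    then show "?H #>\<^bsub>?G\<^esub> int \<sigma> \<in> rcosets\<^bsub>?G\<^esub> ?H" using Rc' by (auto simp: RCOSETS_def)
  next
    fix C assume C: "C \<in> rcosets\<^bsub>?G\<^esub> ?H"
    then obtain \<sigma> where s: "\<sigma> \<in> R" "int \<sigma> \<in> C" using ex by blast
    obtain x where "x \<in> carrier ?G" "C = ?H #>\<^bsub>?G\<^esub> x" using C by (auto simp: RCOSETS_def)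
    with s have "C = ?H #>\<^bsub>?G\<^esub> int \<sigma>"
      using ug.repr_independence subgroup_powers_mod by blast
    with s show "\<exists>\<sigma>\<in>R. C = ?H #>\<^bsub>?G\<^esub> int \<sigma>" by blast
  qed
  then show "card R = unit_index l a" unfolding unit_index_def by (rule bij_betw_same_card)
  fix y :: int assume y: "\<not> int l dvd y"
  let ?y = "y mod int l"
  have yc: "?y \<in> {1..int l - 1}" using mod_in_unit_group[OF y] carrier_unit_group by simp
  then have yG: "?y \<in> carrier ?G" using carrier_unit_group by blast
  then have C: "?H #>\<^bsub>?G\<^esub> ?y \<in> rcosets\<^bsub>?G\<^esub> ?H" by (auto simp: RCOSETS_def)
  \<comment> \<open>Membership is turned around: a coset is determined by any of its elements, so
    two units lie in each other's cosets simultaneously.\<close>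
  have "\<sigma> \<in> R \<and> int \<sigma> \<in> ?H #>\<^bsub>?G\<^esub> ?y \<longleftrightarrow> \<sigma> \<in> R \<and> (\<exists>i. [int \<sigma> * int a ^ i = y] (mod int l))" for \<sigma>
  proof (cases "\<sigma> \<in> R")
    case True
    have "int \<sigma> \<in> ?H #>\<^bsub>?G\<^esub> ?y \<longleftrightarrow> ?y \<in> ?H #>\<^bsub>?G\<^esub> int \<sigma>"
      using ug.repr_independence[OF _ _ subgroup_powers_mod] ug.rcos_self[OF _ subgroup_powers_mod] yG Rc'[OF True]
      by metis
    also have "\<dots> \<longleftrightarrow> (\<exists>i. [int \<sigma> * int a ^ i = y] (mod int l))"
      using mem_rcoset_iff[OF Rc[OF True], of ?y] yc by (simp add: cong_def)
    finally show ?thesis using True by simp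
  qed simp
  from ex[OF C, unfolded this] show "\<exists>!\<sigma>. \<sigma> \<in> R \<and> (\<exists>i. [int \<sigma> * int a ^ i = y] (mod int l))" .
qed

end

section \<open>Orbits of multiplication on the units modulo a prime power\<close>


lemma gcd_prime_power:
  fixes l Y :: nat
  assumes "prime l" "Y \<noteq> 0"
  shows "gcd (l ^ J) Y = l ^ min J (multiplicity l Y)"
proof (rule dvd_antisym)
  obtain k where k: "k \<le> J" "gcd (l ^ J) Y = l ^ k"
    using divides_primepow_nat[OF assms(1), of "gcd (l ^ J) Y" J] by auto
  then have "l ^ k dvd Y" by (metis gcd_dvd2)
  then have "k \<le> multiplicity l Y" using assms by (intro multiplicity_geI) auto
  then show "gcd (l ^ J) Y dvd l ^ min J (multiplicity l Y)" using k by (simp add: le_imp_power_dvd)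
  show "l ^ min J (multiplicity l Y) dvd gcd (l ^ J) Y"
    by (simp add: le_imp_power_dvd multiplicity_dvd')
qed

text \<open>One setting for both cases of the construction: f is the order of Q modulo
  \<open>l ^ c\<close>, with \<open>c = 1\<close> in general and \<open>c = f = 2\<close> when l = 2
  and Q is 3 modulo 4. In either case lifting the exponent applies to \<open>Q ^ f\<close>, with V
  as the initial valuation.\<close>

context
  fixes l Q c f J V :: nat
  assumes l: "prime l" and Q: "Q > 1" and c: "0 < c" "c \<le> J" and f: "f > 0"
    and period: "\<And>i. [int Q ^ i = 1] (mod int l ^ c) \<longleftrightarrow> f dvd i"
    and V: "V = multiplicity l (Q ^ f - 1)" and four: "l = 2 \<Longrightarrow> 4 dvd Q ^ f - 1"
begin

lemma period_gt_1: "Q ^ f > 1"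
  using one_less_power[OF Q f] .

lemma int_dvd_period: "int (Q ^ f - 1) = int Q ^ f - 1"
  using period_gt_1 by (simp add: of_nat_diff)

lemma le_V: "c \<le> V"
proof -
  have "int (l ^ c) dvd int (Q ^ f - 1)"
    using period[of f] unfolding int_dvd_period of_nat_power by (simp add: cong_iff_dvd_diff)
  then have "l ^ c dvd Q ^ f - 1" by (simp only: int_dvd_int_iff)
  moreover have "Q ^ f - 1 \<noteq> 0" using period_gt_1 by linarith
  moreover have "\<not> is_unit l" using l by auto
  ultimately show ?thesis unfolding V by (intro multiplicity_geI) auto
qed

lemma coprime_base: "coprime l Q"
proof -
  have "[int Q ^ f = 1] (mod int l ^ c)" using period by simp
  then have "[int Q ^ f = 1] (mod int l)" by (rule cong_dvd_modulus) (use c in simp)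
  then have "\<not> int l dvd int Q ^ f" using l by (auto simp: cong_dvd_iff)
  moreover have "int l dvd int Q ^ f" if "l dvd Q"
    using that f by (intro dvd_trans[OF _ dvd_power]) auto
  ultimately have "\<not> l dvd Q" by blast
  then show ?thesis using l by (rule prime_imp_coprime[rotated])
qed

lemma period_gcd: "gcd (l ^ J) (Q ^ f - 1) = l ^ min V J"
  using gcd_prime_power[OF l, of "Q ^ f - 1" J] period_gt_1 by (simp add: V min.commute)

lemma prime_dvd_period: "l' dvd Q ^ f - 1" if "prime l'" "l' dvd l ^ J"
proof -
  have "l ^ c dvd Q ^ f - 1" using le_V unfolding V by (rule multiplicity_dvd')
  then have "l dvd Q ^ f - 1" using c(1) by (meson dvd_power dvd_trans)
  moreover have "l' dvd l" using that by (metis prime_dvd_power)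
  ultimately show ?thesis by (rule dvd_trans[rotated])
qed

lemma four_dvd_period: "4 dvd Q ^ f - 1" if "8 dvd l ^ J"
proof -
  have "(2::nat) dvd l ^ J" using that by (rule dvd_trans[rotated]) simp
  then have "2 dvd l" by (metis prime_dvd_power two_is_prime_nat)
  then have "2 = l" using l by (metis primes_dvd_imp_eq two_is_prime_nat)
  then show ?thesis using four by simp
qed

text \<open>The quotient of y by x is 1 modulo \<open>l ^ min V J\<close>, which is the gcd of
  \<open>l ^ J\<close> and \<open>Q ^ f - 1\<close>; hence it is a power of
  \<open>Q ^ f\<close>.\<close>

lemma unit_orbitI:
  fixes x y :: int
  assumes x: "\<not> int l dvd x" and xy: "[x = y] (mod int l ^ min V J)"
  shows "\<exists>i. [x * int Q ^ i = y] (mod int l ^ J)"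
proof -
  have "coprime x (int l ^ J)"
    using x l by (metis coprime_commute coprime_power_right_iff prime_imp_coprime prime_nat_int_transfer)
  then obtain x' where x': "[x * x' = 1] (mod int l ^ J)" using cong_solve_coprime_int by blast
  have m: "[x * x' = 1] (mod int l ^ min V J)"
    by (rule cong_dvd_modulus[OF x']) (simp add: le_imp_power_dvd)
  have "[y * x' = x * x'] (mod int l ^ min V J)" using cong_sym[OF xy] by (rule cong_scalar_right)
  also note m
  finally have "[y * x' = 1] (mod int (gcd (l ^ J) (Q ^ f - 1)))" unfolding period_gcd by simp
  then obtain i where "[int (Q ^ f) ^ i = y * x'] (mod int (l ^ J))"
    using power_cong_one_mod_gcd[of "l ^ J" "Q ^ f"] period_gt_1 prime_dvd_period four_dvd_period prime_gt_0_nat[OF l] by auto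
  then have "[x * int Q ^ (f * i) = x * (y * x')] (mod int l ^ J)"
    by (intro cong_scalar_left) (simp add: power_mult)
  also have "x * (y * x') = y * (x * x')" by (simp add: mult_ac)
  also have "[\<dots> = y * 1] (mod int l ^ J)" using x' by (rule cong_scalar_left)
  finally show ?thesis by auto
qed

text \<open>Agreement modulo \<open>l ^ c\<close> forces the exponent to be a multiple of f, and
  \<open>Q ^ f\<close> is 1 modulo \<open>l ^ V\<close>.\<close>

lemma unit_orbitD:
  fixes x y :: int
  assumes x: "\<not> int l dvd x" and xy: "[x = y] (mod int l ^ c)"
    and i: "[x * int Q ^ i = y] (mod int l ^ J)"
  shows "[x = y] (mod int l ^ min V J)"
proof -
  have cop: "coprime x (int l ^ c)"
    using x l by (metis coprime_commute coprime_power_right_iff prime_imp_coprime prime_nat_int_transfer)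
  have "[x * int Q ^ i = y] (mod int l ^ c)"
    by (rule cong_dvd_modulus[OF i]) (simp add: c le_imp_power_dvd)
  also note cong_sym[OF xy]
  finally have "[x * int Q ^ i = x * 1] (mod int l ^ c)" by simp
  then have "f dvd i" using cong_mult_lcancel[OF cop] period by blast
  then obtain k where k: "i = f * k" by auto
  have "l ^ min V J dvd Q ^ f - 1" unfolding V by (rule multiplicity_dvd') simp
  then have "int (l ^ min V J) dvd int (Q ^ f - 1)" by (simp only: int_dvd_int_iff)
  then have "[int Q ^ f = 1] (mod int l ^ min V J)"
    unfolding cong_iff_dvd_diff int_dvd_period of_nat_power .
  from cong_pow[OF this, of k] have "[int Q ^ i = 1] (mod int l ^ min V J)" by (simp add: k power_mult)
  then have "[x * 1 = x * int Q ^ i] (mod int l ^ min V J)" by (intro cong_scalar_left) (rule cong_sym)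
  moreover have "[x * int Q ^ i = y] (mod int l ^ min V J)"
    by (rule cong_dvd_modulus[OF i]) (simp add: le_imp_power_dvd)
  ultimately show ?thesis by (metis cong_trans mult_1_right)
qed

text \<open>Since \<open>c \<le> J\<close>, every exponent that gives 1 modulo \<open>l ^ J\<close>
  is a multiple of f, so the order is f times that of \<open>Q ^ f\<close>.\<close>

lemma ord_prime_power: "ord (l ^ J) Q = f * l ^ (J - V)"
proof -
  have o: "ord (l ^ J) (Q ^ f) = l ^ (J - V)"
  proof -
    have "ord (l ^ J) (Q ^ f) = l ^ J div gcd (l ^ J) (Q ^ f - 1)"
      using prime_dvd_period four_dvd_period period_gt_1 prime_gt_0_nat[OF l] by (intro ord_eq_div_gcd) auto
    also have "\<dots> = l ^ (J - min V J)" unfolding period_gcd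
      using prime_gt_0_nat[OF l] by (intro power_diff[symmetric]) auto
    finally show ?thesis by (simp add: min_def)
  qed
  have "ord (l ^ J) Q dvd t \<longleftrightarrow> f * l ^ (J - V) dvd t" for t
  proof -
    have fd: "f dvd t" if "[Q ^ t = 1] (mod l ^ J)"
    proof -
      from that have "[int (Q ^ t) = int 1] (mod int (l ^ J))" by (simp only: cong_int_iff)
      then have "[int Q ^ t = 1] (mod int l ^ J)" by simp
      then have "[int Q ^ t = 1] (mod int l ^ c)"
        by (rule cong_dvd_modulus) (simp add: c le_imp_power_dvd)
      then show ?thesis using period by simp
    qed
    show ?thesis
    proof (cases "f dvd t")
      case True
      then obtain s where s: "t = f * s" by auto
      have "ord (l ^ J) Q dvd t \<longleftrightarrow> [(Q ^ f) ^ s = 1] (mod l ^ J)"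
        by (simp add: ord_divides[symmetric] s power_mult)
      also have "\<dots> \<longleftrightarrow> l ^ (J - V) dvd s" by (simp only: ord_divides o)
      finally show ?thesis using f s by simp
    next
      case False
      then show ?thesis using fd by (metis dvd_mult_left ord_divides)
    qed
  qed
  from this[of "ord (l ^ J) Q"] this[of "f * l ^ (J - V)"] show ?thesis by (simp add: dvd_antisym)
qed

text \<open>Among units with the same residue modulo \<open>l ^ c\<close>, an orbit is determined by
  the digits from position c up to \<open>min V J - 1\<close>, which t enumerates; all higher digits
  can be adjusted within the orbit.\<close>

lemma unit_orbit_family:
  fixes e y :: int
  assumes e: "\<not> int l dvd e" and y: "[e * int Q ^ s = y] (mod int l ^ c)"
  shows "\<exists>!t. t \<in> {0..l ^ (min V J - c) - 1} \<and>
    (\<exists>i. [(e + int l ^ c * int t) * int Q ^ i = y] (mod int l ^ J))"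
proof -
  have l0: "l > 0" using prime_gt_0_nat[OF l] .
  have lc: "int l dvd int l ^ c" using c by simp
  have Y: "\<not> int l dvd e + int l ^ c * t" for t
    using e lc by (meson dvd_add_left_iff dvd_mult2)
  have cV: "c \<le> min V J" using le_V c by simp
  have eV: "int l ^ min V J = int l ^ c * int l ^ (min V J - c)" using cV by (simp flip: power_add)
  have cop: "coprime (int Q ^ s) (int l ^ J)"
    using coprime_base by (simp add: coprime_commute)
  \<comment> \<open>w inverts \<open>Q ^ s\<close>, so \<open>y * w\<close> stays in the orbit of y
    and agrees with e modulo \<open>l ^ c\<close>; its next digits give t.\<close>
  then obtain w where w: "[int Q ^ s * w = 1] (mod int l ^ J)" using cong_solve_coprime_int by blast
  have "[e * 1 = e * (int Q ^ s * w)] (mod int l ^ c)"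
    by (intro cong_scalar_left cong_sym[OF cong_dvd_modulus[OF w]]) (simp add: c le_imp_power_dvd)
  also have "e * (int Q ^ s * w) = e * int Q ^ s * w" by simp
  also have "[\<dots> = y * w] (mod int l ^ c)" using y by (rule cong_scalar_right)
  finally have "[y * w = e] (mod int l ^ c)" by (simp add: cong_sym_eq)
  then obtain z where z: "y * w = e + int l ^ c * z" by (metis cong_iff_lin cong_sym mult.commute)
  define t where "t = nat (z mod int l ^ (min V J - c))"
  have t: "int t = z mod int l ^ (min V J - c)" using l0 by (simp add: t_def)
  then have "int t < int (l ^ (min V J - c))" using l0 by simp
  then have tb: "t \<in> {0..l ^ (min V J - c) - 1}" by simp
  have "[int t = z] (mod int l ^ (min V J - c))" using t by (simp add: cong_def)
  then have "[int l ^ c * int t = int l ^ c * z] (mod int l ^ min V J)"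
    unfolding eV by (simp add: cong_def mod_mult_mult1)
  then have "[e + int l ^ c * int t = y * w] (mod int l ^ min V J)"
    unfolding z by (intro cong_add cong_refl)
  from unit_orbitI[OF Y this] obtain i
    where i: "[(e + int l ^ c * int t) * int Q ^ i = y * w] (mod int l ^ J)" by blast
  have "[(e + int l ^ c * int t) * int Q ^ i * int Q ^ s = y * w * int Q ^ s] (mod int l ^ J)"
    using i by (rule cong_scalar_right)
  also have "y * w * int Q ^ s = y * (int Q ^ s * w)" by simp
  also have "[\<dots> = y * 1] (mod int l ^ J)" using w by (rule cong_scalar_left)
  finally have "[(e + int l ^ c * int t) * int Q ^ (i + s) = y] (mod int l ^ J)"
    by (simp add: power_add mult.assoc)
  moreover have "t' = t''" if t': "t' < l ^ (min V J - c)" "t'' < l ^ (min V J - c)"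
    and i': "[(e + int l ^ c * int t') * int Q ^ i' = y] (mod int l ^ J)"
    and i'': "[(e + int l ^ c * int t'') * int Q ^ i'' = y] (mod int l ^ J)" for t' t'' i' i''
  proof -
    have "coprime (l ^ J) Q" using coprime_base by simp
    moreover have "same_coset Q (l ^ J) (e + int l ^ c * int t') y" "same_coset Q (l ^ J) (e + int l ^ c * int t'') y"
      using i' i'' by (auto simp: same_coset_def)
    ultimately have "same_coset Q (l ^ J) (e + int l ^ c * int t') (e + int l ^ c * int t'')"
      using same_coset_sym same_coset_trans by blast
    then obtain k where "[(e + int l ^ c * int t') * int Q ^ k = e + int l ^ c * int t''] (mod int l ^ J)"
      by (auto simp: same_coset_def)
    from unit_orbitD[OF Y _ this]
    have "[e + int l ^ c * int t' = e + int l ^ c * int t''] (mod int l ^ min V J)"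
      by (auto simp: cong_def)
    then have "[int l ^ c * int t' = int l ^ c * int t''] (mod int l ^ c * int l ^ (min V J - c))"
      unfolding eV[symmetric] by (simp only: cong_add_lcancel)
    then have "[int t' = int t''] (mod int (l ^ (min V J - c)))"
      using l0 by (simp add: cong_def mod_mult_mult1)
    then show ?thesis using t' by (simp only: cong_int_iff cong_less_modulus_unique_nat)
  qed
  moreover have "t' < l ^ (min V J - c)" if "t' \<in> {0..l ^ (min V J - c) - 1}" for t'
    using that l0 by (metis Suc_diff_1 atLeastAtMost_iff less_Suc_eq_le zero_less_power)
  ultimately show ?thesis using tb by blast
qed

end

text \<open>The difference between the chosen digit and \<phi> runs through representatives of the
  units modulo the powers of Q. If l divides Q - 1, every nonzero residue is a class of its own, so
  the digit may be any one except \<phi>; otherwise a representative is added to \<phi> modulo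
  l.\<close>

lemma unit_digit:
  fixes l Q \<phi> :: nat and R :: "nat set"
  assumes l: "prime l" and Q: "\<not> l dvd Q" and \<phi>: "\<phi> < l"
    and R: "\<not> l dvd Q - 1 \<Longrightarrow> full_reps l Q R"
  defines "u \<equiv> \<lambda>a. if l dvd Q - 1 then nth_smallest ({0..l - 1} - {\<phi>}) a
                   else (\<phi> + nth_smallest R a) mod l"
  shows "a \<in> {1..unit_index l Q} \<Longrightarrow> \<not> int l dvd int (u a) - int \<phi>"
    and "\<not> int l dvd y \<Longrightarrow>
      \<exists>!a. a \<in> {1..unit_index l Q} \<and> (\<exists>i. [(int (u a) - int \<phi>) * int Q ^ i = y] (mod int l))"
proof -
  have l0: "l > 0" using prime_gt_0_nat[OF l] .
  have Q0: "Q > 0" using Q by (metis dvd_0_right gr0I)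
  \<comment> \<open>Both branches become one: an enumeration of S followed by the map w, where S
    consists either of the digits other than \<phi> or of the given representatives.\<close>
  define S where "S = (if l dvd Q - 1 then {0..l - 1} - {\<phi>} else R)"
  have idx: "unit_index l Q = l - 1" if "l dvd Q - 1"
  proof -
    have "ord l Q = Suc 0" using that Q0 by (simp add: ord_eq_Suc_0_iff cong_altdef_nat)
    then show ?thesis using unit_index_mult_ord[OF l Q] by simp
  qed
  have S: "finite S" "card S = unit_index l Q"
    using full_repsD[OF l Q R] idx \<phi> by (auto simp: S_def card_Diff_singleton)
  define w where "w \<sigma> = (if l dvd Q - 1 then \<sigma> else (\<phi> + \<sigma>) mod l)" for \<sigma>
  have u: "u a = w (nth_smallest S a)" for a by (simp add: u_def w_def S_def)
  have wc: "[int (w \<sigma>) - int \<phi> = int \<sigma>] (mod int l)" if "\<not> l dvd Q - 1" for \<sigma>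
    using that by (simp add: w_def zmod_int cong_def mod_diff_left_eq)
  have bij: "bij_betw (nth_smallest S) {1..unit_index l Q} S"
    using bij_betw_nth_smallest[OF S(1)] S(2) by simp
  have nd: "\<not> int l dvd int (w \<sigma>) - int \<phi>" if "\<sigma> \<in> S" for \<sigma>
  proof (cases "l dvd Q - 1")
    case True
    then have "\<sigma> < l" "\<sigma> \<noteq> \<phi>" using that l0 by (auto simp: S_def)
    then have "\<not> [int \<sigma> = int \<phi>] (mod int l)" using \<phi> by (simp add: cong_int_iff cong_def)
    then show ?thesis using True by (simp add: w_def cong_iff_dvd_diff)
  next
    case False
    then have "\<sigma> \<in> {1..l - 1}" using that R unfolding S_def full_reps_def by auto
    then have "\<not> int l dvd int \<sigma>" using l0 by (auto dest: dvd_imp_le)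
    then show ?thesis using cong_dvd_iff[OF wc[OF False]] by simp
  qed
  show "\<not> int l dvd int (u a) - int \<phi>" if "a \<in> {1..unit_index l Q}"
    unfolding u using nd bij that by (meson bij_betwE)
  have ex: "\<exists>!\<sigma>. \<sigma> \<in> S \<and> (\<exists>i. [(int (w \<sigma>) - int \<phi>) * int Q ^ i = y] (mod int l))" if y: "\<not> int l dvd y"
  proof (cases "l dvd Q - 1")
    case True
    then have "[Q = 1] (mod l)" using Q0 by (simp add: cong_altdef_nat)
    then have "[int Q = int 1] (mod int l)" by (simp only: cong_int_iff)
    then have "[int Q ^ i = 1 ^ i] (mod int l)" for i by (intro cong_pow) simp
    then have Qi: "[x * int Q ^ i = x * 1] (mod int l)" for i x by (intro cong_scalar_left) simp
    have E1: "(\<exists>i. [x * int Q ^ i = y] (mod int l)) \<longleftrightarrow> [x = y] (mod int l)" for x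
      using Qi[of x] by (auto simp: cong_def)
    have E2: "[int \<sigma> - int \<phi> = y] (mod int l) \<longleftrightarrow> \<sigma> = nat ((y + int \<phi>) mod int l)" if "\<sigma> < l" for \<sigma>
    proof -
      have "[int \<sigma> - int \<phi> = y] (mod int l) \<longleftrightarrow> [int \<sigma> = y + int \<phi>] (mod int l)"
        by (simp add: cong_iff_dvd_diff algebra_simps)
      also have "\<dots> \<longleftrightarrow> int \<sigma> = (y + int \<phi>) mod int l" using that by (simp add: cong_def)
      finally show ?thesis using l0 by auto
    qed
    have E3: "nat ((y + int \<phi>) mod int l) \<in> S"
    proof -
      have "(y + int \<phi>) mod int l \<noteq> int \<phi>"
      proof
        assume "(y + int \<phi>) mod int l = int \<phi>"
        then have "[y + int \<phi> = 0 + int \<phi>] (mod int l)" using \<phi> by (simp add: cong_def)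
        then have "int l dvd y" by (simp only: cong_add_rcancel cong_0_iff)
        with y show False by simp
      qed
      moreover have "(y + int \<phi>) mod int l < int l" "(y + int \<phi>) mod int l \<ge> 0" using l0 by simp_all
      ultimately show ?thesis using True unfolding S_def by (auto simp: nat_le_iff nat_eq_iff)
    qed
    have "(\<exists>i. [(int (w \<sigma>) - int \<phi>) * int Q ^ i = y] (mod int l)) \<longleftrightarrow> \<sigma> = nat ((y + int \<phi>) mod int l)"
      if "\<sigma> \<in> S" for \<sigma>
    proof -
      have "\<sigma> < l" using that True l0 by (auto simp: S_def)
      from E2[OF this] show ?thesis unfolding E1 using True by (simp add: w_def)
    qed
    then show ?thesis using E3 by blast
  next
    case False
    have "[(int (w \<sigma>) - int \<phi>) * int Q ^ i = y] (mod int l) \<longleftrightarrow> [int \<sigma> * int Q ^ i = y] (mod int l)" for \<sigma> i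
      using cong_scalar_right[OF wc[OF False, of \<sigma>], of "int Q ^ i"] by (simp add: cong_def)
    then show ?thesis using full_repsD(3)[OF l Q R[OF False] y] False by (simp add: S_def)
  qed
  show "\<exists>!a. a \<in> {1..unit_index l Q} \<and> (\<exists>i. [(int (u a) - int \<phi>) * int Q ^ i = y] (mod int l))"
    if y: "\<not> int l dvd y"
  proof -
    obtain \<sigma> where \<sigma>: "\<sigma> \<in> S" "\<exists>i. [(int (w \<sigma>) - int \<phi>) * int Q ^ i = y] (mod int l)"
      and un: "\<And>\<rho>. \<rho> \<in> S \<Longrightarrow> \<exists>i. [(int (w \<rho>) - int \<phi>) * int Q ^ i = y] (mod int l) \<Longrightarrow> \<rho> = \<sigma>"
      using ex[OF y] by blast
    obtain a where a: "a \<in> {1..unit_index l Q}" "nth_smallest S a = \<sigma>"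
      using bij \<sigma>(1) by (metis bij_betw_imp_surj_on imageE)
    show ?thesis
    proof (rule ex1I[of _ a])
      show "a \<in> {1..unit_index l Q} \<and> (\<exists>i. [(int (u a) - int \<phi>) * int Q ^ i = y] (mod int l))"
        using a \<sigma> by (simp add: u)
    next
      fix b assume b: "b \<in> {1..unit_index l Q} \<and> (\<exists>i. [(int (u b) - int \<phi>) * int Q ^ i = y] (mod int l))"
      then have "nth_smallest S b = \<sigma>" using un[of "nth_smallest S b"] bij by (auto simp: u dest: bij_betwE)
      then show "b = a" using a b bij by (metis bij_betw_def inj_on_def)
    qed
  qed
qed

section \<open>One step of the recursive construction\<close>


locale coset_step =
  fixes q l B j :: nat and \<delta> :: int and R :: "nat \<Rightarrow> nat \<Rightarrow> int \<Rightarrow> nat set"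
  assumes q: "q > 1" and B: "B > 0" "coprime B q"
    and l: "prime l" "\<not> l dvd B" "\<not> l dvd q" and j: "j > 0"
    and R: "\<not> l dvd q ^ cyc_size q B \<delta> - 1 \<Longrightarrow> full_reps l (q ^ cyc_size q B \<delta>) (R B l \<delta>)"
begin

abbreviation \<theta> :: nat where "\<theta> \<equiv> cyc_size q B \<delta>"
abbreviation Q :: nat where "Q \<equiv> q ^ \<theta>"
abbreviation \<Phi> :: int where "\<Phi> \<equiv> ladic_upto l B \<delta> (j - 1)"
abbreviation dig :: "nat \<Rightarrow> nat" where "dig \<equiv> ladic_digit l B \<delta>"

lemma l_gt_1: "l > 1"
  using prime_gt_1_nat[OF l(1)] .

lemma \<theta>_pos: "\<theta> > 0"
  using cyc_size_props(1)[OF B(2)] .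

lemma Q_gt_1: "Q > 1"
  using one_less_power[OF q \<theta>_pos] .

lemma not_dvd_Q: "\<not> l dvd Q"
  using l(1,3) prime_dvd_power by blast

lemma not_dvd_mult_Q: "\<not> int l dvd x \<Longrightarrow> \<not> int l dvd x * int Q ^ s"
proof -
  assume x: "\<not> int l dvd x"
  have "\<not> l dvd Q ^ s" using l(1) not_dvd_Q prime_dvd_power by blast
  then have "\<not> int l dvd int (Q ^ s)" by (simp only: int_dvd_int_iff not_False_eq_True)
  then show ?thesis using x l(1) by (simp add: prime_dvd_mult_iff)
qed

lemma digits: "is_ladic_digits l B \<delta> dig"
  using l by (intro is_ladic_digits_ladic_digit)

lemma dig_less: "dig k < l"
  using digits by (simp add: is_ladic_digits_def)

lemma \<Phi>_cong: "[int B * \<Phi> = - \<delta>] (mod int l ^ j)"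
  using digits j unfolding is_ladic_digits_def ladic_upto_def by (metis Suc_diff_1 Suc_eq_plus1)

lemma coprime_B_l: "coprime (int B) (int l ^ j)"
  using prime_imp_coprime[OF l(1,2)] by (simp add: coprime_commute)

lemma coprime_modulus: "coprime (B * l ^ j) q"
  using B(2) l prime_imp_coprime[of l q] by simp

text \<open>Modulo \<open>l ^ j\<close> the truncation \<Phi> solves
  \<open>B * \<Phi> = - \<delta>\<close>. Measuring x from \<Phi> makes the lifts proportional to
  \<open>x - \<Phi>\<close>, so that powers of q act linearly.\<close>

lemma fibre_cong: "[\<delta> + int B * x = int B * (x - \<Phi>)] (mod int l ^ j)"
proof -
  have "[int B * x - (- \<delta>) = int B * x - int B * \<Phi>] (mod int l ^ j)"
    by (intro cong_diff cong_refl cong_sym[OF \<Phi>_cong])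
  then show ?thesis by (simp add: algebra_simps)
qed

lemma cong_modulus_iff:
  "[x = y] (mod int (B * l ^ j)) \<longleftrightarrow> [x = y] (mod int B) \<and> [x = y] (mod int l ^ j)"
  using coprime_cong_mult[OF _ _ coprime_B_l, of x y]
  by (auto elim: cong_dvd_modulus)

text \<open>Chinese remainder theorem: the condition modulo B sees only \<delta> and says that t is
  a multiple of \<theta>; the condition modulo \<open>l ^ j\<close> is linear in the offset from
  \<Phi> once the unit B is cancelled.\<close>

lemma fibre_power_iff:
  "[(\<delta> + int B * x) * int q ^ t = \<delta> + int B * y] (mod int (B * l ^ j)) \<longleftrightarrow>
   \<theta> dvd t \<and> [(x - \<Phi>) * int q ^ t = y - \<Phi>] (mod int l ^ j)"
proof -
  have "[(\<delta> + int B * x) * int q ^ t = \<delta> + int B * y] (mod int B) \<longleftrightarrow> \<theta> dvd t"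
  proof -
    have "[(\<delta> + int B * x) * int q ^ t = \<delta> * int q ^ t] (mod int B)"
      by (intro cong_mult cong_refl) (simp add: cong_def)
    moreover have "[\<delta> + int B * y = \<delta>] (mod int B)" by (simp add: cong_def)
    ultimately show ?thesis
      using cyc_size_dvd_iff[OF B(2), of \<delta> t] unfolding cong_def by simp
  qed
  moreover have "[(\<delta> + int B * x) * int q ^ t = \<delta> + int B * y] (mod int l ^ j) \<longleftrightarrow>
    [(x - \<Phi>) * int q ^ t = y - \<Phi>] (mod int l ^ j)"
  proof -
    have "[(\<delta> + int B * x) * int q ^ t = int B * (x - \<Phi>) * int q ^ t] (mod int l ^ j)"
      using fibre_cong by (rule cong_scalar_right)
    then have "[(\<delta> + int B * x) * int q ^ t = \<delta> + int B * y] (mod int l ^ j) \<longleftrightarrow>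
      [int B * ((x - \<Phi>) * int q ^ t) = int B * (y - \<Phi>)] (mod int l ^ j)"
      using fibre_cong[of y] unfolding cong_def mult.assoc by simp
    then show ?thesis using cong_mult_lcancel[OF coprime_B_l] by simp
  qed
  ultimately show ?thesis unfolding cong_modulus_iff by blast
qed

lemma same_coset_fibre:
  "same_coset q (B * l ^ j) (\<delta> + int B * x) (\<delta> + int B * y) \<longleftrightarrow>
   (\<exists>i. [(x - \<Phi>) * int Q ^ i = y - \<Phi>] (mod int l ^ j))"
  unfolding same_coset_def fibre_power_iff
  by (auto simp: power_mult elim!: dvdE intro: exI[of _ "\<theta> * _"])

lemma cyc_size_fibre:
  assumes "\<And>i. [(x - \<Phi>) * int Q ^ i = x - \<Phi>] (mod int l ^ j) \<longleftrightarrow> c dvd i"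
  shows "cyc_size q (B * l ^ j) (\<delta> + int B * x) = \<theta> * c"
proof (rule cyc_size_eqI[OF coprime_modulus])
  fix t
  show "[(\<delta> + int B * x) * int q ^ t = \<delta> + int B * x] (mod int (B * l ^ j)) \<longleftrightarrow> \<theta> * c dvd t"
  proof (cases "\<theta> dvd t")
    case True
    then obtain i where i: "t = \<theta> * i" unfolding dvd_def by blast
    then show ?thesis using assms[of i] \<theta>_pos unfolding fibre_power_iff by (simp add: power_mult)
  next
    case False
    then show ?thesis unfolding fibre_power_iff by (auto dest: dvd_mult_left)
  qed
qed

text \<open>Describes the annihilator of a lift, from which the order of the corresponding root of
  unity is read off in the end.\<close>

lemma dvd_fibre_iff:
  "int (B * l ^ j) dvd (\<delta> + int B * x) * w \<longleftrightarrow> int B dvd \<delta> * w \<and> int l ^ j dvd (x - \<Phi>) * w"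
proof -
  have "int (B * l ^ j) dvd (\<delta> + int B * x) * w \<longleftrightarrow>
    int B dvd (\<delta> + int B * x) * w \<and> int l ^ j dvd (\<delta> + int B * x) * w"
    using cong_modulus_iff[of "(\<delta> + int B * x) * w" 0] by (simp add: cong_0_iff)
  also have "int B dvd (\<delta> + int B * x) * w \<longleftrightarrow> int B dvd \<delta> * w"
    by (simp add: algebra_simps dvd_add_left_iff)
  also have "int l ^ j dvd (\<delta> + int B * x) * w \<longleftrightarrow> int l ^ j dvd int B * (x - \<Phi>) * w"
    by (intro cong_dvd_iff cong_scalar_right fibre_cong)
  also have "\<dots> \<longleftrightarrow> int l ^ j dvd (x - \<Phi>) * w"
    using coprime_B_l by (simp add: mult.assoc coprime_dvd_mult_right_iff coprime_commute)
  finally show ?thesis .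
qed

lemma \<Phi>_split:
  assumes "i < j"
  obtains C where "\<Phi> = (\<Sum>k<i. int (dig k) * int l ^ k) + int (dig i) * int l ^ i + int l ^ (i + 1) * C"
proof -
  have "{..j - 1} = {..<Suc i} \<union> {Suc i..<j}" using assms by auto
  then have "\<Phi> = (\<Sum>k<Suc i. int (dig k) * int l ^ k) + (\<Sum>k=Suc i..<j. int (dig k) * int l ^ k)"
    unfolding ladic_upto_def by (simp only:) (subst sum.union_disjoint; auto)
  moreover have "int l ^ (i + 1) dvd (\<Sum>k=Suc i..<j. int (dig k) * int l ^ k)"
    by (intro dvd_sum dvd_mult le_imp_power_dvd) auto
  ultimately show ?thesis using that by (auto elim!: dvdE)
qed

section \<open>Digits, periods and valuations in the ordinary and in the exceptional case\<close>

definition digit_of :: "nat \<Rightarrow> nat \<Rightarrow> nat" where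
  "digit_of i a = (if l dvd Q - 1 then nth_smallest ({0..l - 1} - {dig i}) a
                   else (dig i + nth_smallest (R B l \<delta>) a) mod l)"

lemma U_int_eq: "U_int q R l B \<delta> i a = (\<Sum>k<i. int (dig k) * int l ^ k) + int (digit_of i a) * int l ^ i"
  by (simp add: U_int_def digit_of_def Let_def)

lemma digit_of:
  "a \<in> {1..r_step q l \<theta>} \<Longrightarrow> \<not> int l dvd int (digit_of i a) - int (dig i)"
  "\<not> int l dvd y \<Longrightarrow>
      \<exists>!a. a \<in> {1..r_step q l \<theta>} \<and> (\<exists>s. [(int (digit_of i a) - int (dig i)) * int Q ^ s = y] (mod int l))"
  using unit_digit[OF l(1) not_dvd_Q dig_less[of i] R] unfolding digit_of_def r_step_def by blast+

lemma r_step_mult_ord: "r_step q l \<theta> * ord l Q = l - 1"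
  using unit_index_mult_ord[OF l(1) not_dvd_Q] by (simp add: r_step_def)

lemma ord_pos: "ord l Q > 0"
  using prime_imp_coprime[OF l(1) not_dvd_Q] ord_gt_0_iff by blast

lemma r_step_pos: "r_step q l \<theta> > 0"
  using r_step_mult_ord l_gt_1 by (intro gr0I) simp

lemma period_normal: "[int Q ^ i = 1] (mod int l ^ 1) \<longleftrightarrow> ord l Q dvd i"
proof -
  have "[int Q ^ i = 1] (mod int l ^ 1) \<longleftrightarrow> [int (Q ^ i) = int 1] (mod int l)" by simp
  also have "\<dots> \<longleftrightarrow> ord l Q dvd i" unfolding cong_int_iff ord_divides ..
  finally show ?thesis .
qed

lemma v_step_normal: "\<not> exceptional l q \<theta> \<Longrightarrow> v_step q l \<theta> = multiplicity l (Q ^ ord l Q - 1)"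
proof -
  assume "\<not> exceptional l q \<theta>"
  moreover have "\<theta> * (l - 1) div r_step q l \<theta> = \<theta> * ord l Q"
    using r_step_pos unfolding r_step_mult_ord[symmetric] by (simp add: mult.left_commute)
  ultimately show ?thesis by (simp add: v_step_def power_mult)
qed

lemma four_normal: "\<not> exceptional l q \<theta> \<Longrightarrow> l = 2 \<Longrightarrow> 4 dvd Q ^ ord l Q - 1"
proof -
  assume *: "\<not> exceptional l q \<theta>" "l = 2"
  have "ord l Q = 1" using r_step_mult_ord *(2) by simp
  moreover have "Q mod 4 = 1"
    using * not_dvd_Q unfolding exceptional_def by presburger
  then have "4 dvd Q - 1" by presburger
  ultimately show ?thesis by simp
qed

lemma period_exceptional: "exceptional l q \<theta> \<Longrightarrow> [int Q ^ i = 1] (mod int l ^ 2) \<longleftrightarrow> 2 dvd i"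
proof -
  assume *: "exceptional l q \<theta>"
  have "Q ^ i mod 4 = (if even i then 1 else 3)"
  proof (induction i)
    case (Suc i)
    have "Q ^ Suc i mod 4 = (Q mod 4) * (Q ^ i mod 4) mod 4" by (simp add: mod_mult_eq)
    then show ?case using Suc * by (auto simp: exceptional_def)
  qed simp
  then have "[Q ^ i = 1] (mod 4) \<longleftrightarrow> even i" by (simp add: cong_def)
  moreover have "[int Q ^ i = 1] (mod int l ^ 2) \<longleftrightarrow> [int (Q ^ i) = int 1] (mod int 4)"
    using * by (simp add: exceptional_def)
  ultimately show ?thesis unfolding cong_int_iff by simp
qed

text \<open>In \<open>Q ^ 2 - 1 = (Q - 1) * (Q + 1)\<close> the first factor has valuation 1, as Q
  is 3 modulo 4. This is the shift by one between the valuation V for \<open>f = 2\<close> and the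
  number v of the construction.\<close>

lemma v_step_exceptional:
  assumes "exceptional l q \<theta>"
  shows "multiplicity l (Q ^ 2 - 1) = v_step q l \<theta> + 1"
proof -
  have l2: "l = 2" "Q mod 4 = 3" using assms by (auto simp: exceptional_def)
  have e: "Q ^ 2 - 1 = (Q - 1) * (Q + 1)"
    using Q_gt_1 by (simp add: power2_eq_square algebra_simps)
  have "multiplicity 2 (Q - 1) = 1"
  proof (rule multiplicity_eqI)
    have "2 dvd Q - 1" "\<not> 4 dvd Q - 1" using l2(2) by presburger+
    then show "2 ^ 1 dvd Q - 1" "\<not> 2 ^ Suc 1 dvd Q - 1" by simp_all
  qed
  moreover have "Q - 1 \<noteq> 0" using Q_gt_1 by linarith
  ultimately show ?thesis using assms l2 unfolding e v_step_def
    by (subst prime_elem_multiplicity_mult_distrib) auto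
qed

lemma four_exceptional: "exceptional l q \<theta> \<Longrightarrow> 4 dvd Q ^ 2 - 1"
proof -
  assume *: "exceptional l q \<theta>"
  then have "v_step q l \<theta> \<ge> 1"
  proof -
    have "2 dvd Q + 1" using * unfolding exceptional_def by presburger
    then have "Q + 1 \<noteq> 0" "2 ^ 1 dvd Q + 1" by simp_all
    then have "1 \<le> multiplicity 2 (Q + 1)" by (intro multiplicity_geI) auto
    then show ?thesis using * by (simp add: v_step_def)
  qed
  then have "2 \<le> multiplicity l (Q ^ 2 - 1)" using v_step_exceptional[OF *] by simp
  then have "l ^ 2 dvd Q ^ 2 - 1" by (rule multiplicity_dvd')
  then show ?thesis using * by (simp add: exceptional_def)
qed

text \<open>Q interchanges the two odd classes modulo 4, so they form a single orbit; therefore the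
  index a takes only one value here.\<close>

lemma unit_part_exceptional:
  assumes "exceptional l q \<theta>" "\<not> int l dvd e" "\<not> int l dvd y"
  shows "\<exists>s. [e * int Q ^ s = y] (mod int l ^ 2)"
proof -
  have l2: "l = 2" "Q mod 4 = 3" using assms by (auto simp: exceptional_def)
  then have "odd e" "odd y" using assms by auto
  show ?thesis
  proof (cases "[e = y] (mod 4)")
    case True
    then show ?thesis using l2 by (intro exI[of _ 0]) simp
  next
    case False
    have "int Q mod 4 = 3" using l2(2) by (metis of_nat_numeral zmod_int)
    then have "[e * int Q = e * 3] (mod 4)" by (intro cong_scalar_left) (simp add: cong_def)
    moreover have "[e * 3 = y] (mod 4)"
      using False \<open>odd e\<close> \<open>odd y\<close> unfolding cong_def by presburger
    ultimately have "[e * int Q ^ 1 = y] (mod int l ^ 2)" using l2 by (auto intro: cong_trans)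
    then show ?thesis by blast
  qed
qed

text \<open>The case distinctions in the formula for \<tau> compute one quantity: an offset of
  valuation i is \<open>l ^ i\<close> times a unit modulo \<open>l ^ (j - i)\<close>, so its period
  under Q is the order of Q modulo \<open>l ^ (j - i)\<close>.\<close>

lemma tau_step_enat:
  assumes "i < j"
  shows "tau_step q l j \<theta> (enat i) = \<theta> * ord (l ^ (j - i)) Q"
proof (cases "exceptional l q \<theta>")
  case False
  have "ord (l ^ (j - i)) Q = ord l Q * l ^ (j - i - multiplicity l (Q ^ ord l Q - 1))"
    using assms ord_pos four_normal[OF False] period_normal
    by (intro ord_prime_power[OF l(1) Q_gt_1, of 1]) auto
  moreover have "(l - 1) div r_step q l \<theta> = ord l Q"
    using r_step_pos unfolding r_step_mult_ord[symmetric] by simp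
  ultimately show ?thesis using False v_step_normal[OF False] by (simp add: tau_step_def)
next
  case True
  show ?thesis
  proof (cases "i = j - 1")
    \<comment> \<open>Modulo 2 the odd number Q has order 1; this is why the value
      \<open>j - 1\<close> is set apart in \<open>tau_step\<close>.\<close>
    case i: True
    then have "j - i = 1" using assms by simp
    moreover have "ord l Q = 1" using r_step_mult_ord True by (simp add: exceptional_def)
    ultimately show ?thesis using True i by (simp add: tau_step_def)
  next
    case False
    have "ord (l ^ (j - i)) Q = 2 * l ^ (j - i - (v_step q l \<theta> + 1))"
      using assms False four_exceptional[OF True] period_exceptional[OF True] v_step_exceptional[OF True]
      by (intro ord_prime_power[OF l(1) Q_gt_1, of 2]) auto
    \<comment> \<open>Subtraction is truncated: if \<open>j - i\<close> is at most v, the power of l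
      is 1 and only the factor 2 remains, whence the maximum with 1.\<close>
    also have "\<dots> = 2 ^ max 1 (j - i - v_step q l \<theta>)"
      using True by (cases "j - i - v_step q l \<theta>") (auto simp: exceptional_def max_def)
    finally show ?thesis using True False by (simp add: tau_step_def)
  qed
qed

text \<open>Removes the case distinction for what follows: only the unit part \<open>Y a t\<close>
  of the offset from \<Phi> matters, and the pairs of a and t label the orbits of Q on the units
  modulo \<open>l ^ (j - i)\<close> once each.\<close>

lemma rep_unit:
  assumes "i < j"
  obtains Y where
    "\<And>a t. index_ok q l j \<theta> (enat i) a t \<Longrightarrow>
       rep_step q R l j B \<delta> (enat i) a t = \<delta> + int B * (\<Phi> + int l ^ i * Y a t)"
    "\<And>a t. index_ok q l j \<theta> (enat i) a t \<Longrightarrow> \<not> int l dvd Y a t"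
    "\<And>y. \<not> int l dvd y \<Longrightarrow> \<exists>a t. index_ok q l j \<theta> (enat i) a t \<and>
       (\<exists>s. [Y a t * int Q ^ s = y] (mod int l ^ (j - i)))"
    "\<And>y a t a' t'. index_ok q l j \<theta> (enat i) a t \<Longrightarrow> index_ok q l j \<theta> (enat i) a' t' \<Longrightarrow>
       (\<exists>s. [Y a t * int Q ^ s = y] (mod int l ^ (j - i))) \<Longrightarrow>
       (\<exists>s. [Y a' t' * int Q ^ s = y] (mod int l ^ (j - i))) \<Longrightarrow> a = a' \<and> t = t'"
proof -
  obtain C where C: "\<Phi> = (\<Sum>k<i. int (dig k) * int l ^ k) + int (dig i) * int l ^ i + int l ^ (i + 1) * C"
    using \<Phi>_split[OF assms] .
  \<comment> \<open>\<open>U_int\<close> ends at digit i, while \<Phi> continues with the tail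
    \<open>l ^ (i + 1) * C\<close>. Dividing their difference by \<open>l ^ i\<close> leaves the
    difference of the digits minus \<open>l * C\<close>, which for admissible a is a unit because
    the digits differ modulo l.\<close>
  define e where "e a = int (digit_of i a) - int (dig i) - int l * C" for a
  have e: "\<not> int l dvd e a" if "a \<in> {1..r_step q l \<theta>}" for a
    using digit_of(1)[OF that, of i] unfolding e_def by (simp add: dvd_diff_left_iff)
  have edig: "[e a * z = (int (digit_of i a) - int (dig i)) * z] (mod int l)" for a z
    unfolding e_def by (intro cong_scalar_right) (simp add: cong_iff_dvd_diff)
  show ?thesis
  proof (cases "exceptional l q \<theta>")
    case False
    define v where "v = v_step q l \<theta>"
    have ok: "index_ok q l j \<theta> (enat i) a t \<longleftrightarrow>
      a \<in> {1..r_step q l \<theta>} \<and> t \<in> {0..l ^ (min v (j - i) - 1) - 1}" for a t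
      using False by (simp add: index_ok_def v_def)
    have fam: "\<exists>!t. t \<in> {0..l ^ (min v (j - i) - 1) - 1} \<and>
      (\<exists>s. [(e a + int l ^ 1 * int t) * int Q ^ s = y] (mod int l ^ (j - i)))"
      if "a \<in> {1..r_step q l \<theta>}" "[e a * int Q ^ s = y] (mod int l ^ 1)" for a s y
      unfolding v_def v_step_normal[OF False]
      using assms ord_pos four_normal[OF False] period_normal
      by (intro unit_orbit_family[OF l(1) Q_gt_1, of 1 _ "ord l Q", OF _ _ _ _ _ _ e[OF that(1)] that(2)]) auto
    let ?Y = "\<lambda>a t. e a + int l ^ 1 * int t"
    show ?thesis
    proof (rule that[of ?Y])
      fix a t assume "index_ok q l j \<theta> (enat i) a t"
      show "rep_step q R l j B \<delta> (enat i) a t = \<delta> + int B * (\<Phi> + int l ^ i * ?Y a t)"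
        using False unfolding rep_step_def C e_def by (simp add: U_int_eq algebra_simps)
    next
      fix a t assume "index_ok q l j \<theta> (enat i) a t"
      then show "\<not> int l dvd ?Y a t" using e[of a] unfolding ok by (simp add: dvd_add_left_iff)
    next
      fix y assume "\<not> int l dvd y"
      from digit_of(2)[OF this, of i] obtain a s where a: "a \<in> {1..r_step q l \<theta>}"
        and s: "[(int (digit_of i a) - int (dig i)) * int Q ^ s = y] (mod int l)" by blast
      have "[e a * int Q ^ s = y] (mod int l ^ 1)" using cong_trans[OF edig s] by simp
      from fam[OF a this] a show "\<exists>a t. index_ok q l j \<theta> (enat i) a t \<and>
        (\<exists>s. [?Y a t * int Q ^ s = y] (mod int l ^ (j - i)))" unfolding ok by blast
    next
      fix y a t a' t' assume A: "index_ok q l j \<theta> (enat i) a t" "index_ok q l j \<theta> (enat i) a' t'"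
        "\<exists>s. [?Y a t * int Q ^ s = y] (mod int l ^ (j - i))"
        "\<exists>s. [?Y a' t' * int Q ^ s = y] (mod int l ^ (j - i))"
      have m: "\<exists>s. [e a * int Q ^ s = y] (mod int l)" if "\<exists>s. [?Y a t * int Q ^ s = y] (mod int l ^ (j - i))" for a t
      proof -
        from that obtain s where "[?Y a t * int Q ^ s = y] (mod int l ^ (j - i))" by blast
        then have "[?Y a t * int Q ^ s = y] (mod int l)" by (rule cong_dvd_modulus) (use assms in simp)
        moreover have "[e a * int Q ^ s = ?Y a t * int Q ^ s] (mod int l)"
          by (intro cong_scalar_right) (simp add: cong_iff_dvd_diff)
        ultimately show ?thesis using cong_trans by blast
      qed
      then obtain s s' where s: "[e a * int Q ^ s = y] (mod int l)" "[e a' * int Q ^ s' = y] (mod int l)"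
        using A(3,4) by meson
      have "\<not> int l dvd e a * int Q ^ s"
        using e[of a] A(1) unfolding ok by (intro not_dvd_mult_Q) blast
      then have y: "\<not> int l dvd y" using cong_dvd_iff[OF s(1)] by simp
      have "a = a'"
        using digit_of(2)[OF y, of i] A(1,2) cong_trans[OF cong_sym[OF edig] s(1)]
          cong_trans[OF cong_sym[OF edig] s(2)] unfolding ok by blast
      moreover have "t = t'"
        using fam[of a s y] A s(1) \<open>a = a'\<close> unfolding ok by auto
      ultimately show "a = a' \<and> t = t'" by simp
    qed
  next
    case True
    have l2: "l = 2" using True by (simp add: exceptional_def)
    define v where "v = v_step q l \<theta>"
    have r1: "r_step q l \<theta> = 1" using r_step_mult_ord l2 by simp
    have ok: "index_ok q l j \<theta> (enat i) a t \<longleftrightarrow> a = 1 \<and> t \<in> {0..2 ^ min (v - 1) (j - i - 2) - 1}" for a t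
      using True by (simp add: index_ok_def v_def)
    have e1: "\<not> int l dvd e 1" using e r1 by simp
    let ?Y = "\<lambda>a t. e a + int l ^ 2 * int t"
    have Yd: "\<not> int l dvd ?Y 1 t" for t using e1 by (simp add: dvd_add_left_iff power2_eq_square)
    have fam: "\<exists>!t. t \<in> {0..2 ^ min (v - 1) (j - i - 2) - 1} \<and>
      (\<exists>s. [?Y 1 t * int Q ^ s = y] (mod int l ^ (j - i)))" if y: "\<not> int l dvd y" for y
    \<comment> \<open>For \<open>i = j - 1\<close> the units are taken modulo 2 and form one orbit;
      accordingly only \<open>t = 0\<close> is allowed, as \<open>j - i - 2\<close> is truncated to
      0.\<close>
    proof (cases "i = j - 1")
      case i: True
      then have J: "j - i = 1" using assms by simp
      have "[?Y 1 0 * int Q ^ 0 = y] (mod int l ^ (j - i))"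
        using e1 y unfolding J l2 cong_def by simp presburger
      then have "\<exists>s. [?Y 1 0 * int Q ^ s = y] (mod int l ^ (j - i))" by blast
      then show ?thesis by (intro ex1I[of _ 0]) (auto simp: J)
    next
      case False
      obtain s where s: "[e 1 * int Q ^ s = y] (mod int l ^ 2)"
        using unit_part_exceptional[OF True e1 y] by blast
      have "\<exists>!t. t \<in> {0..l ^ (min (v + 1) (j - i) - 2) - 1} \<and>
        (\<exists>s. [?Y 1 t * int Q ^ s = y] (mod int l ^ (j - i)))"
        using assms False four_exceptional[OF True] period_exceptional[OF True] v_step_exceptional[OF True] s e1
        unfolding v_def
        by (intro unit_orbit_family[OF l(1) Q_gt_1, of 2 _ 2]) auto
      \<comment> \<open>The valuation for the period 2 is \<open>v + 1\<close> and two digits are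
        already fixed, so both entries of the minimum drop by 2.\<close>
      moreover have "min (v + 1) (j - i) - 2 = min (v - 1) (j - i - 2)" by (simp add: min_def)
      ultimately show ?thesis using l2 by simp
    qed
    show ?thesis
    proof (rule that[of ?Y])
      fix a t assume "index_ok q l j \<theta> (enat i) a t"
      then have "a = 1" using ok by simp
      then show "rep_step q R l j B \<delta> (enat i) a t = \<delta> + int B * (\<Phi> + int l ^ i * ?Y a t)"
        using True unfolding rep_step_def C e_def by (simp add: U_int_eq[unfolded l2] l2 algebra_simps power2_eq_square)
    next
      fix a t assume "index_ok q l j \<theta> (enat i) a t"
      then show "\<not> int l dvd ?Y a t" using Yd unfolding ok by blast
    next
      fix y assume "\<not> int l dvd y"
      from fam[OF this] show "\<exists>a t. index_ok q l j \<theta> (enat i) a t \<and>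
        (\<exists>s. [?Y a t * int Q ^ s = y] (mod int l ^ (j - i)))" unfolding ok by blast
    next
      fix y a t a' t' assume A: "index_ok q l j \<theta> (enat i) a t" "index_ok q l j \<theta> (enat i) a' t'"
        "\<exists>s. [?Y a t * int Q ^ s = y] (mod int l ^ (j - i))"
        "\<exists>s. [?Y a' t' * int Q ^ s = y] (mod int l ^ (j - i))"
      then obtain s where "[?Y 1 t * int Q ^ s = y] (mod int l ^ (j - i))" unfolding ok by blast
      then have s: "[?Y 1 t * int Q ^ s = y] (mod int l)" by (rule cong_dvd_modulus) (use assms in simp)
      have "\<not> int l dvd ?Y 1 t * int Q ^ s"
        using Yd by (rule not_dvd_mult_Q)
      then have y: "\<not> int l dvd y" using cong_dvd_iff[OF s] by simp
      show "a = a' \<and> t = t'" using fam[OF y] A unfolding ok by blast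
    qed
  qed
qed


text \<open>Collects what the recursion needs to know of a lift, with \<open>\<infinity>\<close> as
  the degenerate value of m: then the offset from \<Phi> is 0, every w annihilates it and every
  power of Q fixes it, in accordance with \<open>co_exp j m = 0\<close>.\<close>

lemma rep_step_form:
  assumes "m \<in> enat ` {0..j - 1} \<union> {\<infinity>}" "index_ok q l j \<theta> m a t"
  obtains x where "rep_step q R l j B \<delta> m a t = \<delta> + int B * x"
    "\<And>w. int l ^ j dvd (x - \<Phi>) * w \<longleftrightarrow> int l ^ co_exp j m dvd w"
    "\<And>s. [(x - \<Phi>) * int Q ^ s = x - \<Phi>] (mod int l ^ j) \<longleftrightarrow> tau_step q l j \<theta> m div \<theta> dvd s"
    "\<theta> dvd tau_step q l j \<theta> m"
proof (cases m)
  case infinity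
  show ?thesis
    by (rule that[of \<Phi>]) (use infinity \<theta>_pos in \<open>auto simp: rep_step_def co_exp_def tau_step_def\<close>)
next
  case (enat i)
  then have i: "i < j" using assms(1) j by auto
  from rep_unit[OF i] obtain Y where Y: "rep_step q R l j B \<delta> (enat i) a t = \<delta> + int B * (\<Phi> + int l ^ i * Y a t)"
    "\<not> int l dvd Y a t" using assms(2) enat by metis
  have j': "int l ^ j = int l ^ i * int l ^ (j - i)" using i by (simp flip: power_add)
  have cop: "coprime (Y a t) (int l ^ (j - i))"
    using Y(2) l(1) by (metis coprime_commute coprime_power_right_iff prime_imp_coprime prime_nat_int_transfer)
  show ?thesis
  proof (rule that[of "\<Phi> + int l ^ i * Y a t"])
    show "rep_step q R l j B \<delta> m a t = \<delta> + int B * (\<Phi> + int l ^ i * Y a t)" using Y(1) enat by simp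
    show "int l ^ j dvd (\<Phi> + int l ^ i * Y a t - \<Phi>) * w \<longleftrightarrow> int l ^ co_exp j m dvd w" for w
    proof -
      have "int l ^ j dvd (\<Phi> + int l ^ i * Y a t - \<Phi>) * w \<longleftrightarrow> int l ^ (j - i) dvd Y a t * w"
        unfolding j' using l_gt_1 by (simp add: mult.assoc)
      also have "\<dots> \<longleftrightarrow> int l ^ (j - i) dvd w"
        using cop by (simp add: coprime_dvd_mult_right_iff coprime_commute)
      finally show ?thesis by (simp add: enat co_exp_def)
    qed
    have tau: "tau_step q l j \<theta> m div \<theta> = ord (l ^ (j - i)) Q" "\<theta> dvd tau_step q l j \<theta> m"
      using tau_step_enat[OF i] enat \<theta>_pos by simp_all
    show "\<theta> dvd tau_step q l j \<theta> m" by (rule tau(2))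
    show "[(\<Phi> + int l ^ i * Y a t - \<Phi>) * int Q ^ s = \<Phi> + int l ^ i * Y a t - \<Phi>] (mod int l ^ j)
      \<longleftrightarrow> tau_step q l j \<theta> m div \<theta> dvd s" for s
    proof -
      have "[(\<Phi> + int l ^ i * Y a t - \<Phi>) * int Q ^ s = \<Phi> + int l ^ i * Y a t - \<Phi>] (mod int l ^ j) \<longleftrightarrow>
        [Y a t * int Q ^ s = Y a t * 1] (mod int l ^ (j - i))"
        unfolding j' using l_gt_1 by (simp add: cong_def mult.assoc mod_mult_mult1)
      also have "\<dots> \<longleftrightarrow> [int (Q ^ s) = int 1] (mod int (l ^ (j - i)))"
        unfolding cong_mult_lcancel[OF cop] by simp
      also have "\<dots> \<longleftrightarrow> tau_step q l j \<theta> m div \<theta> dvd s"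
        unfolding cong_int_iff ord_divides tau ..
      finally show ?thesis .
    qed
  qed
qed

lemma cyc_size_rep_step:
  assumes "m \<in> enat ` {0..j - 1} \<union> {\<infinity>}" "index_ok q l j \<theta> m a t"
  shows "cyc_size q (B * l ^ j) (rep_step q R l j B \<delta> m a t) = tau_step q l j \<theta> m"
  using rep_step_form[OF assms] cyc_size_fibre by (metis dvd_mult_div_cancel)

lemma rep_step_dvd_iff:
  assumes "m \<in> enat ` {0..j - 1} \<union> {\<infinity>}" "index_ok q l j \<theta> m a t"
  shows "int (B * l ^ j) dvd rep_step q R l j B \<delta> m a t * w \<longleftrightarrow> int B dvd \<delta> * w \<and> int l ^ co_exp j m dvd w"
  using rep_step_form[OF assms] dvd_fibre_iff by metis

lemma rep_step_cong:
  assumes "m \<in> enat ` {0..j - 1} \<union> {\<infinity>}" "index_ok q l j \<theta> m a t"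
  shows "[rep_step q R l j B \<delta> m a t = \<delta>] (mod int B)"
proof -
  obtain x where "rep_step q R l j B \<delta> m a t = \<delta> + int B * x" using rep_step_form[OF assms] by metis
  then show ?thesis by (simp add: cong_def)
qed

lemma rep_step_exists:
  assumes "same_coset q B \<delta> z"
  shows "\<exists>m a t. m \<in> enat ` {0..j - 1} \<union> {\<infinity>} \<and> index_ok q l j \<theta> m a t \<and>
    same_coset q (B * l ^ j) (rep_step q R l j B \<delta> m a t) z"
proof -
  have fib: "\<exists>m a t. m \<in> enat ` {0..j - 1} \<union> {\<infinity>} \<and> index_ok q l j \<theta> m a t \<and>
    same_coset q (B * l ^ j) (rep_step q R l j B \<delta> m a t) (\<delta> + int B * x)" for x
  proof (cases "int l ^ j dvd x - \<Phi>")
    case True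
    then have "[x - \<Phi> = 0] (mod int l ^ j)" by (simp only: cong_0_iff)
    from cong_sym[OF this] have "[(\<Phi> - \<Phi>) * int Q ^ 0 = x - \<Phi>] (mod int l ^ j)" by simp
    then have "same_coset q (B * l ^ j) (rep_step q R l j B \<delta> \<infinity> 0 0) (\<delta> + int B * x)"
      using same_coset_fibre[of \<Phi> x] by (auto simp: rep_step_def)
    moreover have "index_ok q l j \<theta> \<infinity> 0 0" by (simp add: index_ok_def)
    ultimately show ?thesis by blast
  next
    case False
    \<comment> \<open>The index m of a lift is the valuation of its offset from \<Phi>; it is below
      j because the offset is nonzero modulo \<open>l ^ j\<close>.\<close>
    define i where "i = multiplicity (int l) (x - \<Phi>)"
    have nz: "x - \<Phi> \<noteq> 0" "\<not> is_unit (int l)" using False l_gt_1 by auto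
    have i: "i < j" using False nz unfolding i_def by (simp add: power_dvd_iff_le_multiplicity)
    obtain y where y: "x - \<Phi> = int l ^ i * y" "\<not> int l dvd y"
      using multiplicity_decompose'[OF nz] unfolding i_def by metis
    obtain Y a t where Y: "index_ok q l j \<theta> (enat i) a t"
      "rep_step q R l j B \<delta> (enat i) a t = \<delta> + int B * (\<Phi> + int l ^ i * Y a t)"
      "\<exists>s. [Y a t * int Q ^ s = y] (mod int l ^ (j - i))"
      using rep_unit[OF i] y(2) by metis
    then obtain s where s: "[Y a t * int Q ^ s = y] (mod int l ^ (j - i))" by blast
    have j': "int l ^ j = int l ^ i * int l ^ (j - i)" using i by (simp flip: power_add)
    have "[(\<Phi> + int l ^ i * Y a t - \<Phi>) * int Q ^ s = x - \<Phi>] (mod int l ^ j)"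
      using s l_gt_1 unfolding y(1) j' by (simp add: cong_def mult.assoc mod_mult_mult1)
    then have "same_coset q (B * l ^ j) (rep_step q R l j B \<delta> (enat i) a t) (\<delta> + int B * x)"
      unfolding Y(2) same_coset_fibre by blast
    moreover have "enat i \<in> enat ` {0..j - 1}" using i by simp
    ultimately show ?thesis using Y(1) by blast
  qed
  \<comment> \<open>A power of q moves z into the fibre over \<delta>, where the fact just proved
    applies.\<close>
  have "same_coset q B z \<delta>" using same_coset_sym[OF B(2) assms] .
  then obtain s where "[z * int q ^ s = \<delta>] (mod int B)" by (auto simp: same_coset_def)
  then obtain x where x: "z * int q ^ s = \<delta> + int B * x" by (metis cong_iff_lin cong_sym)
  have "same_coset q (B * l ^ j) z (\<delta> + int B * x)" by (rule same_cosetI[of _ _ s]) (simp add: x)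
  then have "same_coset q (B * l ^ j) (\<delta> + int B * x) z" by (rule same_coset_sym[OF coprime_modulus])
  then show ?thesis using fib[of x] same_coset_trans by blast
qed

text \<open>Elements of one coset have the same annihilator, which determines
  \<open>co_exp j m\<close> and so m, since every finite value allowed for m has positive
  co-exponent. Then a and t are determined by the orbit of the unit part.\<close>

lemma rep_step_unique:
  assumes m: "m \<in> enat ` {0..j - 1} \<union> {\<infinity>}" "index_ok q l j \<theta> m a t"
    and m': "m' \<in> enat ` {0..j - 1} \<union> {\<infinity>}" "index_ok q l j \<theta> m' a' t'"
    and eq: "same_coset q (B * l ^ j) (rep_step q R l j B \<delta> m a t) (rep_step q R l j B \<delta> m' a' t')"
  shows "m = m' \<and> a = a' \<and> t = t'"
proof -
  let ?M = "B * l ^ j" and ?r = "rep_step q R l j B \<delta>"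
  obtain s where s: "[?r m a t * int q ^ s = ?r m' a' t'] (mod int ?M)"
    using eq by (auto simp: same_coset_def)
  have dvd: "int ?M dvd ?r m a t * w \<longleftrightarrow> int ?M dvd ?r m' a' t' * w" for w
  proof -
    have "int ?M dvd ?r m' a' t' * w \<longleftrightarrow> int ?M dvd ?r m a t * int q ^ s * w"
      using cong_dvd_iff[OF cong_scalar_right[OF s]] by simp
    also have "\<dots> \<longleftrightarrow> int ?M dvd int q ^ s * (?r m a t * w)" by (simp add: mult_ac)
    also have "\<dots> \<longleftrightarrow> int ?M dvd ?r m a t * w"
    proof (rule coprime_dvd_mult_right_iff)
      have "coprime ?M (q ^ s)" using coprime_modulus by simp
      then show "coprime (int ?M) (int q ^ s)" by (metis coprime_int_iff of_nat_power)
    qed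
    finally show ?thesis by simp
  qed
  have co: "co_exp j m = co_exp j m'"
  proof -
    have "int l ^ co_exp j m dvd w \<longleftrightarrow> int l ^ co_exp j m' dvd w" if "int B dvd w" for w
    proof -
      have "int B dvd \<delta> * w" using that by simp
      then show ?thesis using dvd[of w] rep_step_dvd_iff[OF m, of w] rep_step_dvd_iff[OF m', of w] by blast
    qed
    \<comment> \<open>Multiples of B satisfy the condition modulo B in both annihilators, so the
      test values \<open>B * l ^ k\<close> compare only the powers of l.\<close>
    then have "int l ^ co_exp j m dvd int B * int l ^ k \<longleftrightarrow> int l ^ co_exp j m' dvd int B * int l ^ k" for k
      by simp
    moreover have "int l ^ n dvd int B * int l ^ k \<longleftrightarrow> n \<le> k" for n k
    proof -
      have "coprime (int l ^ n) (int B)" using prime_imp_coprime[OF l(1,2)] by simp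
      then have "int l ^ n dvd int B * int l ^ k \<longleftrightarrow> int l ^ n dvd int l ^ k"
        by (rule coprime_dvd_mult_right_iff)
      also have "\<dots> \<longleftrightarrow> n \<le> k" using l_gt_1 by (simp add: dvd_power_iff)
      finally show ?thesis .
    qed
    ultimately have "co_exp j m \<le> k \<longleftrightarrow> co_exp j m' \<le> k" for k by blast
    then show ?thesis by (meson le_antisym order_refl)
  qed
  have mm: "m = m'"
    using co m(1) m'(1) j unfolding co_exp_def by (auto split: enat.splits)
  show ?thesis
  proof (cases m)
    case infinity
    then show ?thesis using m(2) m'(2) mm by (simp add: index_ok_def)
  next
    case (enat i)
    then have i: "i < j" using m(1) j by auto
    have j': "int l ^ j = int l ^ i * int l ^ (j - i)" using i by (simp flip: power_add)
    obtain Y where Y: "\<And>a t. index_ok q l j \<theta> (enat i) a t \<Longrightarrow>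
       rep_step q R l j B \<delta> (enat i) a t = \<delta> + int B * (\<Phi> + int l ^ i * Y a t)"
      and un: "\<And>y a t a' t'. index_ok q l j \<theta> (enat i) a t \<Longrightarrow> index_ok q l j \<theta> (enat i) a' t' \<Longrightarrow>
       (\<exists>s. [Y a t * int Q ^ s = y] (mod int l ^ (j - i))) \<Longrightarrow>
       (\<exists>s. [Y a' t' * int Q ^ s = y] (mod int l ^ (j - i))) \<Longrightarrow> a = a' \<and> t = t'"
      using rep_unit[OF i] by metis
    have ok: "index_ok q l j \<theta> (enat i) a t" "index_ok q l j \<theta> (enat i) a' t'"
      using m m' mm enat by auto
    have "\<exists>s. [(\<Phi> + int l ^ i * Y a t - \<Phi>) * int Q ^ s = \<Phi> + int l ^ i * Y a' t' - \<Phi>] (mod int l ^ j)"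
      using eq unfolding mm[symmetric] enat Y[OF ok(1)] Y[OF ok(2)] same_coset_fibre .
    then have "\<exists>s. [Y a t * int Q ^ s = Y a' t'] (mod int l ^ (j - i))"
      using l_gt_1 unfolding j' by (simp add: cong_def mult.assoc mod_mult_mult1)
    moreover have "\<exists>s. [Y a' t' * int Q ^ s = Y a' t'] (mod int l ^ (j - i))" by (rule exI[of _ 0]) simp
    ultimately show ?thesis using un[OF ok] mm by blast
  qed
qed

end

section \<open>The recursive construction\<close>


lemma tau_seq_cong:
  "(\<And>i. i \<in> {1..k} \<Longrightarrow> m i = m' i) \<Longrightarrow> tau_seq q ps js \<tau> m k = tau_seq q ps js \<tau> m' k"
  by (induction k) auto

lemma rep_seq_cong:
  "(\<And>i. i \<in> {1..k} \<Longrightarrow> m i = m' i \<and> a i = a' i \<and> t i = t' i) \<Longrightarrow>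
    rep_seq q R ps js N0 \<gamma> (m, a, t) k = rep_seq q R ps js N0 \<gamma> (m', a', t') k"
  by (induction k) auto

locale coset_chain =
  fixes q s N0 :: nat and ps js :: "nat \<Rightarrow> nat" and R :: "nat \<Rightarrow> nat \<Rightarrow> int \<Rightarrow> nat set"
  assumes q: "q > 1" and N0: "N0 > 0" "coprime N0 q"
    and ps: "\<And>k. k \<in> {1..s} \<Longrightarrow> prime (ps k) \<and> \<not> ps k dvd q \<and> \<not> ps k dvd N0 \<and> js k > 0"
    and inj: "inj_on ps {1..s}"
    and R: "\<And>B l \<delta>. B > 0 \<Longrightarrow> coprime B q \<Longrightarrow> prime l \<Longrightarrow> \<not> l dvd B \<Longrightarrow> \<not> l dvd q \<Longrightarrow>
      \<not> l dvd q ^ cyc_size q B \<delta> - 1 \<Longrightarrow> full_reps l (q ^ cyc_size q B \<delta>) (R B l \<delta>)"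
begin

definition modulus :: "nat \<Rightarrow> nat" where
  "modulus k = (\<Prod>i=1..k. ps i ^ js i) * N0"

lemma modulus_0 [simp]: "modulus 0 = N0"
  by (simp add: modulus_def)

lemma modulus_Suc: "modulus (Suc k) = modulus k * ps (Suc k) ^ js (Suc k)"
  by (simp add: modulus_def)

lemma coprime_modulus:
  assumes "k \<le> s"
  shows "coprime (modulus k) q"
proof -
  have "coprime (ps i) q" if "i \<in> {1..k}" for i
    using ps[of i] that assms by (intro prime_imp_coprime) auto
  then show ?thesis unfolding modulus_def using N0(2) by (auto intro!: prod_coprime_left)
qed

lemma coprime_partial_prod:
  assumes "k < s"
  shows "coprime (ps (Suc k)) ((\<Prod>i=1..k. ps i ^ c i) * N0)"
proof -
  have k: "Suc k \<in> {1..s}" using assms by simp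
  have "coprime (ps (Suc k)) (ps i ^ c i)" if "i \<in> {1..k}" for i
  proof -
    have i: "i \<in> {1..s}" "Suc k \<noteq> i" using that assms by auto
    then have "ps (Suc k) \<noteq> ps i" using inj_onD[OF inj _ k] by blast
    then have "coprime (ps (Suc k)) (ps i)" using ps[OF k] ps[OF i(1)] by (intro primes_coprime) auto
    then show ?thesis by simp
  qed
  moreover have "coprime (ps (Suc k)) N0" using ps[OF k] by (intro prime_imp_coprime) auto
  ultimately show ?thesis by (auto intro!: prod_coprime_right)
qed

text \<open>The exponents are left free because they will be the \<open>co_exp\<close> of an index,
  and the product the order of the root.\<close>

lemma prod_dvd_iff:
  assumes "k \<le> s"
  shows "int ((\<Prod>i=1..k. ps i ^ c i) * N0) dvd w \<longleftrightarrow>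
    int N0 dvd w \<and> (\<forall>i\<in>{1..k}. int (ps i) ^ c i dvd w)"
  using assms
proof (induction k)
  case (Suc k)
  let ?P = "(\<Prod>i=1..k. ps i ^ c i) * N0"
  have "coprime (ps (Suc k) ^ c (Suc k)) ?P" using coprime_partial_prod[of k c] Suc.prems by simp
  then have cop: "coprime (int (ps (Suc k) ^ c (Suc k))) (int ?P)" unfolding coprime_int_iff .
  have "int ((\<Prod>i=1..Suc k. ps i ^ c i) * N0) = int (ps (Suc k) ^ c (Suc k)) * int ?P" by simp
  also have "\<dots> dvd w \<longleftrightarrow> int (ps (Suc k) ^ c (Suc k)) dvd w \<and> int ?P dvd w"
    using divides_mult[OF _ _ cop, of w] by (auto simp only: dest: dvd_mult_left dvd_mult_right)
  also have "\<dots> \<longleftrightarrow> int N0 dvd w \<and> (\<forall>i\<in>insert (Suc k) {1..k}. int (ps i) ^ c i dvd w)"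
    using Suc by auto
  also have "insert (Suc k) {1..k} = {1..Suc k}" by auto
  finally show ?case .
qed simp

lemma coset_step:
  assumes "k < s"
  shows "coset_step q (ps (Suc k)) (modulus k) (js (Suc k)) \<delta> R"
proof -
  have k: "Suc k \<in> {1..s}" using assms by simp
  have psi: "prime (ps i)" "\<not> ps i dvd q" if "i \<in> {1..k}" for i using ps[of i] that assms by auto
  have "modulus k > 0" unfolding modulus_def using N0 psi(1) prime_gt_0_nat by (auto intro!: prod_pos)
  moreover have "coprime (modulus k) q" using coprime_modulus assms by simp
  moreover have "\<not> ps (Suc k) dvd modulus k"
  proof
    assume "ps (Suc k) dvd modulus k"
    then have "is_unit (ps (Suc k))"
      using coprime_partial_prod[OF assms, of js] coprime_absorb_left unfolding modulus_def by blast
    then show False using ps[OF k] by simp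
  qed
  ultimately show ?thesis using q ps[OF k] R by unfold_locales auto
qed

text \<open>The conditions of \<open>index_set\<close> on the first k entries, stated without
  extensionality so that an induction can overwrite the next entry.\<close>

definition ok_upto :: "nat \<Rightarrow> int \<Rightarrow> index \<Rightarrow> bool" where
  "ok_upto k \<gamma> = (\<lambda>(m, a, t). \<forall>i\<in>{1..k}. m i \<in> enat ` {0..js i - 1} \<union> {\<infinity>} \<and>
     index_ok q (ps i) (js i) (tau_seq q ps js (cyc_size q N0 \<gamma>) m (i - 1)) (m i) (a i) (t i))"

lemma ok_upto_Suc: "ok_upto (Suc k) \<gamma> (m, a, t) \<longleftrightarrow> ok_upto k \<gamma> (m, a, t) \<and>
    m (Suc k) \<in> enat ` {0..js (Suc k) - 1} \<union> {\<infinity>} \<and>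
    index_ok q (ps (Suc k)) (js (Suc k)) (tau_seq q ps js (cyc_size q N0 \<gamma>) m k) (m (Suc k)) (a (Suc k)) (t (Suc k))"
proof -
  have "{1..Suc k} = insert (Suc k) {1..k}" by auto
  then show ?thesis by (auto simp: ok_upto_def)
qed

lemma rep_seq_Suc:
  "rep_seq q R ps js N0 \<gamma> (m, a, t) (Suc k) =
    rep_step q R (ps (Suc k)) (js (Suc k)) (modulus k) (rep_seq q R ps js N0 \<gamma> (m, a, t) k)
      (m (Suc k)) (a (Suc k)) (t (Suc k))"
  by (simp add: modulus_def)

lemma ok_upto_cong:
  assumes "\<And>i. i \<in> {1..k} \<Longrightarrow> m i = m' i \<and> a i = a' i \<and> t i = t' i"
  shows "ok_upto k \<gamma> (m, a, t) \<longleftrightarrow> ok_upto k \<gamma> (m', a', t')"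
proof -
  have "tau_seq q ps js \<tau> m (i - 1) = tau_seq q ps js \<tau> m' (i - 1)" if "i \<in> {1..k}" for i \<tau>
    using assms that by (intro tau_seq_cong) auto
  then show ?thesis using assms by (simp add: ok_upto_def)
qed

text \<open>The size has to be part of the induction: admissibility of an entry is phrased with
  \<open>tau_seq\<close>, whereas the facts about one step use the actual coset size. The
  annihilator is carried along for the order of the root, the congruence for comparing chains with
  different starting points.\<close>

lemma rep_seq_invariants:
  assumes "k \<le> s" "ok_upto k \<gamma> (m, a, t)"
  shows "cyc_size q (modulus k) (rep_seq q R ps js N0 \<gamma> (m, a, t) k) =
           tau_seq q ps js (cyc_size q N0 \<gamma>) m k \<and>
         (\<forall>w. int (modulus k) dvd rep_seq q R ps js N0 \<gamma> (m, a, t) k * w \<longleftrightarrow>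
            int N0 dvd \<gamma> * w \<and> (\<forall>i\<in>{1..k}. int (ps i) ^ co_exp (js i) (m i) dvd w)) \<and>
         [rep_seq q R ps js N0 \<gamma> (m, a, t) k = \<gamma>] (mod int N0)"
  using assms
proof (induction k)
  case 0
  then show ?case by simp
next
  case (Suc k)
  let ?r = "rep_seq q R ps js N0 \<gamma> (m, a, t)"
  have k: "k < s" using Suc.prems by simp
  have IH: "cyc_size q (modulus k) (?r k) = tau_seq q ps js (cyc_size q N0 \<gamma>) m k"
    "\<And>w. int (modulus k) dvd ?r k * w \<longleftrightarrow>
            int N0 dvd \<gamma> * w \<and> (\<forall>i\<in>{1..k}. int (ps i) ^ co_exp (js i) (m i) dvd w)"
    "[?r k = \<gamma>] (mod int N0)"
    using Suc unfolding ok_upto_Suc by auto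
  interpret st: coset_step q "ps (Suc k)" "modulus k" "js (Suc k)" "?r k" R
    using coset_step[OF k] .
  have m: "m (Suc k) \<in> enat ` {0..js (Suc k) - 1} \<union> {\<infinity>}"
    "index_ok q (ps (Suc k)) (js (Suc k)) (cyc_size q (modulus k) (?r k)) (m (Suc k)) (a (Suc k)) (t (Suc k))"
    using Suc.prems(2) unfolding ok_upto_Suc IH(1) by auto
  have ins: "{1..Suc k} = insert (Suc k) {1..k}" by auto
  have "[?r (Suc k) = ?r k] (mod int N0)"
    unfolding rep_seq_Suc by (rule cong_dvd_modulus[OF st.rep_step_cong[OF m]]) (simp add: modulus_def)
  then have "[?r (Suc k) = \<gamma>] (mod int N0)" using IH(3) by (rule cong_trans)
  moreover have "cyc_size q (modulus (Suc k)) (?r (Suc k)) = tau_seq q ps js (cyc_size q N0 \<gamma>) m (Suc k)"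
    unfolding rep_seq_Suc modulus_Suc st.cyc_size_rep_step[OF m] by (simp add: IH(1))
  moreover have "int (modulus (Suc k)) dvd ?r (Suc k) * w \<longleftrightarrow>
            int N0 dvd \<gamma> * w \<and> (\<forall>i\<in>{1..Suc k}. int (ps i) ^ co_exp (js i) (m i) dvd w)" for w
    unfolding rep_seq_Suc modulus_Suc st.rep_step_dvd_iff[OF m] ins IH(2) by blast
  ultimately show ?case by blast
qed

lemma rep_seq_exists:
  assumes "k \<le> s" "same_coset q N0 \<gamma> z"
  shows "\<exists>m a t. ok_upto k \<gamma> (m, a, t) \<and> same_coset q (modulus k) (rep_seq q R ps js N0 \<gamma> (m, a, t) k) z"
  using assms(1)
proof (induction k)
  case 0
  then show ?case using assms(2) by (simp add: ok_upto_def)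
next
  case (Suc k)
  then obtain m a t where ok: "ok_upto k \<gamma> (m, a, t)"
    and same: "same_coset q (modulus k) (rep_seq q R ps js N0 \<gamma> (m, a, t) k) z" by auto
  let ?r = "rep_seq q R ps js N0 \<gamma> (m, a, t) k"
  have k: "k < s" using Suc.prems by simp
  interpret st: coset_step q "ps (Suc k)" "modulus k" "js (Suc k)" ?r R
    using coset_step[OF k] .
  obtain m' a' t' where n: "m' \<in> enat ` {0..js (Suc k) - 1} \<union> {\<infinity>}"
    "index_ok q (ps (Suc k)) (js (Suc k)) (cyc_size q (modulus k) ?r) m' a' t'"
    "same_coset q (modulus k * ps (Suc k) ^ js (Suc k))
       (rep_step q R (ps (Suc k)) (js (Suc k)) (modulus k) ?r m' a' t') z"
    using st.rep_step_exists[OF same] by blast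
  \<comment> \<open>Only entry \<open>Suc k\<close> is overwritten, so the representatives and sizes
    up to k stay the same.\<close>
  let ?m = "m(Suc k := m')" and ?a = "a(Suc k := a')" and ?t = "t(Suc k := t')"
  have agree: "?m i = m i \<and> ?a i = a i \<and> ?t i = t i" if "i \<in> {1..k}" for i using that by simp
  have r: "rep_seq q R ps js N0 \<gamma> (?m, ?a, ?t) k = ?r" by (rule rep_seq_cong[OF agree])
  have tau: "tau_seq q ps js (cyc_size q N0 \<gamma>) ?m k = cyc_size q (modulus k) ?r"
    using rep_seq_invariants[of k \<gamma> m a t] k ok tau_seq_cong[of k ?m m] agree by simp
  have "ok_upto k \<gamma> (?m, ?a, ?t)" using ok ok_upto_cong[of k ?m m ?a a ?t t \<gamma>] agree by simp
  then have "ok_upto (Suc k) \<gamma> (?m, ?a, ?t)" unfolding ok_upto_Suc tau using n by simp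
  moreover have "same_coset q (modulus (Suc k)) (rep_seq q R ps js N0 \<gamma> (?m, ?a, ?t) (Suc k)) z"
    unfolding rep_seq_Suc modulus_Suc r using n(3) by simp
  ultimately show ?case by blast
qed

text \<open>A step does not change the class modulo the old modulus, so equality of cosets descends
  to level k. By induction the earlier entries agree, both last steps start at the same integer, and
  uniqueness for one step applies.\<close>

lemma rep_seq_unique:
  assumes "k \<le> s" "ok_upto k \<gamma> (m, a, t)" "ok_upto k \<gamma> (m', a', t')"
    "same_coset q (modulus k) (rep_seq q R ps js N0 \<gamma> (m, a, t) k) (rep_seq q R ps js N0 \<gamma> (m', a', t') k)"
  shows "\<forall>i\<in>{1..k}. m i = m' i \<and> a i = a' i \<and> t i = t' i"
  using assms
proof (induction k)
  case 0
  then show ?case by simp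
next
  case (Suc k)
  let ?r = "rep_seq q R ps js N0 \<gamma> (m, a, t)" and ?r' = "rep_seq q R ps js N0 \<gamma> (m', a', t')"
  have k: "k < s" using Suc.prems by simp
  have ok: "ok_upto k \<gamma> (m, a, t)" "ok_upto k \<gamma> (m', a', t')"
    using Suc.prems unfolding ok_upto_Suc by auto
  interpret st: coset_step q "ps (Suc k)" "modulus k" "js (Suc k)" "?r k" R
    using coset_step[OF k] .
  interpret st': coset_step q "ps (Suc k)" "modulus k" "js (Suc k)" "?r' k" R
    using coset_step[OF k] .
  have size: "cyc_size q (modulus k) (?r k) = tau_seq q ps js (cyc_size q N0 \<gamma>) m k"
    "cyc_size q (modulus k) (?r' k) = tau_seq q ps js (cyc_size q N0 \<gamma>) m' k"
    using rep_seq_invariants[of k] ok k by auto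
  have M: "m (Suc k) \<in> enat ` {0..js (Suc k) - 1} \<union> {\<infinity>}"
    "index_ok q (ps (Suc k)) (js (Suc k)) (cyc_size q (modulus k) (?r k)) (m (Suc k)) (a (Suc k)) (t (Suc k))"
    using Suc.prems(2) unfolding ok_upto_Suc size by auto
  have M': "m' (Suc k) \<in> enat ` {0..js (Suc k) - 1} \<union> {\<infinity>}"
    "index_ok q (ps (Suc k)) (js (Suc k)) (cyc_size q (modulus k) (?r' k)) (m' (Suc k)) (a' (Suc k)) (t' (Suc k))"
    using Suc.prems(3) unfolding ok_upto_Suc size by auto
  have "same_coset q (modulus k) (?r (Suc k)) (?r' (Suc k))"
    using Suc.prems(4) by (rule same_coset_dvd_modulus) (simp add: modulus_Suc)
  moreover have "same_coset q (modulus k) (?r k) (?r (Suc k))"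
    unfolding rep_seq_Suc by (intro same_coset_cong cong_sym[OF st.rep_step_cong[OF M]])
  moreover have "same_coset q (modulus k) (?r' (Suc k)) (?r' k)"
    unfolding rep_seq_Suc by (intro same_coset_cong st'.rep_step_cong[OF M'])
  ultimately have "same_coset q (modulus k) (?r k) (?r' k)" using same_coset_trans by blast
  then have agree: "\<forall>i\<in>{1..k}. m i = m' i \<and> a i = a' i \<and> t i = t' i"
    using Suc.IH ok k by simp
  then have r: "?r' k = ?r k" by (intro rep_seq_cong) auto
  have "m (Suc k) = m' (Suc k) \<and> a (Suc k) = a' (Suc k) \<and> t (Suc k) = t' (Suc k)"
    using st.rep_step_unique[OF M M'[unfolded r]] Suc.prems(4) unfolding rep_seq_Suc modulus_Suc r by blast
  moreover have "{1..Suc k} = insert (Suc k) {1..k}" by auto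
  ultimately show ?case using agree by simp
qed

lemma index_set_iff:
  "(m, a, t) \<in> index_set q s ps js N0 \<gamma> \<longleftrightarrow>
    m \<in> extensional {1..s} \<and> a \<in> extensional {1..s} \<and> t \<in> extensional {1..s} \<and> ok_upto s \<gamma> (m, a, t)"
  by (auto simp: index_set_def ok_upto_def PiE_iff)

lemma index_set_unique:
  assumes "I \<in> index_set q s ps js N0 \<gamma>" "I' \<in> index_set q s ps js N0 \<gamma>"
    "same_coset q (modulus s) (rep_seq q R ps js N0 \<gamma> I s) (rep_seq q R ps js N0 \<gamma> I' s)"
  shows "I = I'"
proof -
  obtain m a t where I1: "I = (m, a, t)" using prod_cases3 by blast
  obtain m' a' t' where I2: "I' = (m', a', t')" using prod_cases3 by blast
  note I = I1 I2
  have "\<forall>i\<in>{1..s}. m i = m' i \<and> a i = a' i \<and> t i = t' i"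
    using rep_seq_unique[of s \<gamma> m a t m' a' t'] assms unfolding I index_set_iff by simp
  then have "m = m'" "a = a'" "t = t'"
    using assms(1,2) unfolding I index_set_iff by (auto intro: extensionalityI)
  then show ?thesis by (simp add: I)
qed

lemma index_set_exists:
  assumes "same_coset q N0 \<gamma> z"
  shows "\<exists>I\<in>index_set q s ps js N0 \<gamma>. same_coset q (modulus s) (rep_seq q R ps js N0 \<gamma> I s) z"
proof -
  obtain m a t where ok: "ok_upto s \<gamma> (m, a, t)"
    and same: "same_coset q (modulus s) (rep_seq q R ps js N0 \<gamma> (m, a, t) s) z"
    using rep_seq_exists[OF order_refl assms] by blast
  let ?m = "restrict m {1..s}" and ?a = "restrict a {1..s}" and ?t = "restrict t {1..s}"
  have "ok_upto s \<gamma> (?m, ?a, ?t)" using ok ok_upto_cong[of s ?m m ?a a ?t t \<gamma>] by simp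
  then have "(?m, ?a, ?t) \<in> index_set q s ps js N0 \<gamma>" unfolding index_set_iff by simp
  moreover have "rep_seq q R ps js N0 \<gamma> (?m, ?a, ?t) s = rep_seq q R ps js N0 \<gamma> (m, a, t) s"
    by (intro rep_seq_cong) auto
  ultimately show ?thesis using same by metis
qed

lemma index_set_invariants:
  assumes "(m, a, t) \<in> index_set q s ps js N0 \<gamma>"
  shows "cyc_size q (modulus s) (rep_seq q R ps js N0 \<gamma> (m, a, t) s) = tau_seq q ps js (cyc_size q N0 \<gamma>) m s"
    "int (modulus s) dvd rep_seq q R ps js N0 \<gamma> (m, a, t) s * w \<longleftrightarrow>
      int N0 dvd \<gamma> * w \<and> (\<forall>i\<in>{1..s}. int (ps i) ^ co_exp (js i) (m i) dvd w)"
    "[rep_seq q R ps js N0 \<gamma> (m, a, t) s = \<gamma>] (mod int N0)"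
  using rep_seq_invariants[of s \<gamma> m a t] assms unfolding index_set_iff by auto

end

section \<open>The cosets modulo the part of the modulus supported on the primes of \<open>g\<close>\<close>


lemma gcd_mult_coprime:
  fixes a b y :: nat
  assumes "coprime a b"
  shows "gcd (a * b) y = gcd a y * gcd b y"
proof (rule dvd_antisym)
  obtain b' c' where bc: "gcd (a * b) y = b' * c'" "b' dvd a" "c' dvd b"
    using division_decomp[of "gcd (a * b) y" a b] by auto
  have "b' * c' dvd y" using bc(1) by (metis gcd_dvd2)
  then have "b' dvd gcd a y" "c' dvd gcd b y"
    using bc(2,3) by (auto dest: dvd_mult_left dvd_mult_right)
  then show "gcd (a * b) y dvd gcd a y * gcd b y" unfolding bc(1) by (rule mult_dvd_mono)
  have "coprime (gcd a y) (gcd b y)"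
    using assms by (meson coprime_divisors gcd_dvd1)
  then have "gcd a y * gcd b y dvd y" by (intro divides_mult) auto
  then show "gcd a y * gcd b y dvd gcd (a * b) y" by (intro gcd_greatest mult_dvd_mono) auto
qed

lemma gcd_prod_prime_powers:
  fixes l a :: "'b \<Rightarrow> nat"
  assumes "finite K" "\<And>k. k \<in> K \<Longrightarrow> prime (l k)" "inj_on l K" "y \<noteq> 0"
  shows "gcd (\<Prod>k\<in>K. l k ^ a k) y = (\<Prod>k\<in>K. l k ^ min (a k) (multiplicity (l k) y))"
  using assms
proof (induction K rule: finite_induct)
  case (insert k K)
  have "coprime (l k ^ a k) (\<Prod>k\<in>K. l k ^ a k)"
  proof (rule prod_coprime_right)
    fix i assume i: "i \<in> K"
    then have "l k \<noteq> l i" using insert by (auto simp: inj_on_def)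
    then have "coprime (l k) (l i)" using insert i by (intro primes_coprime) auto
    then show "coprime (l k ^ a k) (l i ^ a i)" by simp
  qed
  then show ?case using insert by (simp add: gcd_mult_coprime gcd_prime_power)
qed simp

text \<open>For a unit x the claim concerns the quotient of y by x and the powers of Q, which are
  exactly the classes that are 1 modulo \<open>gcd M (Q - 1)\<close>.\<close>

lemma same_coset_iff_cong_gcd:
  fixes Q M :: nat and x y :: int
  assumes "M > 0" "Q > 1" "\<And>l. prime l \<Longrightarrow> l dvd M \<Longrightarrow> l dvd Q - 1" "8 dvd M \<Longrightarrow> 4 dvd Q - 1"
    and x: "coprime x (int M)"
  shows "same_coset Q M x y \<longleftrightarrow> [x = y] (mod int (gcd M (Q - 1)))"
proof
  let ?D = "gcd M (Q - 1)"
  assume "same_coset Q M x y"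
  then obtain i where i: "[x * int Q ^ i = y] (mod int M)" by (auto simp: same_coset_def)
  have "int ?D dvd int (Q - 1)" by (simp only: int_dvd_int_iff gcd_dvd2)
  then have "[int Q = 1] (mod int ?D)" using assms(2) by (simp add: cong_iff_dvd_diff of_nat_diff)
  then have "[int Q ^ i = 1 ^ i] (mod int ?D)" by (rule cong_pow)
  then have "[x * int Q ^ i = x * 1] (mod int ?D)" by (intro cong_scalar_left) simp
  moreover have "[x * int Q ^ i = y] (mod int ?D)"
    by (rule cong_dvd_modulus[OF i]) (simp only: int_dvd_int_iff gcd_dvd1)
  ultimately show "[x = y] (mod int ?D)" by (simp add: cong_def)
next
  let ?D = "gcd M (Q - 1)"
  assume xy: "[x = y] (mod int ?D)"
  obtain w where w: "[x * w = 1] (mod int M)" using cong_solve_coprime_int[OF x] by blast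
  have "[y * w = x * w] (mod int ?D)" using cong_sym[OF xy] by (rule cong_scalar_right)
  moreover have "[x * w = 1] (mod int ?D)"
    by (rule cong_dvd_modulus[OF w]) (simp only: int_dvd_int_iff gcd_dvd1)
  ultimately have "[y * w = 1] (mod int ?D)" by (rule cong_trans)
  from power_cong_one_mod_gcd[OF assms(1-4) this] obtain i where "[int Q ^ i = y * w] (mod int M)" by blast
  then have "[x * int Q ^ i = x * (y * w)] (mod int M)" by (rule cong_scalar_left)
  also have "x * (y * w) = y * (x * w)" by (simp add: mult_ac)
  also have "[\<dots> = y * 1] (mod int M)" using w by (rule cong_scalar_left)
  finally show "same_coset Q M x y" by (intro same_cosetI) simp
qed

text \<open>The kind of sum that occurs in \<open>gamma_x\<close>. It is no ordinary positional
  system: the weights grow with the exponents F, while the digits will be bounded by possibly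
  smaller exponents Y. Digits are therefore recovered by congruences, one prime at a time, and not
  by size.\<close>

definition radix_sum :: "nat \<Rightarrow> (nat \<Rightarrow> nat) \<Rightarrow> (nat \<Rightarrow> nat) \<Rightarrow> (nat \<Rightarrow> nat) \<Rightarrow> int" where
  "radix_sum u l F x = (\<Sum>k=1..u. (\<Prod>i=1..<k. int (l i) ^ F i) * int (x k))"

text \<open>Modulo \<open>l k ^ Y k\<close> the terms after k vanish, because their weights contain
  \<open>l k ^ F k\<close> and \<open>Y k \<le> F k\<close>; the terms before k agree by induction,
  and the weight of \<open>x k\<close> is a unit.\<close>

lemma radix_sum_unique:
  assumes pr: "\<And>k. k \<in> {1..u} \<Longrightarrow> prime (l k)" and inj: "inj_on l {1..u}"
    and le: "\<And>k. k \<in> {1..u} \<Longrightarrow> Y k \<le> F k"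
    and x: "x \<in> PiE {1..u} (\<lambda>k. {0..l k ^ Y k - 1})" and x': "x' \<in> PiE {1..u} (\<lambda>k. {0..l k ^ Y k - 1})"
    and eq: "[radix_sum u l F x = radix_sum u l F x'] (mod int (\<Prod>k=1..u. l k ^ Y k))"
  shows "x = x'"
proof -
  have "x k = x' k" if "k \<in> {1..u}" for k
    using that
  proof (induction k rule: less_induct)
    case (less k)
    let ?c = "\<lambda>k. \<Prod>i=1..<k. int (l i) ^ F i" and ?L = "int (l k) ^ Y k"
    have split: "[radix_sum u l F z = (\<Sum>i=1..<k. ?c i * int (z i)) + ?c k * int (z k)] (mod ?L)" for z
    proof -
      have "{1..u} = {1..<k} \<union> {k} \<union> {k<..u}" using less.prems by auto
      then have "radix_sum u l F z = (\<Sum>i\<in>{1..<k} \<union> {k}. ?c i * int (z i)) + (\<Sum>i\<in>{k<..u}. ?c i * int (z i))"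
        unfolding radix_sum_def by (simp only:) (rule sum.union_disjoint; auto)
      moreover have "?L dvd (\<Sum>i\<in>{k<..u}. ?c i * int (z i))"
      proof (intro dvd_sum dvd_mult2)
        fix i assume "i \<in> {k<..u}"
        then have "int (l k) ^ F k dvd ?c i" using less.prems by (intro dvd_prodI[of _ k "\<lambda>i. int (l i) ^ F i"]) auto
        then show "?L dvd ?c i" using le[OF less.prems] by (meson dvd_trans le_imp_power_dvd)
      qed
      ultimately show ?thesis by (simp add: cong_iff_dvd_diff)
    qed
    have "?L dvd int (\<Prod>k=1..u. l k ^ Y k)"
      using dvd_prodI[of "{1..u}" k "\<lambda>k. l k ^ Y k"] less.prems
      by (metis finite_atLeastAtMost int_dvd_int_iff of_nat_power)
    with eq have "[radix_sum u l F x = radix_sum u l F x'] (mod ?L)" by (rule cong_dvd_modulus)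
    then have "[(\<Sum>i=1..<k. ?c i * int (x i)) + ?c k * int (x k) =
      (\<Sum>i=1..<k. ?c i * int (x' i)) + ?c k * int (x' k)] (mod ?L)"
      using split[of x] split[of x'] by (meson cong_sym cong_trans)
    moreover have "(\<Sum>i=1..<k. ?c i * int (x i)) = (\<Sum>i=1..<k. ?c i * int (x' i))"
      using less by (intro sum.cong) auto
    ultimately have "[?c k * int (x k) = ?c k * int (x' k)] (mod ?L)" by (simp add: cong_add_lcancel)
    moreover have "coprime (?c k) ?L"
    proof (rule prod_coprime_left)
      fix i assume "i \<in> {1..<k}"
      then have "i \<in> {1..u}" "i \<noteq> k" using less.prems by auto
      then have "l i \<noteq> l k" using inj_onD[OF inj _ _ less.prems] by blast
      then have "coprime (l i) (l k)" using pr less.prems \<open>i \<in> {1..u}\<close> by (intro primes_coprime) auto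
      then show "coprime (int (l i) ^ F i) ?L" by simp
    qed
    ultimately have "[int (x k) = int (x' k)] (mod int (l k ^ Y k))" by (simp add: cong_mult_lcancel)
    then have "[x k = x' k] (mod l k ^ Y k)" by (simp only: cong_int_iff)
    moreover have "l k ^ Y k > 0" using pr[OF less.prems] prime_gt_0_nat by simp
    moreover have "x k \<in> {0..l k ^ Y k - 1}" "x' k \<in> {0..l k ^ Y k - 1}" using x x' less.prems by auto
    moreover have "n < L" if "L > 0" "n \<in> {0..L - 1}" for n L :: nat using that by simp
    ultimately have "x k < l k ^ Y k" "x' k < l k ^ Y k" by blast+
    with \<open>[x k = x' k] (mod l k ^ Y k)\<close> show ?case by (rule cong_less_modulus_unique_nat)
  qed
  then show ?thesis using x x' by (intro PiE_ext) auto
qed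

text \<open>There are as many tuples as residues modulo the product, so injectivity gives
  surjectivity.\<close>

lemma radix_sum_exists:
  assumes pr: "\<And>k. k \<in> {1..u} \<Longrightarrow> prime (l k)" and inj: "inj_on l {1..u}"
    and le: "\<And>k. k \<in> {1..u} \<Longrightarrow> Y k \<le> F k"
  shows "\<exists>x\<in>PiE {1..u} (\<lambda>k. {0..l k ^ Y k - 1}). [radix_sum u l F x = z] (mod int (\<Prod>k=1..u. l k ^ Y k))"
proof -
  define P where "P = PiE {1..u} (\<lambda>k. {0..l k ^ Y k - 1})"
  define D where "D = (\<Prod>k=1..u. l k ^ Y k)"
  let ?f = "\<lambda>x. radix_sum u l F x mod int D"
  have D: "D > 0" unfolding D_def using pr prime_gt_0_nat by (auto intro!: prod_pos)
  have "inj_on ?f P"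
  proof (rule inj_onI)
    fix x x' assume *: "x \<in> P" "x' \<in> P" "?f x = ?f x'"
    have "[radix_sum u l F x = radix_sum u l F x'] (mod int D)" using *(3) unfolding cong_def .
    from radix_sum_unique[OF pr inj le *(1,2)[unfolded P_def] this[unfolded D_def]] show "x = x'" .
  qed
  then have "card (?f ` P) = card P" by (rule card_image)
  also have "\<dots> = (\<Prod>k=1..u. card {0..l k ^ Y k - 1})" unfolding P_def by (rule card_PiE) simp
  also have "\<dots> = D" unfolding D_def using pr prime_gt_0_nat by (intro prod.cong) auto
  also have "\<dots> = card {0..<int D}" by simp
  finally have "?f ` P = {0..<int D}" using D by (intro card_seteq) auto
  moreover have "z mod int D \<in> {0..<int D}" using D by simp
  ultimately have "z mod int D \<in> ?f ` P" by simp
  then show ?thesis unfolding P_def[symmetric] D_def[symmetric] cong_def by auto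
qed

section \<open>Orbits of q on the classes that are 1 modulo g\<close>

locale base_cosets =
  fixes q u :: nat and gs es fs :: "nat \<Rightarrow> nat"
  assumes q: "q > 1" and gs: "\<And>k. k \<in> {1..u} \<Longrightarrow> prime (gs k) \<and> es k > 0"
    and mono: "strict_mono_on {1..u} gs"
    and g_dvd: "(\<Prod>k=1..u. gs k ^ es k) dvd q - 1"
begin

definition g :: nat where "g = (\<Prod>k=1..u. gs k ^ es k)"
definition n1 :: nat where "n1 = (\<Prod>k=1..u. gs k ^ fs k)"
definition y :: "nat \<Rightarrow> nat" where "y = y_exp q gs es fs"
text \<open>The number of tuples x. In the ordinary case \<open>g * D\<close> turns out to be
  \<open>gcd (n1 * g) (q - 1)\<close>, in the exceptional one \<open>2 * g * D\<close> is
  \<open>gcd (n1 * g) (q ^ 2 - 1)\<close>.\<close>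

definition D :: nat where "D = (\<Prod>k=1..u. gs k ^ y k)"

lemma inj_gs: "inj_on gs {1..u}"
  using mono by (rule strict_mono_on_imp_inj_on)

lemma g_pos: "g > 0" and n1_pos: "n1 > 0"
  unfolding g_def n1_def using gs prime_gt_0_nat by (auto intro!: prod_pos)

lemma n1_g: "n1 * g = (\<Prod>k=1..u. gs k ^ (fs k + es k))"
  by (simp add: n1_def g_def prod.distrib power_add)

lemma gs_dvd_g: "k \<in> {1..u} \<Longrightarrow> gs k ^ es k dvd g"
  unfolding g_def by (rule dvd_prodI) auto

lemma prime_dvd_n1_g:
  assumes "prime l" "l dvd n1 * g"
  obtains k where "k \<in> {1..u}" "l = gs k"
proof -
  obtain k where k: "k \<in> {1..u}" "l dvd gs k ^ (fs k + es k)"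
    using assms unfolding n1_g by (auto simp: prime_dvd_prod_iff)
  then have "l dvd gs k" using assms(1) prime_dvd_power by blast
  then have "l = gs k" using assms(1) gs[OF k(1)] by (metis primes_dvd_imp_eq)
  with k that show ?thesis by blast
qed

lemma prime_dvd_g:
  assumes "prime l" "l dvd n1 * g"
  shows "l dvd g"
proof -
  obtain k where k: "k \<in> {1..u}" "l = gs k" using prime_dvd_n1_g[OF assms] .
  then have "l dvd gs k ^ es k" using gs[OF k(1)] unfolding k(2) by (intro dvd_power) auto
  then show ?thesis using gs_dvd_g[OF k(1)] by (rule dvd_trans)
qed

lemma prime_dvd_q1: "prime l \<Longrightarrow> l dvd n1 * g \<Longrightarrow> l dvd q - 1"
  using prime_dvd_g g_dvd unfolding g_def by (meson dvd_trans)

text \<open>Every prime divisor of \<open>n1 * g\<close> already divides g, and z is 1 modulo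
  it.\<close>

lemma coprime_n1_g:
  fixes z :: int
  assumes "[z = 1] (mod int g)"
  shows "coprime z (int (n1 * g))"
proof (rule ccontr)
  assume "\<not> coprime z (int (n1 * g))"
  then have "\<not> coprime (int (nat \<bar>z\<bar>)) (int (n1 * g))" by simp
  then have "\<not> coprime (nat \<bar>z\<bar>) (n1 * g)" unfolding coprime_int_iff .
  then have "gcd (nat \<bar>z\<bar>) (n1 * g) \<noteq> 1" unfolding coprime_iff_gcd_eq_1 .
  then obtain l where l: "prime l" "l dvd gcd (nat \<bar>z\<bar>) (n1 * g)" using prime_factor_nat by blast
  then have "l dvd nat \<bar>z\<bar>" "l dvd n1 * g" using dvd_trans gcd_dvd1 gcd_dvd2 by blast+
  then have "l dvd g" "int l dvd int (nat \<bar>z\<bar>)" using prime_dvd_g[OF l(1)] by (simp_all only: int_dvd_int_iff)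
  then have "int l dvd z" by simp
  have "[z = 1] (mod int l)" using cong_dvd_modulus[OF assms] \<open>l dvd g\<close> by simp
  then have "int l dvd 1" using \<open>int l dvd z\<close> cong_dvd_iff by blast
  then show False using l(1) by simp
qed

lemma es_le: "k \<in> {1..u} \<Longrightarrow> es k \<le> multiplicity (gs k) (q - 1)"
proof -
  assume k: "k \<in> {1..u}"
  have "gs k ^ es k dvd q - 1" using gs_dvd_g[OF k] g_dvd unfolding g_def by (rule dvd_trans)
  then show ?thesis using q gs[OF k] by (intro multiplicity_geI) auto
qed

abbreviation exc :: bool where "exc \<equiv> u \<ge> 1 \<and> gs 1 = 2 \<and> q mod 4 = 3"

lemma two_le: "k \<in> {1..u} \<Longrightarrow> gs k = 2 \<Longrightarrow> k = 1"
proof (rule ccontr)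
  assume k: "k \<in> {1..u}" "gs k = 2" "k \<noteq> 1"
  then have "gs 1 < gs k" by (intro strict_mono_onD[OF mono]) auto
  moreover have "prime (gs 1)" using k gs[of 1] by auto
  ultimately show False using k(2) prime_ge_2_nat[of "gs 1"] by simp
qed

lemma exc_es:
  assumes exc
  shows "es 1 = 1"
proof -
  have "gs 1 ^ es 1 dvd q - 1" using gs_dvd_g[of 1] assms g_dvd unfolding g_def by (auto intro: dvd_trans)
  moreover have "\<not> 4 dvd q - 1" using assms by presburger
  moreover have "4 dvd (2::nat) ^ es 1" if "es 1 \<ge> 2"
    using le_imp_power_dvd[OF that, of "2::nat"] by simp
  ultimately have "\<not> es 1 \<ge> 2" using assms by (metis dvd_trans)
  moreover have "es 1 > 0" using gs[of 1] assms by simp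
  ultimately show ?thesis by simp
qed

lemma y_le: "k \<in> {1..u} \<Longrightarrow> y k \<le> fs k"
  by (auto simp: y_def y_exp_def)

lemma x_set_eq: "x_set q u gs es fs = PiE {1..u} (\<lambda>k. {0..gs k ^ y k - 1})"
  by (simp add: x_set_def y_def)

text \<open>The exceptional q with \<open>fs 1 = 0\<close> belongs here too: then
  \<open>y 1 = 0\<close> forces \<open>x 1 = 0\<close>, and the first summand of
  \<open>gamma_x\<close> is 0. The exponents y are made so that \<open>es k + y k\<close> is the
  exponent of \<open>gs k\<close> in \<open>gcd (n1 * g) (q - 1)\<close>.\<close>

lemma representatives_normal:
  assumes "\<not> (exc \<and> fs 1 \<ge> 1)"
  shows "x \<in> x_set q u gs es fs \<Longrightarrow> gamma_x q g u gs fs x = 1 + int g * radix_sum u gs fs x"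
    and "[a = 1] (mod int g) \<Longrightarrow> same_coset q (n1 * g) a b \<longleftrightarrow> [a = b] (mod int (g * D))"
proof -
  assume x: "x \<in> x_set q u gs es fs"
  have h: "(if k = 1 \<and> gs 1 = 2 \<and> q mod 4 = 3 then int (gs 1) else 1) * c * int (x k) = c * int (x k)"
    if "k \<in> {1..u}" for k c
  proof (cases "k = 1 \<and> gs 1 = 2 \<and> q mod 4 = 3")
    case True
    then have "fs 1 = 0" using assms that by auto
    then have "y 1 = 0" using True by (simp add: y_def y_exp_def)
    then have "x 1 = 0" using x True that unfolding x_set_eq by (auto dest!: PiE_mem[of _ _ _ 1])
    then show ?thesis using True by simp
  qed auto
  have "(\<Sum>k=1..u. (if k = 1 \<and> gs 1 = 2 \<and> q mod 4 = 3 then int (gs 1) else 1) *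
      (\<Prod>i=1..<k. int (gs i) ^ fs i) * int (x k)) = radix_sum u gs fs x"
    unfolding radix_sum_def by (intro sum.cong refl h)
  then show "gamma_x q g u gs fs x = 1 + int g * radix_sum u gs fs x"
    unfolding gamma_x_def by (simp only:)
next
  assume a: "[a = 1] (mod int g)"
  have "gcd (n1 * g) (q - 1) = (\<Prod>k=1..u. gs k ^ min (fs k + es k) (multiplicity (gs k) (q - 1)))"
    unfolding n1_g using gs inj_gs q by (intro gcd_prod_prime_powers) auto
  also have "\<dots> = (\<Prod>k=1..u. gs k ^ (es k + y k))"
  proof (intro prod.cong refl arg_cong2[of _ _ _ _ "(^)"])
    fix k assume k: "k \<in> {1..u}"
    show "min (fs k + es k) (multiplicity (gs k) (q - 1)) = es k + y k"
    proof (cases "k = 1 \<and> gs 1 = 2 \<and> q mod 4 = 3")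
      case True
      then have "fs 1 = 0" using assms k by auto
      then show ?thesis using True es_le[OF k] by (simp add: y_def y_exp_def)
    next
      case False
      then show ?thesis using es_le[OF k] by (auto simp: y_def y_exp_def min_def)
    qed
  qed
  also have "\<dots> = g * D" by (simp add: g_def D_def prod.distrib power_add)
  finally have gcd: "gcd (n1 * g) (q - 1) = g * D" .
  have four: "4 dvd q - 1" if "8 dvd n1 * g"
  proof -
    have "2 dvd n1 * g" using that by (rule dvd_trans[rotated]) simp
    then obtain k where k: "k \<in> {1..u}" "2 = gs k" using prime_dvd_n1_g[of 2] by auto
    then have k1: "k = 1" using two_le by metis
    have "2 dvd q - 1" using prime_dvd_q1[of 2] \<open>2 dvd n1 * g\<close> by simp
    show ?thesis
    proof (cases "q mod 4 = 3")
      \<comment> \<open>For q congruent to 3 modulo 4 the prime 2 occurs in \<open>n1 * g\<close> to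
        the first power only, in contradiction to divisibility by 8.\<close>
      case True
      then have e: exc and f: "fs 1 = 0" using k k1 assms by auto
      have "{1..u} = insert 1 {2..u}" using e by auto
      then have "n1 * g = gs 1 ^ (fs 1 + es 1) * (\<Prod>k=2..u. gs k ^ (fs k + es k))"
        unfolding n1_g by simp
      then have *: "n1 * g = 2 * (\<Prod>k=2..u. gs k ^ (fs k + es k))" using e f exc_es by simp
      have "2 dvd (\<Prod>k=2..u. gs k ^ (fs k + es k))" using that unfolding * by presburger
      then obtain i where i: "i \<in> {2..u}" "2 dvd gs i ^ (fs i + es i)" by (auto simp: prime_dvd_prod_iff)
      then have "2 dvd gs i" using two_is_prime_nat prime_dvd_power by blast
      then have "2 = gs i" using gs[of i] i(1) by (intro primes_dvd_imp_eq) auto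
      then show ?thesis using two_le[of i] i(1) by auto
    next
      case False
      then show ?thesis using \<open>2 dvd q - 1\<close> q by presburger
    qed
  qed
  show "same_coset q (n1 * g) a b \<longleftrightarrow> [a = b] (mod int (g * D))"
    using same_coset_iff_cong_gcd[of "n1 * g" q a b] g_pos n1_pos q prime_dvd_q1 four coprime_n1_g[OF a]
    unfolding gcd by auto
qed

text \<open>Passing to \<open>q ^ 2\<close> adds the factor q + 1, which enlarges the gcd with
  \<open>n1 * g\<close> only at 2: an odd \<open>gs k\<close> divides q - 1 and so cannot divide q +
  1. The factor 2 in \<open>gamma_x\<close> keeps all representatives 1 modulo 4, because 4 divides
  \<open>2 * g\<close>.\<close>

lemma representatives_exceptional:
  assumes exc "fs 1 \<ge> 1"
  shows "gamma_x q g u gs fs x = 1 + int (2 * g) * radix_sum u gs (fs(1 := fs 1 - 1)) x"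
    and "[a = 1] (mod int g) \<Longrightarrow> same_coset (q ^ 2) (n1 * g) a b \<longleftrightarrow> [a = b] (mod int (2 * g * D))"
    and "4 dvd 2 * g"
proof -
  \<comment> \<open>One factor 2 is taken out of every weight: for \<open>k = 1\<close> it is the
    explicit factor, for \<open>k > 1\<close> it comes from \<open>2 ^ fs 1\<close>. Hence the first
    exponent drops by one.\<close>
  let ?F = "fs(1 := fs 1 - 1)"
  have c: "(if k = 1 \<and> gs 1 = 2 \<and> q mod 4 = 3 then int (gs 1) else 1) * (\<Prod>i=1..<k. int (gs i) ^ fs i) =
    2 * (\<Prod>i=1..<k. int (gs i) ^ ?F i)" if "k \<in> {1..u}" for k
  proof (cases "k = 1")
    case True
    then show ?thesis using assms by simp
  next
    case False
    then have "{1..<k} = insert 1 {2..<k}" using that by auto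
    moreover have "(2::int) ^ fs 1 = 2 * 2 ^ (fs 1 - 1)" using assms(2) by (metis power_Suc Suc_diff_1 One_nat_def Suc_le_lessD)
    moreover have "(\<Prod>i=2..<k. int (gs i) ^ ?F i) = (\<Prod>i=2..<k. int (gs i) ^ fs i)" by (intro prod.cong) auto
    ultimately show ?thesis using False assms by simp
  qed
  show "gamma_x q g u gs fs x = 1 + int (2 * g) * radix_sum u gs ?F x"
  proof -
    have "(\<Sum>k=1..u. (if k = 1 \<and> gs 1 = 2 \<and> q mod 4 = 3 then int (gs 1) else 1) *
        (\<Prod>i=1..<k. int (gs i) ^ fs i) * int (x k)) = 2 * radix_sum u gs ?F x"
      unfolding radix_sum_def sum_distrib_left mult.assoc[symmetric]
      by (intro sum.cong refl) (simp only: c)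
    then show ?thesis unfolding gamma_x_def by (simp only:)
  qed
  have "2 dvd g" using gs_dvd_g[of 1] exc_es assms by simp
  then have "2 * 2 dvd 2 * g" by (rule mult_dvd_mono[OF dvd_refl])
  then show "4 dvd 2 * g" by simp
  have q2: "q ^ 2 > 1" using one_less_power[OF q] by simp
  have e: "q ^ 2 - 1 = (q - 1) * (q + 1)" using q by (simp add: power2_eq_square algebra_simps)
  have q1: "q - 1 \<noteq> 0" using q by linarith
  have mult: "multiplicity l (q ^ 2 - 1) = multiplicity l (q - 1) + multiplicity l (q + 1)" if "prime l" for l
    using that q1 unfolding e by (subst prime_elem_multiplicity_mult_distrib) auto
  assume a: "[a = 1] (mod int g)"
  have "gcd (n1 * g) (q ^ 2 - 1) = (\<Prod>k=1..u. gs k ^ min (fs k + es k) (multiplicity (gs k) (q ^ 2 - 1)))"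
    unfolding n1_g using gs inj_gs q2 by (intro gcd_prod_prime_powers) auto
  also have "\<dots> = (\<Prod>k=1..u. gs k ^ (es k + y k) * (if k = 1 then 2 else 1))"
  proof (intro prod.cong refl)
    fix k assume k: "k \<in> {1..u}"
    show "gs k ^ min (fs k + es k) (multiplicity (gs k) (q ^ 2 - 1)) = gs k ^ (es k + y k) * (if k = 1 then 2 else 1)"
    proof (cases "k = 1")
      case True
      have "multiplicity 2 (q - 1) = 1"
      proof (rule multiplicity_eqI)
        have "2 dvd q - 1" "\<not> 4 dvd q - 1" using assms(1) by presburger+
        then show "2 ^ 1 dvd q - 1" "\<not> 2 ^ Suc 1 dvd q - 1" by simp_all
      qed
      moreover have "1 \<le> multiplicity 2 (q + 1)"
      proof (rule multiplicity_geI)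
        have "2 dvd q + 1" using assms(1) by presburger
        then show "2 ^ 1 dvd q + 1" by simp
      qed auto
      \<comment> \<open>With \<open>es 1 = 1\<close> and v the valuation of q + 1 at 2, both sides
        are \<open>2 + min (fs 1 - 1) (v - 1)\<close>.\<close>
      ultimately have "min (fs k + es k) (multiplicity (gs k) (q ^ 2 - 1)) = Suc (es k + y k)"
        using True assms exc_es mult[of 2] by (auto simp: y_def y_exp_def min_def)
      then show ?thesis using True assms by simp
    next
      case False
      then have "gs k \<noteq> 2" using two_le k by blast
      then have g2: "gs k > 2" using gs[OF k] prime_ge_2_nat[of "gs k"] by simp
      have "gs k dvd q - 1" using prime_dvd_q1[of "gs k"] gs[OF k] gs_dvd_g[OF k]
        by (meson dvd_mult dvd_power dvd_trans)
      have "\<not> gs k dvd q + 1"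
      proof
        assume "gs k dvd q + 1"
        then have "gs k dvd (q + 1) - (q - 1)" using \<open>gs k dvd q - 1\<close> by (rule dvd_diff_nat)
        then have "gs k dvd 2" using q by simp
        then show False using g2 by (auto dest: dvd_imp_le)
      qed
      then have "multiplicity (gs k) (q ^ 2 - 1) = multiplicity (gs k) (q - 1)"
        using mult gs[OF k] by (simp add: not_dvd_imp_multiplicity_0)
      then show ?thesis using False es_le[OF k] by (auto simp: y_def y_exp_def min_def add.commute)
    qed
  qed
  also have "\<dots> = 2 * g * D"
    using assms(1) by (simp add: g_def D_def prod.distrib power_add prod.delta)
  finally have gcd: "gcd (n1 * g) (q ^ 2 - 1) = 2 * g * D" .
  have "l dvd q ^ 2 - 1" if "prime l" "l dvd n1 * g" for l
    using prime_dvd_q1[OF that] unfolding e by simp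
  moreover have "4 dvd q ^ 2 - 1"
  proof -
    have "2 dvd q - 1" "2 dvd q + 1" using assms(1) by presburger+
    then have "2 * 2 dvd (q - 1) * (q + 1)" by (rule mult_dvd_mono)
    then show ?thesis unfolding e by simp
  qed
  ultimately show "same_coset (q ^ 2) (n1 * g) a b \<longleftrightarrow> [a = b] (mod int (2 * g * D))"
    using same_coset_iff_cong_gcd[of "n1 * g" "q ^ 2" a b] g_pos n1_pos q2 coprime_n1_g[OF a]
    unfolding gcd by auto
qed

text \<open>q is -1 modulo 4, so an exponent connecting two classes that are 1 modulo 4 is
  even.\<close>

lemma same_coset_square:
  assumes "q mod 4 = 3" "4 dvd n1 * g" "[a = 1] (mod 4)" "[b = 1] (mod 4)"
  shows "same_coset q (n1 * g) a b \<longleftrightarrow> same_coset (q ^ 2) (n1 * g) a b"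
proof
  assume "same_coset q (n1 * g) a b"
  then obtain i where i: "[a * int q ^ i = b] (mod int (n1 * g))" by (auto simp: same_coset_def)
  have "even i"
  proof (rule ccontr)
    assume "odd i"
    have "[int q = - 1] (mod 4)" using assms(1) by (simp add: cong_def) presburger
    then have "[a * int q ^ i = 1 * (- 1) ^ i] (mod 4)" using assms(3) by (intro cong_mult cong_pow)
    then have "[a * int q ^ i = - 1] (mod 4)" using \<open>odd i\<close> by simp
    moreover have "int 4 dvd int (n1 * g)" using assms(2) by (simp only: int_dvd_int_iff)
    then have "[a * int q ^ i = b] (mod 4)" using cong_dvd_modulus[OF i] by simp
    ultimately show False using assms(4) by (simp add: cong_def)
  qed
  then obtain k where "i = 2 * k" by (auto elim: evenE)
  with i have "[a * int (q ^ 2) ^ k = b] (mod int (n1 * g))" by (simp add: power_mult)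
  then show "same_coset (q ^ 2) (n1 * g) a b" by (rule same_cosetI)
next
  assume "same_coset (q ^ 2) (n1 * g) a b"
  then obtain k where "[a * int q ^ (2 * k) = b] (mod int (n1 * g))" by (auto simp: same_coset_def power_mult)
  then show "same_coset q (n1 * g) a b" by (rule same_cosetI)
qed

lemma gamma_x_cong: "[gamma_x q g u gs fs x = 1] (mod int g)"
  by (simp add: gamma_x_def cong_iff_dvd_diff)

lemma four_dvd_n1_g: "exc \<Longrightarrow> fs 1 \<ge> 1 \<Longrightarrow> 4 dvd n1 * g"
proof -
  assume *: exc "fs 1 \<ge> 1"
  have "gs 1 ^ fs 1 dvd n1" unfolding n1_def using * by (intro dvd_prodI) auto
  moreover have "2 dvd gs 1 ^ fs 1" using * by simp
  ultimately have "2 dvd n1" by (rule dvd_trans[rotated])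
  moreover have "2 dvd g" using gs_dvd_g[of 1] exc_es * by simp
  ultimately have "2 * 2 dvd n1 * g" by (rule mult_dvd_mono)
  then show ?thesis by simp
qed

lemma gamma_x_unique:
  assumes "x \<in> x_set q u gs es fs" "x' \<in> x_set q u gs es fs"
    "same_coset q (n1 * g) (gamma_x q g u gs fs x) (gamma_x q g u gs fs x')"
  shows "x = x'"
proof (cases "exc \<and> fs 1 \<ge> 1")
  case False
  have "[1 + int g * radix_sum u gs fs x = 1 + int g * radix_sum u gs fs x'] (mod int g * int D)"
    using representatives_normal[OF False] assms gamma_x_cong[of x] by simp
  then have "[radix_sum u gs fs x = radix_sum u gs fs x'] (mod int D)"
    using g_pos by (simp add: cong_add_lcancel) (simp add: cong_def mod_mult_mult1)
  then show ?thesis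
    using radix_sum_unique[OF _ inj_gs, of y fs x x'] gs y_le assms(1,2) unfolding x_set_eq D_def by simp
next
  case True
  let ?F = "fs(1 := fs 1 - 1)" and ?\<gamma> = "gamma_x q g u gs fs"
  note rep = representatives_exceptional[OF conjunct1[OF True] conjunct2[OF True]]
  have "[?\<gamma> x = 1] (mod 4)" for x
  proof -
    have "int 4 dvd int (2 * g)" using rep(3) by (simp only: int_dvd_int_iff)
    then show ?thesis unfolding rep(1) cong_iff_dvd_diff by (simp add: dvd_mult2)
  qed
  then have "same_coset (q ^ 2) (n1 * g) (?\<gamma> x) (?\<gamma> x')"
    using assms(3) same_coset_square four_dvd_n1_g True by blast
  then have "[1 + int (2 * g) * radix_sum u gs ?F x = 1 + int (2 * g) * radix_sum u gs ?F x'] (mod int (2 * g) * int D)"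
    using rep(2)[OF gamma_x_cong[of x]] unfolding rep(1) by simp
  then have "[int (2 * g) * radix_sum u gs ?F x = int (2 * g) * radix_sum u gs ?F x'] (mod int (2 * g) * int D)"
    by (simp only: cong_add_lcancel)
  then have "[radix_sum u gs ?F x = radix_sum u gs ?F x'] (mod int D)"
    using g_pos unfolding cong_def mod_mult_mult1 by simp
  moreover have "y k \<le> ?F k" if "k \<in> {1..u}" for k
    using y_le[OF that] True by (auto simp: y_def y_exp_def)
  ultimately show ?thesis
    using radix_sum_unique[OF _ inj_gs, of y ?F x x'] gs assms(1,2) unfolding x_set_eq D_def by simp
qed

lemma gamma_x_exists:
  assumes z: "[z = 1] (mod int g)"
  shows "\<exists>x\<in>x_set q u gs es fs. same_coset q (n1 * g) (gamma_x q g u gs fs x) z"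
proof (cases "exc \<and> fs 1 \<ge> 1")
  case False
  obtain w where w: "z = 1 + int g * w" using cong_sym[OF z] unfolding cong_iff_lin by blast
  obtain x where x: "x \<in> x_set q u gs es fs" "[radix_sum u gs fs x = w] (mod int D)"
    using radix_sum_exists[OF _ inj_gs, of y fs w] gs y_le unfolding x_set_eq D_def by auto
  have "[int g * radix_sum u gs fs x = int g * w] (mod int g * int D)"
    using x(2) unfolding cong_def mod_mult_mult1 by simp
  then have "[gamma_x q g u gs fs x = z] (mod int (g * D))"
    unfolding w representatives_normal(1)[OF False x(1)] by (simp add: cong_add_lcancel)
  then show ?thesis using representatives_normal(2)[OF False gamma_x_cong] x(1) by blast
next
  case True
  let ?F = "fs(1 := fs 1 - 1)" and ?\<gamma> = "gamma_x q g u gs fs"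
  note rep = representatives_exceptional[OF conjunct1[OF True] conjunct2[OF True]]
  \<comment> \<open>As g is 2 modulo 4, being 1 both modulo g and modulo 4 amounts to being 1 modulo
    \<open>2 * g\<close>.\<close>
  have g2: "int g mod 4 = 2"
  proof -
    have "g dvd q - 1" using g_dvd unfolding g_def .
    moreover have "\<not> 4 dvd q - 1" using True by presburger
    ultimately have "\<not> 4 dvd g" using dvd_trans by blast
    moreover have "2 dvd g" using gs_dvd_g[of 1] exc_es True by simp
    moreover have "r mod 4 = 2" if "\<not> 4 dvd r" "2 dvd r" for r :: nat using that by presburger
    ultimately have "g mod 4 = 2" by blast
    then show ?thesis using zmod_int[of g 4] by simp
  qed
  have "int g dvd int (q - 1)" using g_dvd unfolding g_def[symmetric] by (simp only: int_dvd_int_iff)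
  then have qg: "[int q = 1] (mod int g)" using q by (simp add: cong_iff_dvd_diff of_nat_diff)
  \<comment> \<open>If z is 3 modulo 4, one multiplication by q makes it 1 modulo 4 and keeps it 1
    modulo g, since g divides q - 1. From there powers of \<open>q ^ 2\<close> suffice.\<close>
  obtain z' where z': "same_coset q (n1 * g) z' z" "[z' = 1] (mod int g)" "[z' = 1] (mod 4)"
  proof (cases "[z = 1] (mod 4)")
    case True
    then show ?thesis using that[of z] z by simp
  next
    case False
    obtain w where w: "z = 1 + int g * w" using cong_sym[OF z] unfolding cong_iff_lin by blast
    have "even (int g)" using g2 by presburger
    then have "odd z" unfolding w by simp
    then have "[z = 3] (mod 4)" using False unfolding cong_def by presburger
    moreover have "[int q = 3] (mod 4)" using True by (simp add: cong_def) presburger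
    ultimately have "[z * int q = 3 * 3] (mod 4)" by (intro cong_mult)
    then have 4: "[z * int q = 1] (mod 4)" by (simp add: cong_def)
    have "[z * int q = 1 * 1] (mod int g)" using z qg by (intro cong_mult)
    moreover have "same_coset q (n1 * g) z (z * int q)" by (rule same_cosetI[of _ _ 1]) simp
    moreover have "coprime (n1 * g) q"
    proof (rule ccontr)
      assume "\<not> coprime (n1 * g) q"
      then have "gcd (n1 * g) q \<noteq> 1" unfolding coprime_iff_gcd_eq_1 .
      then obtain l where l: "prime l" "l dvd gcd (n1 * g) q" using prime_factor_nat by blast
      then have "l dvd q" "l dvd q - 1" using prime_dvd_q1[of l] by auto
      then have "l dvd q - (q - 1)" by (rule dvd_diff_nat)
      then have "l dvd 1" using q by simp
      then show False using l(1) by auto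
    qed
    ultimately show ?thesis using that[of "z * int q"] 4 same_coset_sym by simp
  qed
  have "[z' = 1] (mod int (2 * g))"
  proof -
    obtain w where w: "z' - 1 = int g * w" using z'(2) unfolding cong_iff_dvd_diff dvd_def by blast
    have "4 dvd int g * w" using z'(3) unfolding cong_iff_dvd_diff w .
    then have "even w" using g2
    proof -
      obtain c where c: "int g = 4 * c + 2" using g2 by (metis mod_eqE mult.commute add.commute mult_div_mod_eq)
      have "int g * w = 4 * (c * w) + 2 * w" unfolding c by (simp add: algebra_simps)
      then show ?thesis using \<open>4 dvd int g * w\<close> by presburger
    qed
    then show ?thesis unfolding cong_iff_dvd_diff w by (auto elim!: evenE)
  qed
  from cong_sym[OF this] obtain w where w: "z' = 1 + int (2 * g) * w" unfolding cong_iff_lin by blast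
  have "y k \<le> ?F k" if "k \<in> {1..u}" for k
    using y_le[OF that] True by (auto simp: y_def y_exp_def)
  then obtain x where x: "x \<in> x_set q u gs es fs" "[radix_sum u gs ?F x = w] (mod int D)"
    using radix_sum_exists[OF _ inj_gs, of y ?F w] gs unfolding x_set_eq D_def by auto
  have "[int (2 * g) * radix_sum u gs ?F x = int (2 * g) * w] (mod int (2 * g) * int D)"
    using x(2) unfolding cong_def mod_mult_mult1 by simp
  then have "[?\<gamma> x = z'] (mod int (2 * g * D))"
    unfolding w rep(1) by (simp only: cong_add_lcancel of_nat_mult)
  then have "same_coset (q ^ 2) (n1 * g) (?\<gamma> x) z'" using rep(2)[OF gamma_x_cong] by blast
  then obtain k where "[?\<gamma> x * int q ^ (2 * k) = z'] (mod int (n1 * g))" by (auto simp: same_coset_def power_mult)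
  then have "same_coset q (n1 * g) (?\<gamma> x) z'" by (rule same_cosetI)
  then show ?thesis using z'(1) same_coset_trans x(1) by blast
qed

end

section \<open>Polynomials with conjugate roots of unity as roots\<close>


lemma has_mult_order_nonzero: "has_mult_order (z :: 'b :: field) M \<Longrightarrow> z \<noteq> 0"
  by (auto simp: has_mult_order_def power_0_left)

lemma has_mult_order_powi_eq_1_iff:
  fixes z :: "'b :: field"
  assumes "has_mult_order z M"
  shows "z powi a = 1 \<longleftrightarrow> int M dvd a"
proof -
  have M: "M > 0" "z ^ M = 1" "\<And>k. 0 < k \<Longrightarrow> k < M \<Longrightarrow> z ^ k \<noteq> 1"
    using assms by (auto simp: has_mult_order_def)
  have nn: "a mod int M \<ge> 0" "a mod int M < int M" using M(1) by simp_all
  have "z powi a = z powi (int M * (a div int M) + a mod int M)" by simp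
  also have "\<dots> = z powi (int M * (a div int M)) * z powi (a mod int M)"
    using has_mult_order_nonzero[OF assms] by (intro power_int_add) simp
  also have "z powi (int M * (a div int M)) = 1"
    using M(2) by (simp add: power_int_mult)
  also have "z powi (a mod int M) = z ^ nat (a mod int M)" using nn by (simp add: power_int_nonneg_exp)
  finally have e: "z powi a = z ^ nat (a mod int M)" by simp
  show ?thesis
  proof (cases "a mod int M = 0")
    case True
    then show ?thesis unfolding e by auto
  next
    case False
    then have "0 < nat (a mod int M)" "nat (a mod int M) < M" using nn by auto
    then have "z powi a \<noteq> 1" unfolding e using M(3) by blast
    then show ?thesis using False by (auto simp: dvd_eq_mod_eq_0)
  qed
qed

lemma has_mult_order_powi_eq_iff:
  fixes z :: "'b :: field"
  assumes "has_mult_order z M"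
  shows "z powi a = z powi b \<longleftrightarrow> [a = b] (mod int M)"
proof -
  have z: "z \<noteq> 0" using has_mult_order_nonzero[OF assms] .
  then have "z powi a = z powi b \<longleftrightarrow> z powi (a - b) = 1" by (simp add: power_int_diff)
  also have "\<dots> \<longleftrightarrow> [a = b] (mod int M)"
    unfolding has_mult_order_powi_eq_1_iff[OF assms] cong_iff_dvd_diff ..
  finally show ?thesis .
qed

lemma degree_prod_linear: "finite A \<Longrightarrow> degree (\<Prod>a\<in>A. [:- a, 1 :: 'b :: field:]) = card A"
  by (subst degree_prod_eq_sum_degree) auto

lemma lead_coeff_prod_linear: "lead_coeff (\<Prod>a\<in>A. [:- a, 1 :: 'b :: field:]) = 1"
  by (simp add: lead_coeff_prod)

lemma poly_prod_linear_eq_0_iff: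
  "finite A \<Longrightarrow> poly (\<Prod>a\<in>A. [:- a, 1 :: 'b :: field:]) x = 0 \<longleftrightarrow> x \<in> A"
  by (auto simp: poly_prod)

text \<open>Otherwise the difference would be a nonzero polynomial of degree below
  \<open>card A\<close>, as the leading terms cancel, with all of A among its roots.\<close>

lemma monic_eq_prod_linear:
  fixes P :: "'b :: field poly"
  assumes A: "finite A" and P: "degree P = card A" "lead_coeff P = 1" and root: "\<And>a. a \<in> A \<Longrightarrow> poly P a = 0"
  shows "P = (\<Prod>a\<in>A. [:- a, 1:])"
proof (rule ccontr)
  let ?L = "\<Prod>a\<in>A. [:- a, 1:]"
  assume "P \<noteq> ?L"
  then have D: "P - ?L \<noteq> 0" by simp
  have "degree (P - ?L) \<le> card A" using P(1) degree_prod_linear[OF A] by (intro degree_diff_le) auto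
  moreover have "coeff (P - ?L) (card A) = 0"
    using P lead_coeff_prod_linear[of A] degree_prod_linear[OF A] by simp
  ultimately have lt: "degree (P - ?L) < card A" using D eq_zero_or_degree_less by blast
  have "A \<subseteq> {x. poly (P - ?L) x = 0}" using root poly_prod_linear_eq_0_iff[OF A] by auto
  then have "card A \<le> card {x. poly (P - ?L) x = 0}" using poly_roots_finite[OF D] by (intro card_mono)
  also have "\<dots> \<le> degree (P - ?L)" using D by (rule card_poly_roots_bound)
  finally show False using lt by simp
qed

section \<open>Polynomials under field homomorphisms, for the Frobenius map and for
  \<open>to_ac\<close>\<close>

context
  fixes f :: "'b :: field \<Rightarrow> 'c :: field"
  assumes f0: "f 0 = 0" and f1: "f 1 = 1" and fadd: "\<And>a b. f (a + b) = f a + f b"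
    and fmult: "\<And>a b. f (a * b) = f a * f b"
begin

lemma hom_sum: "f (sum g A) = (\<Sum>x\<in>A. f (g x))"
  by (induction A rule: infinite_finite_induct) (auto simp: f0 fadd)

lemma map_poly_hom_mult: "map_poly f (P * Q) = map_poly f P * map_poly f Q"
  by (rule poly_eqI) (simp add: coeff_map_poly f0 coeff_mult hom_sum fmult)

lemma map_poly_hom_diff: "map_poly f (P - Q) = map_poly f P - map_poly f Q"
proof -
  have "f (a - b) = f a - f b" for a b using fadd[of "a - b" b] by simp
  then show ?thesis by (intro poly_eqI) (simp add: coeff_map_poly f0)
qed

lemma map_poly_hom_prod: "map_poly f (prod g A) = (\<Prod>x\<in>A. map_poly f (g x))"
  by (induction A rule: infinite_finite_induct) (auto simp: map_poly_hom_mult map_poly_1' f1)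

lemma poly_map_poly_hom: "poly (map_poly f P) (f x) = f (poly P x)"
  by (induction P) (auto simp: map_poly_pCons f0 fadd fmult)

end

text \<open>S is the set of factors that contribute their constant term. Grouping the expanded
  product by \<open>k = w - card S\<close> collects the signed elementary symmetric
  polynomials.\<close>

lemma elem_sym_expansion:
  fixes z :: "nat \<Rightarrow> 'b :: field"
  shows "(\<Prod>i<w. monom 1 t - [:z i:]) =
    (\<Sum>k\<le>w. monom ((- 1) ^ (w - k) * elem_sym (w - k) w z) (t * k))"
proof -
  let ?h = "\<lambda>S. (\<Prod>i\<in>S. - [:z i:]) * (\<Prod>i\<in>{..<w} - S. monom 1 t)"
  have "(\<Prod>i<w. monom 1 t - [:z i:]) = (\<Prod>i<w. - [:z i:] + monom 1 t)"
    by (intro prod.cong) auto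
  also have "\<dots> = (\<Sum>S\<in>Pow {..<w}. ?h S)" by (rule prod_add) simp
  also have "\<dots> = (\<Sum>k\<le>w. \<Sum>S\<in>{S \<in> Pow {..<w}. w - card S = k}. ?h S)"
    by (rule sum.group[symmetric]) auto
  also have "\<dots> = (\<Sum>k\<le>w. monom ((- 1) ^ (w - k) * elem_sym (w - k) w z) (t * k))"
  proof (intro sum.cong refl)
    fix k assume k: "k \<in> {..w}"
    have cw: "card S \<le> w" if "S \<subseteq> {..<w}" for S using card_mono[OF _ that] by simp
    have set: "{S \<in> Pow {..<w}. w - card S = k} = {S. S \<subseteq> {..<w} \<and> card S = w - k}"
      using k cw by force
    have h: "?h S = monom ((- 1) ^ (w - k) * (\<Prod>i\<in>S. z i)) (t * k)" if "S \<subseteq> {..<w}" "card S = w - k" for S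
    proof -
      have fin: "finite S" using that(1) finite_subset by blast
      have "(\<Prod>i\<in>S. - [:z i:]) = [:(- 1) ^ (w - k) * (\<Prod>i\<in>S. z i):]"
        unfolding that(2)[symmetric] using fin by (induction S rule: finite_induct) auto
      moreover have "card ({..<w} - S) = k" using that k fin by (simp add: card_Diff_subset)
      then have "(\<Prod>i\<in>{..<w} - S. monom (1 :: 'b) t) = monom 1 (t * k)" by (simp add: monom_power)
      ultimately show ?thesis by (simp add: smult_monom)
    qed
    have "(\<Sum>S\<in>{S \<in> Pow {..<w}. w - card S = k}. ?h S) =
      (\<Sum>S | S \<subseteq> {..<w} \<and> card S = w - k. monom ((- 1) ^ (w - k) * (\<Prod>i\<in>S. z i)) (t * k))"
      unfolding set using h by (intro sum.cong) auto
    also have "\<dots> = monom ((- 1) ^ (w - k) * elem_sym (w - k) w z) (t * k)"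
      unfolding elem_sym_def sum_distrib_left by (rule monom_sum[symmetric])
    finally show "(\<Sum>S\<in>{S \<in> Pow {..<w}. w - card S = k}. ?h S) =
      monom ((- 1) ^ (w - k) * elem_sym (w - k) w z) (t * k)" .
  qed
  finally show ?thesis .
qed

section \<open>Frobenius, descent to the finite field and irreducibility\<close>

locale finite_field_roots =
  fixes p e q :: nat and \<zeta> :: "nat \<Rightarrow> 'a :: finite_field alg_closure"
  assumes p: "prime p" and e: "e > 0" and q_def: "q = p ^ e" and card: "card (UNIV :: 'a set) = q"
    and \<zeta>: "compatible_roots q \<zeta>"
begin

lemma q_gt_1: "q > 1"
  unfolding q_def using one_less_power[OF prime_gt_1_nat[OF p] e] .

lemma CHAR_eq: "CHAR('a) = p"
proof -
  have "CHAR('a) dvd p ^ e" using CHAR_dvd_CARD[where ?'a = 'a] by (simp add: card q_def)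
  moreover have c: "prime CHAR('a)" by (rule prime_CHAR_semidom) (rule CHAR_pos)
  ultimately have "CHAR('a) dvd p" using prime_dvd_power by blast
  then show ?thesis using c p by (metis primes_dvd_imp_eq)
qed

lemma frobenius_add: "(x + y :: 'a alg_closure) ^ q = x ^ q + y ^ q"
  by (rule freshmans_dream'[where n = e]) (simp_all add: CHAR_eq p q_def)

lemma frobenius_0: "(0 :: 'a alg_closure) ^ q = 0"
  using q_gt_1 by (simp add: power_0_left)

lemmas frobenius_hom = frobenius_0 power_one frobenius_add power_mult_distrib

lemma frobenius_inj: "(x :: 'a alg_closure) ^ q = y ^ q \<Longrightarrow> x = y"
proof -
  assume "x ^ q = y ^ q"
  moreover have "x ^ q = (x - y) ^ q + y ^ q" using frobenius_add[of "x - y" y] by simp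
  ultimately have "(x - y) ^ q = 0" by simp
  then show ?thesis by simp
qed

text \<open>The polynomial X^q - X has at most q roots, and the q elements of the embedded field
  already provide them.\<close>

lemma frobenius_fixed_iff: "z ^ q = z \<longleftrightarrow> z \<in> range (to_ac :: 'a \<Rightarrow> _)"
proof
  assume "z \<in> range (to_ac :: 'a \<Rightarrow> _)"
  then obtain x :: 'a where "z = to_ac x" by blast
  then show "z ^ q = z" using finite_field_power_card_eq_same[of x] by (metis card to_ac_power)
next
  let ?P = "monom 1 q - monom 1 1 :: 'a alg_closure poly"
  have deg: "degree ?P = q"
    unfolding diff_conv_add_uminus using q_gt_1 by (subst degree_add_eq_left) (auto simp: degree_monom_eq)
  then have nz: "?P \<noteq> 0" using q_gt_1 by auto
  have root: "poly ?P x = 0 \<longleftrightarrow> x ^ q = x" for x by (simp add: poly_monom)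
  have sub: "range (to_ac :: 'a \<Rightarrow> _) \<subseteq> {x. poly ?P x = 0}"
    unfolding root using finite_field_power_card_eq_same[where ?'a = 'a] card by (auto simp flip: to_ac_power)
  have "card (range (to_ac :: 'a \<Rightarrow> _)) = card (UNIV :: 'a set)" by (rule card_image) (rule inj_to_ac)
  then have "card (range (to_ac :: 'a \<Rightarrow> _)) = q" by (simp only: card)
  then have "card {x. poly ?P x = 0} \<le> card (range (to_ac :: 'a \<Rightarrow> _))"
    using card_poly_roots_bound[OF nz] deg by simp
  then have "range (to_ac :: 'a \<Rightarrow> _) = {x. poly ?P x = 0}"
    using sub poly_roots_finite[OF nz] by (intro card_seteq)
  then show "z ^ q = z \<Longrightarrow> z \<in> range (to_ac :: 'a \<Rightarrow> _)" using root by blast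
qed

definition conjugates :: "nat \<Rightarrow> int \<Rightarrow> 'a alg_closure set" where
  "conjugates M \<delta> = range (\<lambda>i. \<zeta> M powi (\<delta> * int q ^ i))"

lemma order_\<zeta>: "M > 0 \<Longrightarrow> coprime M q \<Longrightarrow> has_mult_order (\<zeta> M) M"
  using \<zeta> by (simp add: compatible_roots_def)

lemma \<zeta>_power: "M > 0 \<Longrightarrow> coprime M q \<Longrightarrow> t dvd M \<Longrightarrow> \<zeta> M ^ t = \<zeta> (M div t)"
proof -
  assume M: "M > 0" "coprime M q" "t dvd M"
  then have "M div t dvd M" "M div (M div t) = t" by (auto simp: div_div_eq_right elim!: dvdE)
  then show ?thesis using \<zeta> M unfolding compatible_roots_def by metis
qed

context
  fixes M :: nat
  assumes M: "M > 0" "coprime M q"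
begin

lemma conjugates_eq_image: "conjugates M \<delta> = (\<lambda>i. \<zeta> M powi i) ` cyc_coset q M \<delta>"
proof (intro equalityI subsetI)
  fix x assume "x \<in> conjugates M \<delta>"
  then obtain i where x: "x = \<zeta> M powi (\<delta> * int q ^ i)" by (auto simp: conjugates_def)
  let ?j = "(\<delta> * int q ^ i) mod int M"
  have "x = \<zeta> M powi ?j" unfolding x has_mult_order_powi_eq_iff[OF order_\<zeta>[OF M]] by (simp add: cong_def)
  moreover have "same_coset q M \<delta> ?j" by (rule same_cosetI[of _ _ i]) (simp add: cong_def)
  then have "?j \<in> cyc_coset q M \<delta>" unfolding cyc_coset_eq[OF M(2,1)] using M(1) by simp
  ultimately show "x \<in> (\<lambda>i. \<zeta> M powi i) ` cyc_coset q M \<delta>" by blast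
next
  fix x assume "x \<in> (\<lambda>i. \<zeta> M powi i) ` cyc_coset q M \<delta>"
  then obtain j i where x: "x = \<zeta> M powi j" "[\<delta> * int q ^ i = j] (mod int M)"
    unfolding cyc_coset_eq[OF M(2,1)] same_coset_def by blast
  then have "x = \<zeta> M powi (\<delta> * int q ^ i)"
    using has_mult_order_powi_eq_iff[OF order_\<zeta>[OF M]] by metis
  then show "x \<in> conjugates M \<delta>" by (auto simp: conjugates_def)
qed

lemma inj_on_powi: "inj_on (\<lambda>i. \<zeta> M powi i) {0..<int M}"
  by (rule inj_onI) (simp add: has_mult_order_powi_eq_iff[OF order_\<zeta>[OF M]] cong_def)

lemma inj_on_powi_coset: "inj_on (\<lambda>i. \<zeta> M powi i) (cyc_coset q M \<delta>)"
  by (rule inj_on_subset[OF inj_on_powi]) (auto simp: cyc_coset_eq[OF M(2,1)])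

lemma finite_conjugates: "finite (conjugates M \<delta>)"
  by (simp add: conjugates_eq_image cyc_coset_def)

lemma card_conjugates: "card (conjugates M \<delta>) = cyc_size q M \<delta>"
  using card_image[OF inj_on_powi_coset] card_cyc_coset[OF M(2)] by (simp add: conjugates_eq_image)

lemma cyc_poly_eq: "cyc_poly q \<zeta> M \<delta> = (\<Prod>a\<in>conjugates M \<delta>. [:- a, 1:])"
  unfolding conjugates_eq_image cyc_poly_def by (subst prod.reindex[OF inj_on_powi_coset]) simp

lemma conjugates_frobenius: "(\<lambda>a. a ^ q) ` conjugates M \<delta> = conjugates M \<delta>"
proof (rule endo_inj_surj)
  show "(\<lambda>a. a ^ q) ` conjugates M \<delta> \<subseteq> conjugates M \<delta>"
  proof
    fix x assume "x \<in> (\<lambda>a. a ^ q) ` conjugates M \<delta>"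
    then obtain i where "x = (\<zeta> M powi (\<delta> * int q ^ i)) ^ q" by (auto simp: conjugates_def)
    then have "x = \<zeta> M powi (\<delta> * int q ^ Suc i)" by (simp add: power_int_power' mult_ac)
    then show "x \<in> conjugates M \<delta>" unfolding conjugates_def by blast
  qed
  show "inj_on (\<lambda>a. a ^ q) (conjugates M \<delta>)" by (intro inj_onI) (rule frobenius_inj)
qed (rule finite_conjugates)

text \<open>Frobenius permutes the roots, so it fixes every coefficient, and its fixed points form
  the embedded finite field.\<close>

lemma cyc_poly_descends:
  obtains F :: "'a poly" where "map_poly to_ac F = cyc_poly q \<zeta> M \<delta>"
proof -
  let ?P = "cyc_poly q \<zeta> M \<delta>"
  have neg: "(- a) ^ q = - (a ^ q)" for a :: "'a alg_closure"
    using frobenius_add[of a "- a"] frobenius_0 by (simp add: eq_neg_iff_add_eq_0 add.commute)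
  have "map_poly (\<lambda>a. a ^ q) ?P = (\<Prod>a\<in>conjugates M \<delta>. map_poly (\<lambda>a. a ^ q) [:- a, 1:])"
    unfolding cyc_poly_eq by (rule map_poly_hom_prod) (fact frobenius_hom)+
  also have "\<dots> = (\<Prod>a\<in>conjugates M \<delta>. [:- (a ^ q), 1:])"
    by (intro prod.cong refl) (simp add: map_poly_pCons frobenius_0 neg)
  also have "\<dots> = (\<Prod>a\<in>(\<lambda>a. a ^ q) ` conjugates M \<delta>. [:- a, 1:])"
    by (subst prod.reindex) (auto intro!: inj_onI frobenius_inj)
  also have "\<dots> = ?P" unfolding conjugates_frobenius cyc_poly_eq ..
  finally have "coeff ?P i ^ q = coeff ?P i" for i
    by (metis coeff_map_poly frobenius_0)
  then have "coeff ?P i \<in> range (to_ac :: 'a \<Rightarrow> _)" for i using frobenius_fixed_iff by blast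
  then have "to_ac (of_ac (coeff ?P i) :: 'a) = coeff ?P i" for i by (rule to_ac_of_ac)
  then have "map_poly to_ac (map_poly of_ac ?P :: 'a poly) = ?P"
    by (intro poly_eqI) (simp add: coeff_map_poly)
  then show ?thesis using that by blast
qed

text \<open>A factor of positive degree has a root in the algebraic closure, which is one of the
  conjugates. Its coefficients are fixed by Frobenius, so all conjugates are roots and its degree is
  at least that of F.\<close>

lemma irreducible_if_map_eq_cyc_poly:
  fixes F :: "'a poly"
  assumes F: "map_poly to_ac F = cyc_poly q \<zeta> M \<delta>"
  shows "irreducible F"
proof -
  have deg: "degree (map_poly (to_ac :: 'a \<Rightarrow> _) G) = degree G" for G by (rule degree_map_poly) simp
  have degF: "degree F = cyc_size q M \<delta>"
    using deg[of F] unfolding F cyc_poly_eq degree_prod_linear[OF finite_conjugates] card_conjugates by simp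
  then have degF0: "degree F > 0" using cyc_size_props(1)[OF M(2)] by simp
  then have F0: "F \<noteq> 0" by auto
  have key: "degree H = 0" if GH: "F = G * H" and G: "degree G > 0" for G H
  proof -
    have nz: "G \<noteq> 0" "H \<noteq> 0" using GH F0 by auto
    let ?G = "map_poly (to_ac :: 'a \<Rightarrow> _) G" and ?H = "map_poly (to_ac :: 'a \<Rightarrow> _) H"
    have "map_poly to_ac F = ?G * ?H" unfolding GH by (rule map_poly_hom_mult) simp_all
    then have prod: "cyc_poly q \<zeta> M \<delta> = ?G * ?H" using F by simp
    have frob: "poly ?G (x ^ q) = (poly ?G x) ^ q" for x
    proof -
      have "map_poly (\<lambda>a. a ^ q) ?G = ?G"
      proof (rule poly_eqI)
        fix i show "coeff (map_poly (\<lambda>a. a ^ q) ?G) i = coeff ?G i"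
          using frobenius_fixed_iff by (simp add: coeff_map_poly frobenius_0)
      qed
      then show ?thesis using poly_map_poly_hom[of "\<lambda>a. a ^ q", OF frobenius_hom, of ?G x] by simp
    qed
    obtain x where x: "poly ?G x = 0" using alg_closed_imp_poly_has_root[of ?G] G deg by auto
    then have "poly (cyc_poly q \<zeta> M \<delta>) x = 0" by (simp add: prod)
    then have "x \<in> conjugates M \<delta>" unfolding cyc_poly_eq poly_prod_linear_eq_0_iff[OF finite_conjugates] .
    then obtain i where i: "x = \<zeta> M powi (\<delta> * int q ^ i)" by (auto simp: conjugates_def)
    have xk: "x ^ (q ^ k) = \<zeta> M powi (\<delta> * int q ^ (i + k))" for k
      by (simp add: i power_int_power' power_add mult.assoc)
    have Gk: "poly ?G (x ^ (q ^ k)) = 0" for k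
    proof (induction k)
      case (Suc k)
      have "x ^ (q ^ Suc k) = (x ^ (q ^ k)) ^ q" by (simp add: mult.commute flip: power_mult)
      then show ?case using frob[of "x ^ (q ^ k)"] Suc frobenius_0 by simp
    qed (use x in simp)
    have "conjugates M \<delta> \<subseteq> {y. poly ?G y = 0}"
    proof
      fix y assume "y \<in> conjugates M \<delta>"
      then obtain k where k: "y = \<zeta> M powi (\<delta> * int q ^ k)" by (auto simp: conjugates_def)
      \<comment> \<open>The exponent k may be smaller than the exponent i of the root found. Adding
        the multiple \<open>?c * i\<close> of the period leaves y unchanged and makes the exponent
        at least i.\<close>
      let ?c = "cyc_size q M \<delta>"
      have "[\<delta> * int q ^ (?c * i) * int q ^ k = \<delta> * int q ^ k] (mod int M)"
        by (rule cong_scalar_right) (simp add: cyc_size_dvd_iff[OF M(2)])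
      then have "y = \<zeta> M powi (\<delta> * int q ^ (?c * i + k))"
        unfolding k has_mult_order_powi_eq_iff[OF order_\<zeta>[OF M]] by (simp add: cong_sym_eq power_add mult.assoc)
      moreover have "?c > 0" using cyc_size_props(1)[OF M(2)] .
      then obtain c where "?c = Suc c" using gr0_implies_Suc by blast
      then have "?c * i + k = i + ((?c - 1) * i + k)" by simp
      ultimately have "y = x ^ (q ^ ((?c - 1) * i + k))" unfolding xk by simp
      then show "y \<in> {y. poly ?G y = 0}" using Gk by simp
    qed
    moreover have "?G \<noteq> 0" using nz(1) by (metis deg G degree_0 less_irrefl)
    ultimately have "cyc_size q M \<delta> \<le> card {y. poly ?G y = 0}"
      using poly_roots_finite card_conjugates card_mono by metis
    also have "\<dots> \<le> degree ?G" using \<open>?G \<noteq> 0\<close> by (rule card_poly_roots_bound)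
    finally have "degree F \<le> degree G" using deg degF by simp
    then show ?thesis using nz unfolding GH by (simp add: degree_mult_eq)
  qed
  show ?thesis
  proof (rule Factorial_Ring.irreducibleI)
    show "F \<noteq> 0" by (rule F0)
    show "\<not> is_unit F" using degF0 by (simp add: is_unit_iff_degree[OF F0])
    fix G H assume GH: "F = G * H"
    then have "G \<noteq> 0" "H \<noteq> 0" using F0 by auto
    then show "is_unit G \<or> is_unit H" using key[OF GH] is_unit_iff_degree by blast
  qed
qed

lemma same_coset_if_cyc_poly_eq:
  assumes "cyc_poly q \<zeta> M \<delta> = cyc_poly q \<zeta> M \<delta>'"
  shows "same_coset q M \<delta> \<delta>'"
proof -
  have "conjugates M \<delta> = conjugates M \<delta>'"
    using assms poly_prod_linear_eq_0_iff[OF finite_conjugates] unfolding cyc_poly_eq by (metis subsetI subset_antisym)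
  moreover have "\<zeta> M powi (\<delta>' * int q ^ 0) \<in> conjugates M \<delta>'" unfolding conjugates_def by blast
  ultimately obtain i where "\<zeta> M powi (\<delta>' * int q ^ 0) = \<zeta> M powi (\<delta> * int q ^ i)"
    by (auto simp: conjugates_def)
  then have "[\<delta>' = \<delta> * int q ^ i] (mod int M)"
    unfolding has_mult_order_powi_eq_iff[OF order_\<zeta>[OF M]] by simp
  then show ?thesis by (intro same_cosetI) (rule cong_sym)
qed

text \<open>By \<open>stable\<close> the t-th powers of the conjugates repeat with period w, so the
  conjugate with exponent i is a root of the binomial with index \<open>i mod w\<close>. The degree
  \<open>t * w\<close> is the number of conjugates.\<close>

lemma cyc_poly_eq_prod_binomials:
  assumes size: "cyc_size q M \<delta> = t * w" and t: "t > 0" "t dvd M" and w: "w > 0"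
    and stable: "[\<delta> * int q ^ w = \<delta>] (mod int (M div t))"
  shows "cyc_poly q \<zeta> M \<delta> = (\<Prod>i<w. monom 1 t - [:\<zeta> (M div t) powi (\<delta> * int q ^ i):])"
    (is "_ = ?P")
proof -
  have d: "M div t > 0" "coprime (M div t) q"
    using M t by (auto simp: div_greater_zero_iff dvd_imp_le elim: coprime_divisors[rotated 2])
  have deg1: "degree (monom 1 t - [:c:]) = t" for c :: "'a alg_closure"
    unfolding diff_conv_add_uminus using t by (subst degree_add_eq_left) (auto simp: degree_monom_eq)
  then have nz: "monom 1 t - [:c:] \<noteq> 0" for c :: "'a alg_closure" using t by (metis degree_0 less_irrefl)
  have "?P = (\<Prod>a\<in>conjugates M \<delta>. [:- a, 1:])"
  proof (rule monic_eq_prod_linear[OF finite_conjugates])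
    show "degree ?P = card (conjugates M \<delta>)"
      unfolding card_conjugates size using nz by (subst degree_prod_eq_sum_degree) (auto simp: deg1)
    have "lead_coeff (monom 1 t - [:c:]) = 1" for c :: "'a alg_closure"
      unfolding deg1 using t by (cases t) auto
    then show "lead_coeff ?P = 1" unfolding lead_coeff_prod by simp
  next
    fix x assume "x \<in> conjugates M \<delta>"
    then obtain i where x: "x = \<zeta> M powi (\<delta> * int q ^ i)" by (auto simp: conjugates_def)
    have "x ^ t = (\<zeta> M ^ t) powi (\<delta> * int q ^ i)"
      unfolding x power_int_power power_int_power' by (simp add: mult.commute)
    also have "\<dots> = \<zeta> (M div t) powi (\<delta> * int q ^ i)" using \<zeta>_power[OF M t(2)] by simp
    also have "\<dots> = \<zeta> (M div t) powi (\<delta> * int q ^ (i mod w))"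
    proof -
      have "[\<delta> * (int q ^ w) ^ (i div w) = \<delta>] (mod int (M div t))"
        using stable by (rule cong_power_mult)
      then have "[\<delta> * (int q ^ w) ^ (i div w) * int q ^ (i mod w) = \<delta> * int q ^ (i mod w)] (mod int (M div t))"
        by (rule cong_scalar_right)
      moreover have "\<delta> * (int q ^ w) ^ (i div w) * int q ^ (i mod w) = \<delta> * int q ^ i"
        by (simp add: mult.assoc flip: power_mult power_add)
      ultimately show ?thesis unfolding has_mult_order_powi_eq_iff[OF order_\<zeta>[OF d]] by simp
    qed
    finally have "poly (monom 1 t - [:\<zeta> (M div t) powi (\<delta> * int q ^ (i mod w)):]) x = 0"
      by (simp add: poly_monom)
    moreover have "i mod w \<in> {..<w}" using w by simp
    ultimately show "poly ?P x = 0" unfolding poly_prod by (meson finite_lessThan prod_zero)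
  qed
  then show ?thesis unfolding cyc_poly_eq by simp
qed

end

end

section \<open>The factorization\<close>


lemma rad_dvd: "n > 0 \<Longrightarrow> rad n dvd n"
proof -
  assume n: "n > 0"
  have "rad n dvd (\<Prod>l\<in>prime_factors n. l ^ multiplicity l n)"
    unfolding rad_def by (intro prod_dvd_prod dvd_power) (auto simp: prime_factors_multiplicity)
  also have "\<dots> = n" using n prime_factorization_nat[of n] by simp
  finally show ?thesis .
qed

lemma prime_dvd_rad: "n > 0 \<Longrightarrow> prime l \<Longrightarrow> l dvd n \<Longrightarrow> l dvd rad n"
  unfolding rad_def by (rule dvd_prodI) (auto simp: in_prime_factors_iff)

text \<open>\<omega> is the order modulo K, which has all prime divisors of M, doubled if necessary
  so that \<open>q ^ \<omega>\<close> admits lifting the exponent modulo M. The order of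
  \<open>q ^ \<omega>\<close> is then \<open>M div gcd M (q ^ \<omega> - 1)\<close>; it equals
  \<open>ord M q div \<omega>\<close> and divides M.\<close>

lemma order_factorization:
  fixes q M K :: nat
  assumes M: "M > 0" "coprime M q" and q: "q > 1" and K: "K dvd M" "\<And>l. prime l \<Longrightarrow> l dvd M \<Longrightarrow> l dvd K"
  defines "\<omega> \<equiv> if q ^ ord K q mod 4 = 3 \<and> 8 dvd M then 2 * ord K q else ord K q"
  shows "\<omega> > 0" "\<omega> dvd ord M q" "M dvd (ord M q div \<omega>) * (q ^ \<omega> - 1)" "ord M q div \<omega> dvd M"
proof -
  let ?w = "ord K q" and ?\<tau> = "ord M q"
  have copK: "coprime K q" using M(2) K(1) by (meson coprime_divisors dvd_refl)
  then have w0: "?w > 0" by (simp add: ord_gt_0_iff)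
  then show \<omega>0: "\<omega> > 0" by (simp add: \<omega>_def)
  have "[q ^ ?\<tau> = 1] (mod M)" by (rule ord)
  then have "[q ^ ?\<tau> = 1] (mod K)" using K(1) by (rule cong_dvd_modulus_nat)
  then have w\<tau>: "?w dvd ?\<tau>" by (simp only: ord_divides)
  show \<omega>\<tau>: "\<omega> dvd ?\<tau>"
  proof (cases "q ^ ?w mod 4 = 3 \<and> 8 dvd M")
    \<comment> \<open>As 4 divides M, the power \<open>q ^ ord M q\<close> is 1 modulo 4, so it must
      be an even power of \<open>q ^ ord K q\<close>; this leaves room for the doubling.\<close>
    case True
    obtain c where c: "?\<tau> = ?w * c" using w\<tau> unfolding dvd_def by blast
    have "4 dvd M" using True by (auto elim!: dvd_trans[rotated])
    then have "[q ^ ?\<tau> = 1] (mod 4)" using \<open>[q ^ ?\<tau> = 1] (mod M)\<close> cong_dvd_modulus_nat by blast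
    then have 1: "(q ^ ?w) ^ c mod 4 = 1" by (simp add: c power_mult cong_def)
    have P: "(q ^ ?w) ^ c mod 4 = (if even c then 1 else 3)"
    proof (induction c)
      case (Suc c)
      have "(q ^ ?w) ^ Suc c mod 4 = (q ^ ?w mod 4) * ((q ^ ?w) ^ c mod 4) mod 4" by (simp add: mod_mult_eq)
      then show ?case using Suc True by auto
    qed simp
    have "(if even c then 1 else 3) = (1 :: nat)" using trans[OF sym[OF P] 1] .
    then have "even c" by (simp split: if_splits)
    then show ?thesis using True by (auto simp: \<omega>_def c)
  next
    case False
    then show ?thesis using w\<tau> by (auto simp: \<omega>_def)
  qed
  let ?Q = "q ^ \<omega>"
  have Q1: "?Q > 1" using one_less_power[OF q \<omega>0] .
  have l: "l dvd ?Q - 1" if "prime l" "l dvd M" for l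
  proof -
    have "?w dvd \<omega>" by (simp add: \<omega>_def)
    then have "[?Q = 1] (mod K)" by (simp only: ord_divides)
    then have "K dvd ?Q - 1" using Q1 by (simp add: cong_altdef_nat)
    then show ?thesis using K(2)[OF that] dvd_trans by blast
  qed
  have four: "4 dvd ?Q - 1" if "8 dvd M"
  proof -
    have "2 dvd M" using that by (rule dvd_trans[rotated]) simp
    then have "2 dvd ?Q - 1" using l two_is_prime_nat by blast
    have "?Q mod 4 \<noteq> 3"
    proof (cases "q ^ ?w mod 4 = 3")
      case True
      then have "?Q = q ^ ?w * q ^ ?w" using that by (simp add: \<omega>_def mult_2 power_add)
      moreover have "(q ^ ?w * q ^ ?w) mod 4 = (q ^ ?w mod 4) * (q ^ ?w mod 4) mod 4" by (simp add: mod_mult_eq)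
      ultimately show ?thesis using True by simp
    qed (simp add: \<omega>_def)
    moreover have "4 dvd y - 1" if "2 dvd y - 1" "y mod 4 \<noteq> 3" "y > 1" for y :: nat
      using that by presburger
    ultimately show ?thesis using \<open>2 dvd ?Q - 1\<close> Q1 by blast
  qed
  have "?Q ^ (?\<tau> div \<omega>) = q ^ ?\<tau>" using \<omega>\<tau> by (simp flip: power_mult)
  moreover have "M dvd q ^ ?\<tau> - 1" using \<open>[q ^ ?\<tau> = 1] (mod M)\<close> q by (simp add: cong_altdef_nat)
  ultimately have "M dvd ?Q ^ (?\<tau> div \<omega>) - 1" by (simp only:)
  then show "M dvd (?\<tau> div \<omega>) * (?Q - 1)"
    using dvd_power_minus_one_iff[OF M(1) Q1 l four, of "?\<tau> div \<omega>"] by blast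
  have "?\<tau> div \<omega> = ord M ?Q"
    using ord_power[OF M(2), of \<omega>] gcd_nat.absorb1[OF \<omega>\<tau>] by simp
  also have "\<dots> = M div gcd M (?Q - 1)" by (rule ord_eq_div_gcd[OF M(1) Q1 l four])
  finally show "?\<tau> div \<omega> dvd M" by (metis div_dvd_iff_mult dvd_div_mult_self dvd_triv_left gcd_dvd1 M(1) gcd_eq_0_iff less_irrefl mult.commute)
qed

theorem proposition8p1:
  fixes p e q N v n g n1 u s :: nat
    and gs es fs ps js :: "nat \<Rightarrow> nat"
    and lam lam' :: "'a :: finite_field"
    and \<zeta> :: "nat \<Rightarrow> 'a alg_closure"
    and h :: int
    and R :: "nat \<Rightarrow> nat \<Rightarrow> int \<Rightarrow> nat set"
  assumes "prime p" and "e > 0" and "q = p ^ e" and "card (UNIV :: 'a set) = q"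
    and "compatible_roots q \<zeta>"
    and "lam \<noteq> 0" and "has_mult_order lam g"
    and "N > 0" and "v = multiplicity p N" and "N = p ^ v * n" and "coprime n p"
    and "lam' ^ (p ^ v) = lam"
    and "coprime h (int (n * g))" and "\<zeta> (n * g) powi (h * int n) = to_ac lam'"
    and "g = (\<Prod>k=1..u. gs k ^ es k)"
    and "n1 = (\<Prod>k=1..u. gs k ^ fs k)"
    and "n = n1 * (\<Prod>k=1..s. ps k ^ js k)"
    and "\<forall>k\<in>{1..u}. prime (gs k) \<and> gs k \<noteq> p \<and> es k > 0"
    and "\<forall>k\<in>{1..s}. prime (ps k) \<and> ps k \<noteq> p \<and> js k > 0"
    and "\<forall>i\<in>{1..u}. \<forall>k\<in>{1..s}. gs i \<noteq> ps k"
    and "strict_mono_on {1..u} gs" and "strict_mono_on {1..s} ps"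
    and "\<forall>B l \<delta>. B > 0 \<and> coprime B q \<and> prime l \<and> \<not> l dvd B \<and> l \<noteq> p \<and>
           \<not> l dvd q ^ cyc_size q B \<delta> - 1 \<longrightarrow> full_reps l (q ^ cyc_size q B \<delta>) (R B l \<delta>)"
  defines "\<X> \<equiv> x_set q u gs es fs"
    and "\<I> \<equiv> \<lambda>x. index_set q s ps js (n1 * g) (gamma_x q g u gs fs x)"
    and "\<gamma> \<equiv> \<lambda>x I. rep_seq q R ps js (n1 * g) (gamma_x q g u gs fs x) I s"
    and "M \<equiv> \<lambda>\<delta>. cyc_poly q \<zeta> (n * g) \<delta>"
    and "\<tau> \<equiv> \<lambda>x m. tau_seq q ps js (cyc_size q (n1 * g) (gamma_x q g u gs fs x)) m s"
    and "\<omega> \<equiv> \<lambda>m. omega q g n1 s ps js m"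
    and "d \<equiv> \<lambda>x m. n * g * omega q g n1 s ps js m div
                     tau_seq q ps js (cyc_size q (n1 * g) (gamma_x q g u gs fs x)) m s"
  shows "(\<exists>F :: (nat \<Rightarrow> nat) \<Rightarrow> index \<Rightarrow> 'a poly.
            (\<forall>x\<in>\<X>. \<forall>I\<in>\<I> x. irreducible (F x I) \<and> map_poly to_ac (F x I) = M (h * \<gamma> x I)) \<and>
            inj_on (\<lambda>(x, I). F x I) (SIGMA x:\<X>. \<I> x) \<and>
            monom 1 N - [:lam:] = (\<Prod>x\<in>\<X>. \<Prod>I\<in>\<I> x. F x I ^ (p ^ v)))
       \<and> (\<forall>x\<in>\<X>. \<forall>(m, a, t)\<in>\<I> x.
            \<omega> m dvd \<tau> x m \<and> \<tau> x m dvd n * g * \<omega> m \<and>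
            M (h * \<gamma> x (m, a, t)) =
              (\<Sum>k\<le>\<omega> m.
                 monom ((- 1) ^ (\<omega> m - k) *
                        elem_sym (\<omega> m - k) (\<omega> m)
                          (\<lambda>i. \<zeta> (d x m) powi (h * \<gamma> x (m, a, t) * int q ^ i)))
                       (\<tau> x m * k div \<omega> m)))"
proof -
  interpret ff: finite_field_roots p e q \<zeta>
    using assms(1-5) by unfold_locales
  note q = ff.q_gt_1
  have g0: "g > 0" using assms(7) by (simp add: has_mult_order_def)
  have "lam * lam ^ (q - 1) = lam ^ q" using q by (simp flip: power_Suc)
  also have "\<dots> = lam" using finite_field_power_card_eq_same[of lam] assms(4) by simp
  finally have "lam powi int (q - 1) = 1" using assms(6) unfolding power_int_of_nat by simp
  then have "int g dvd int (q - 1)" using has_mult_order_powi_eq_1_iff[OF assms(7)] by blast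
  then have g_dvd: "g dvd q - 1" unfolding int_dvd_int_iff .
  interpret b: base_cosets q u gs es fs
    using q assms(15,18,21) g_dvd by unfold_locales auto
  have b: "b.g = g" "b.n1 = n1" by (simp_all add: b.g_def b.n1_def assms)
  have cop_g: "coprime g q"
  proof (rule coprimeI)
    fix c assume "c dvd g" "c dvd q"
    then have "c dvd q - (q - 1)" using g_dvd dvd_trans dvd_diff_nat by metis
    then show "is_unit c" using q by simp
  qed
  have n0: "n > 0" using assms(8,10) by (intro gr0I) simp
  have "coprime n q" using assms(3,11) by simp
  then have ng: "n * g > 0" "coprime (n * g) q" using cop_g n0 g0 by auto
  have n1g: "n1 * g > 0" "coprime (n1 * g) q"
    using \<open>coprime n q\<close> cop_g g0 n0 unfolding assms(17) by auto
  interpret c: coset_chain q s "n1 * g" ps js R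
  proof
    fix k assume k: "k \<in> {1..s}"
    have "\<not> ps k dvd n1 * g"
    proof
      assume "ps k dvd n1 * g"
      then obtain i where "i \<in> {1..u}" "ps k = gs i" using b.prime_dvd_n1_g[of "ps k"] b assms(19) k by metis
      then show False using assms(20) k by metis
    qed
    moreover have "\<not> ps k dvd q"
      using assms(1,19) k unfolding assms(3) by (metis prime_dvd_power primes_dvd_imp_eq)
    ultimately show "prime (ps k) \<and> \<not> ps k dvd q \<and> \<not> ps k dvd n1 * g \<and> js k > 0" using assms(19) k by blast
  next
    show "inj_on ps {1..s}" using assms(22) by (rule strict_mono_on_imp_inj_on)
  next
    fix B l \<delta> assume *: "B > 0" "coprime B q" "prime l" "\<not> l dvd B" "\<not> l dvd q"
      "\<not> l dvd q ^ cyc_size q B \<delta> - 1"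
    have "l \<noteq> p" using *(5) assms(2) unfolding assms(3) by auto
    then show "full_reps l (q ^ cyc_size q B \<delta>) (R B l \<delta>)" using * assms(23) by blast
  qed (use q n1g in auto)
  have modulus: "c.modulus s = n * g" unfolding c.modulus_def assms(17) by (simp add: mult_ac)
  let ?\<gamma>0 = "gamma_x q g u gs fs"
  have cong0: "[\<gamma> x I = ?\<gamma>0 x] (mod int (n1 * g))" if "I \<in> \<I> x" for x I
  proof -
    obtain m a t where I: "I = (m, a, t)" using prod_cases3 by blast
    show ?thesis using c.index_set_invariants(3)[of m a t "?\<gamma>0 x"] that unfolding I \<I>_def \<gamma>_def by blast
  qed
  have cong1: "[\<gamma> x I = 1] (mod int g)" if "I \<in> \<I> x" for x I
    by (rule cong_trans[OF cong_dvd_modulus[OF cong0[OF that]] b.gamma_x_cong[unfolded b]]) simp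
  have unique: "x = x' \<and> I = I'"
    if "x \<in> \<X>" "x' \<in> \<X>" "I \<in> \<I> x" "I' \<in> \<I> x'" "same_coset q (n * g) (\<gamma> x I) (\<gamma> x' I')" for x x' I I'
  proof -
    have "same_coset q (n1 * g) (\<gamma> x I) (\<gamma> x' I')"
      using that(5) by (rule same_coset_dvd_modulus) (simp add: assms(17))
    then have "same_coset q (n1 * g) (?\<gamma>0 x) (?\<gamma>0 x')"
      using same_coset_cong[OF cong0[OF that(4)]] same_coset_cong[OF cong_sym[OF cong0[OF that(3)]]]
        same_coset_trans by blast
    then have "x = x'" using b.gamma_x_unique[unfolded b, of x x'] that(1,2) unfolding \<X>_def by blast
    then show ?thesis
      using c.index_set_unique[of I "?\<gamma>0 x" I'] that unfolding \<I>_def \<gamma>_def modulus by blast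
  qed
  have exists: "\<exists>x\<in>\<X>. \<exists>I\<in>\<I> x. same_coset q (n * g) (\<gamma> x I) z" if z: "[z = 1] (mod int g)" for z
  proof -
    obtain x where x: "x \<in> \<X>" "same_coset q (n1 * g) (?\<gamma>0 x) z"
      using b.gamma_x_exists[unfolded b, OF z] unfolding \<X>_def by blast
    then show ?thesis using c.index_set_exists[OF x(2)] unfolding \<I>_def \<gamma>_def modulus by blast
  qed
  have finX: "finite \<X>" unfolding \<X>_def x_set_def by (intro finite_PiE) auto
  \<comment> \<open>Uniqueness makes \<gamma> injective modulo \<open>n * g\<close> on the indices,
    so finiteness comes from the residues.\<close>
  have finI: "finite (\<I> x)" if "x \<in> \<X>" for x
  proof (rule finite_imageD)
    show "finite ((\<lambda>I. \<gamma> x I mod int (n * g)) ` \<I> x)"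
      by (rule finite_subset[of _ "{0..<int (n * g)}"]) (use ng in auto)
    show "inj_on (\<lambda>I. \<gamma> x I mod int (n * g)) (\<I> x)"
    proof (rule inj_onI)
      fix I I' assume "I \<in> \<I> x" "I' \<in> \<I> x" "\<gamma> x I mod int (n * g) = \<gamma> x I' mod int (n * g)"
      then show "I = I'" using unique[OF that that] same_coset_cong unfolding cong_def by blast
    qed
  qed
  let ?S = "SIGMA x:\<X>. \<I> x"
  have finS: "finite ?S" using finX finI by (rule finite_SigmaI)
  have "\<exists>G :: 'a poly. map_poly to_ac G = M \<delta>" for \<delta>
    using ff.cyc_poly_descends[OF ng] unfolding M_def by metis
  then obtain G :: "int \<Rightarrow> 'a poly" where G: "\<And>\<delta>. map_poly to_ac (G \<delta>) = M \<delta>" by metis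
  define F where "F x I = G (h * \<gamma> x I)" for x I
  have F: "map_poly to_ac (F x I) = M (h * \<gamma> x I)" for x I by (simp add: F_def G)
  have irr: "irreducible (F x I)" for x I
    using ff.irreducible_if_map_eq_cyc_poly[OF ng] F unfolding M_def by blast
  have M_inj: "x = x' \<and> I = I'"
    if "x \<in> \<X>" "x' \<in> \<X>" "I \<in> \<I> x" "I' \<in> \<I> x'" "same_coset q (n * g) (h * \<gamma> x I) (h * \<gamma> x' I')" for x x' I I'
    using unique[OF that(1-4)] that(5) unfolding same_coset_mult_cancel[OF assms(13)] by blast
  have inj: "inj_on (\<lambda>(x, I). F x I) ?S"
  proof (rule inj_onI, clarify)
    fix x I x' I' assume *: "x \<in> \<X>" "I \<in> \<I> x" "x' \<in> \<X>" "I' \<in> \<I> x'" "F x I = F x' I'"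
    then have "M (h * \<gamma> x I) = M (h * \<gamma> x' I')" using F by metis
    then have "same_coset q (n * g) (h * \<gamma> x I) (h * \<gamma> x' I')"
      using ff.same_coset_if_cyc_poly_eq[OF ng] unfolding M_def by blast
    then show "x = x' \<and> I = I'" using M_inj * by blast
  qed
  have prod: "(\<Prod>x\<in>\<X>. \<Prod>I\<in>\<I> x. F x I) = monom 1 n - [:lam':]"
  proof -
    let ?C = "\<lambda>(x, I). ff.conjugates (n * g) (h * \<gamma> x I)" and ?z = "\<zeta> (n * g)"
    have z: "has_mult_order ?z (n * g)" using ff.order_\<zeta>[OF ng] .
    let ?A = "\<Union>(?C ` ?S)"
    \<comment> \<open>Every conjugate has an exponent h times a class 1 modulo g, because g divides
      q - 1; conversely each of the n classes \<open>1 + g * k\<close> lies in some coset by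
      \<open>exists\<close>.\<close>
    have A: "?A = (\<lambda>k. ?z powi (h * (1 + int g * int k))) ` {..<n}"
    proof (intro equalityI subsetI)
      fix a assume "a \<in> ?A"
      then obtain x I i where xI: "I \<in> \<I> x" and a: "a = ?z powi (h * \<gamma> x I * int q ^ i)"
        by (auto simp: ff.conjugates_def)
      have "int g dvd int (q - 1)" using g_dvd unfolding int_dvd_int_iff .
      then have "[int q = 1] (mod int g)" using q by (simp add: cong_iff_dvd_diff of_nat_diff)
      then have "[\<gamma> x I * int q ^ i = 1 * 1 ^ i] (mod int g)" by (intro cong_mult cong_pow cong1[OF xI])
      from cong_sym[OF this] obtain k where k: "\<gamma> x I * int q ^ i = 1 + int g * k"
        unfolding cong_iff_lin by auto
      have "[int g * (k mod int n) = int g * k] (mod int (n * g))"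
        unfolding of_nat_mult mult.commute[of "int n"] by (simp add: cong_def mod_mult_mult1)
      then have "[h * (1 + int g * (k mod int n)) = h * (1 + int g * k)] (mod int (n * g))"
        by (intro cong_scalar_left[OF cong_add[OF cong_refl]])
      then have "a = ?z powi (h * (1 + int g * int (nat (k mod int n))))"
        unfolding a mult.assoc k has_mult_order_powi_eq_iff[OF z] using n0 by (simp add: cong_sym_eq)
      moreover have "nat (k mod int n) \<in> {..<n}" using n0 by (simp add: nat_less_iff)
      ultimately show "a \<in> (\<lambda>k. ?z powi (h * (1 + int g * int k))) ` {..<n}" by blast
    next
      fix a assume "a \<in> (\<lambda>k. ?z powi (h * (1 + int g * int k))) ` {..<n}"
      then obtain k where a: "a = ?z powi (h * (1 + int g * int k))" by blast
      have "[1 + int g * int k = 1] (mod int g)" by (simp add: cong_def)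
      from exists[OF this] obtain x I where xI: "x \<in> \<X>" "I \<in> \<I> x"
        "same_coset q (n * g) (\<gamma> x I) (1 + int g * int k)" by blast
      from same_coset_mult[OF xI(3), of h] obtain i
        where "[h * \<gamma> x I * int q ^ i = h * (1 + int g * int k)] (mod int (n * g))" by (auto simp: same_coset_def)
      then have "a = ?z powi (h * \<gamma> x I * int q ^ i)"
        unfolding a has_mult_order_powi_eq_iff[OF z] by (rule cong_sym)
      then have "a \<in> ?C (x, I)" by (auto simp: ff.conjugates_def)
      then show "a \<in> ?A" using xI by blast
    qed
    have "inj_on (\<lambda>k. ?z powi (h * (1 + int g * int k))) {..<n}"
    proof (rule inj_onI)
      fix k k' assume k: "k \<in> {..<n}" "k' \<in> {..<n}"
        "?z powi (h * (1 + int g * int k)) = ?z powi (h * (1 + int g * int k'))"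
      then have "[1 + int g * int k = 1 + int g * int k'] (mod int (n * g))"
        unfolding has_mult_order_powi_eq_iff[OF z] cong_mult_lcancel[OF assms(13)] by blast
      then have "[int g * int k = int g * int k'] (mod int g * int n)"
        by (simp only: cong_add_lcancel of_nat_mult mult.commute)
      then have "[int k = int k'] (mod int n)" using g0 by (simp add: cong_def mod_mult_mult1)
      then show "k = k'" using k by (simp add: cong_def)
    qed
    then have cardA: "card ?A = n" unfolding A by (simp add: card_image)
    have finA: "finite ?A" unfolding A by simp
    have "monom 1 n - [:to_ac lam':] = (\<Prod>a\<in>?A. [:- a, 1:])"
    proof (rule monic_eq_prod_linear[OF finA])
      have deg: "degree (monom 1 n - [:to_ac lam':]) = n"
        unfolding diff_conv_add_uminus using n0 by (subst degree_add_eq_left) (auto simp: degree_monom_eq)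
      then show "degree (monom 1 n - [:to_ac lam':]) = card ?A" by (simp only: cardA)
      show "lead_coeff (monom 1 n - [:to_ac lam':]) = 1" unfolding deg using n0 by (cases n) auto
    next
      fix a assume "a \<in> ?A"
      then obtain k where "a = ?z powi (h * (1 + int g * int k))" unfolding A by blast
      then have "a ^ n = ?z powi (h * (1 + int g * int k) * int n)" by (simp add: power_int_power')
      also have "\<dots> = ?z powi (h * int n)"
        unfolding has_mult_order_powi_eq_iff[OF z] cong_iff_dvd_diff by (simp add: algebra_simps)
      finally show "poly (monom 1 n - [:to_ac lam':]) a = 0" using assms(14) by (simp add: poly_monom)
    qed
    also have "\<dots> = (\<Prod>i\<in>?S. \<Prod>a\<in>?C i. [:- a, 1:])"
    proof (rule prod.UNION_disjoint[OF finS])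
      show "\<forall>i\<in>?S. finite (?C i)" using ff.finite_conjugates[OF ng] by auto
      show "\<forall>i\<in>?S. \<forall>j\<in>?S. i \<noteq> j \<longrightarrow> ?C i \<inter> ?C j = {}"
      proof (intro ballI impI, rule ccontr)
        fix i j assume *: "i \<in> ?S" "j \<in> ?S" "i \<noteq> j" "?C i \<inter> ?C j \<noteq> {}"
        obtain x I x' I' where ij: "i = (x, I)" "j = (x', I')" by (metis surj_pair)
        obtain r r' where "?z powi (h * \<gamma> x I * int q ^ r) = ?z powi (h * \<gamma> x' I' * int q ^ r')"
          using *(4) unfolding ij ff.conjugates_def by auto
        then have "[h * \<gamma> x I * int q ^ r = h * \<gamma> x' I' * int q ^ r'] (mod int (n * g))"
          unfolding has_mult_order_powi_eq_iff[OF z] .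
        then have "same_coset q (n * g) (h * \<gamma> x I) (h * \<gamma> x' I' * int q ^ r')" by (rule same_cosetI)
        moreover have "same_coset q (n * g) (h * \<gamma> x' I') (h * \<gamma> x' I' * int q ^ r')"
          by (rule same_cosetI) (rule cong_refl)
        ultimately have "same_coset q (n * g) (h * \<gamma> x I) (h * \<gamma> x' I')"
          using same_coset_trans same_coset_sym[OF ng(2)] by blast
        then show False using M_inj * unfolding ij by blast
      qed
    qed
    also have "\<dots> = (\<Prod>(x, I)\<in>?S. M (h * \<gamma> x I))"
      by (intro prod.cong refl) (auto simp: M_def ff.cyc_poly_eq[OF ng])
    also have "\<dots> = (\<Prod>x\<in>\<X>. \<Prod>I\<in>\<I> x. M (h * \<gamma> x I))"
      using finX finI by (intro prod.Sigma[symmetric]) auto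
    also have "\<dots> = map_poly to_ac (\<Prod>x\<in>\<X>. \<Prod>I\<in>\<I> x. F x I)"
      by (simp add: F map_poly_hom_prod[OF to_ac_0 to_ac_1 to_ac_add to_ac_mult])
    finally have "map_poly to_ac (\<Prod>x\<in>\<X>. \<Prod>I\<in>\<I> x. F x I) = map_poly to_ac (monom 1 n - [:lam':])"
      using map_poly_hom_diff[of "to_ac :: 'a \<Rightarrow> _", OF to_ac_0 to_ac_1 to_ac_add to_ac_mult]
      by (simp add: map_poly_monom map_poly_pCons)
    from arg_cong[OF this, of coeff]
    have "to_ac (coeff (\<Prod>x\<in>\<X>. \<Prod>I\<in>\<I> x. F x I) i) = to_ac (coeff (monom 1 n - [:lam':]) i)" for i
      unfolding fun_eq_iff by (simp only: coeff_map_poly to_ac_0)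
    then show ?thesis by (intro poly_eqI) (simp only: to_ac_eq_iff)
  qed
  have "(\<Prod>x\<in>\<X>. \<Prod>I\<in>\<I> x. F x I ^ (p ^ v)) = (monom 1 n - [:lam':]) ^ (p ^ v)"
    unfolding prod[symmetric] by (simp add: prod_power_distrib)
  also have "\<dots> = monom 1 N - [:lam:]"
  proof -
    \<comment> \<open>The rule for powers of a sum in characteristic p is applied to the difference
      plus its subtrahend, which avoids signs when p = 2.\<close>
    have "((monom 1 n - [:lam':]) + [:lam':]) ^ (p ^ v) = (monom 1 n - [:lam':]) ^ (p ^ v) + [:lam':] ^ (p ^ v)"
      by (rule freshmans_dream'[where n = v]) (simp_all add: ff.CHAR_eq assms(1))
    then have "(monom 1 n - [:lam':]) ^ (p ^ v) = monom 1 n ^ (p ^ v) - [:lam':] ^ (p ^ v)" by simp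
    also have "monom (1 :: 'a) n ^ (p ^ v) = monom 1 N" using assms(10) by (simp add: monom_power mult.commute)
    also have "[:lam':] ^ (p ^ v) = [:lam:]" using assms(12) by (simp add: poly_const_pow)
    finally show ?thesis .
  qed
  finally have part1: "monom 1 N - [:lam:] = (\<Prod>x\<in>\<X>. \<Prod>I\<in>\<I> x. F x I ^ (p ^ v))" by (rule sym)
  have part2: "\<omega> m dvd \<tau> x m \<and> \<tau> x m dvd n * g * \<omega> m \<and>
            M (h * \<gamma> x (m, a, t)) =
              (\<Sum>k\<le>\<omega> m.
                 monom ((- 1) ^ (\<omega> m - k) *
                        elem_sym (\<omega> m - k) (\<omega> m)
                          (\<lambda>i. \<zeta> (d x m) powi (h * \<gamma> x (m, a, t) * int q ^ i)))
                       (\<tau> x m * k div \<omega> m))"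
    if x: "x \<in> \<X>" and I: "(m, a, t) \<in> \<I> x" for x m a t
  proof -
    let ?c = "\<lambda>k. co_exp (js k) (m k)" and ?\<delta> = "\<gamma> x (m, a, t)"
    \<comment> \<open>The order of the root: the starting point is a unit modulo
      \<open>n1 * g\<close>, so that part occurs in full, while at \<open>ps k\<close> the
      annihilator has exponent \<open>co_exp (js k) (m k)\<close>.\<close>
    define M' where "M' = n1 * g * (\<Prod>k=1..s. ps k ^ ?c k)"
    define K where "K = rad g * (\<Prod>k=1..s. ps k ^ min (?c k) 1)"
    note inv = c.index_set_invariants[OF I[unfolded \<I>_def], folded modulus]
    have dvd: "int (n * g) dvd ?\<delta> * w \<longleftrightarrow> int M' dvd w" for w
    proof -
      have "coprime (?\<gamma>0 x) (int (n1 * g))" using b.coprime_n1_g[unfolded b] b.gamma_x_cong[unfolded b] by blast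
      then have "int (n1 * g) dvd ?\<gamma>0 x * w \<longleftrightarrow> int (n1 * g) dvd w"
        by (simp add: coprime_dvd_mult_right_iff coprime_commute)
      then have "int (n * g) dvd ?\<delta> * w \<longleftrightarrow> int ((\<Prod>k=1..s. ps k ^ ?c k) * (n1 * g)) dvd w"
        using inv(2)[of w] unfolding modulus \<gamma>_def c.prod_dvd_iff[OF order_refl] by blast
      then show ?thesis unfolding M'_def by (simp only: mult.commute)
    qed
    have M'n: "M' dvd n * g" using dvd[of "int (n * g)"] unfolding int_dvd_int_iff by simp
    have M': "M' > 0" "coprime M' q"
      using dvd_pos_nat[OF ng(1) M'n] coprime_divisors[OF M'n dvd_refl ng(2)] .
    have K: "K dvd M'" unfolding K_def M'_def
      by (intro mult_dvd_mono prod_dvd_prod dvd_mult rad_dvd[OF g0] le_imp_power_dvd) auto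
    have KM: "l dvd K" if l: "prime l" "l dvd M'" for l
    proof -
      from l consider "l dvd n1 * g" | "l dvd (\<Prod>k=1..s. ps k ^ ?c k)"
        unfolding M'_def prime_dvd_mult_iff[OF l(1)] by blast
      then show ?thesis
      proof cases
        case 1
        then have "l dvd rad g" using b.prime_dvd_g[unfolded b, OF l(1)] prime_dvd_rad[OF g0 l(1)] by blast
        then show ?thesis unfolding K_def by (rule dvd_mult2)
      next
        case 2
        then obtain k where k: "k \<in> {1..s}" "l dvd ps k ^ ?c k" using l(1) by (auto simp: prime_dvd_prod_iff)
        have "?c k \<noteq> 0" using k(2) l(1) by (intro notI) simp
        moreover have "l dvd ps k" using k(2) l(1) prime_dvd_power by blast
        ultimately have "l dvd ps k ^ min (?c k) 1" by simp
        also have "\<dots> dvd (\<Prod>k=1..s. ps k ^ min (?c k) 1)" using k(1) by (intro dvd_prodI) auto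
        finally show ?thesis unfolding K_def by (rule dvd_mult)
      qed
    qed
    have \<omega>: "\<omega> m = (if q ^ ord K q mod 4 = 3 \<and> 8 dvd M' then 2 * ord K q else ord K q)"
      unfolding \<omega>_def omega_def K_def[symmetric] M'_def[symmetric] Let_def ..
    have size: "cyc_size q (n * g) ?\<delta> = \<tau> x m" using inv(1) unfolding modulus \<gamma>_def \<tau>_def .
    have cong_iff: "[?\<delta> * int q ^ i = ?\<delta>] (mod int (n * g)) \<longleftrightarrow> ord M' q dvd i" for i
    proof -
      have "[?\<delta> * int q ^ i = ?\<delta>] (mod int (n * g)) \<longleftrightarrow> int (n * g) dvd ?\<delta> * (int q ^ i - 1)"
        unfolding cong_iff_dvd_diff by (simp add: algebra_simps)
      also have "\<dots> \<longleftrightarrow> [int (q ^ i) = int 1] (mod int M')" unfolding dvd cong_iff_dvd_diff by simp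
      also have "\<dots> \<longleftrightarrow> ord M' q dvd i" unfolding cong_int_iff ord_divides ..
      finally show ?thesis .
    qed
    \<comment> \<open>The coset size is known in two ways, from the recursion and as the order of q
      modulo M'; the comparison identifies the recursive formula with that order.\<close>
    have \<tau>: "\<tau> x m = ord M' q" using cyc_size_eqI[OF ng(2) cong_iff] size by simp
    have hsize: "cyc_size q (n * g) (h * ?\<delta>) = \<tau> x m"
      unfolding \<tau> using cong_iff cong_mult_lcancel[OF assms(13)] by (intro cyc_size_eqI[OF ng(2)]) (simp add: mult.assoc)
    note ordf = order_factorization[OF M' q K KM, folded \<omega>, folded \<tau>]
    define r where "r = \<tau> x m div \<omega> m"
    have \<tau>r: "\<tau> x m = r * \<omega> m" using ordf(2) by (simp add: r_def)
    have "\<tau> x m > 0" unfolding \<tau> using M'(2) by (simp add: ord_gt_0_iff)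
    then have r0: "r > 0" unfolding \<tau>r by simp
    have rng: "r dvd n * g" using ordf(4) M'n unfolding r_def by (rule dvd_trans)
    have d: "d x m = n * g div r"
    proof -
      have "d x m = n * g * \<omega> m div \<tau> x m" by (simp only: d_def \<omega>_def \<tau>_def)
      then show ?thesis unfolding \<tau>r using ordf(1) by simp
    qed
    \<comment> \<open>That M' divides \<open>r * (q ^ \<omega> m - 1)\<close> means that
      \<open>n * g\<close> divides this number times \<open>?\<delta>\<close>; cancelling r leaves
      the modulus \<open>n * g div r\<close>.\<close>
    have stable: "[h * ?\<delta> * int q ^ \<omega> m = h * ?\<delta>] (mod int (n * g div r))"
    proof -
      have "int M' dvd int r * int (q ^ \<omega> m - 1)"
        using ordf(3) unfolding r_def[symmetric] by (metis int_dvd_int_iff of_nat_mult)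
      then have "int (n * g) dvd ?\<delta> * (int r * int (q ^ \<omega> m - 1))" unfolding dvd .
      moreover have "int (n * g div r) * int r = int (n * g)"
        using rng by (simp only: of_nat_mult[symmetric] dvd_div_mult_self)
      ultimately have "int (n * g div r) * int r dvd (?\<delta> * int (q ^ \<omega> m - 1)) * int r"
        by (simp only: mult_ac)
      then have "int (n * g div r) dvd ?\<delta> * int (q ^ \<omega> m - 1)" using r0 by simp
      then have "int (n * g div r) dvd h * (?\<delta> * int (q ^ \<omega> m - 1))" by (rule dvd_mult)
      moreover have "int (q ^ \<omega> m - 1) = int q ^ \<omega> m - 1" using q by (simp add: of_nat_diff)
      moreover have "h * ?\<delta> * int q ^ \<omega> m - h * ?\<delta> = h * (?\<delta> * (int q ^ \<omega> m - 1))"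
        by (simp add: algebra_simps)
      ultimately show ?thesis unfolding cong_iff_dvd_diff by (simp only:)
    qed
    have "M (h * ?\<delta>) = (\<Prod>i<\<omega> m. monom 1 r - [:\<zeta> (n * g div r) powi (h * ?\<delta> * int q ^ i):])"
      unfolding M_def using hsize \<tau>r r0 rng ordf(1) stable by (intro ff.cyc_poly_eq_prod_binomials[OF ng]) auto
    also have "\<dots> = (\<Sum>k\<le>\<omega> m. monom ((- 1) ^ (\<omega> m - k) * elem_sym (\<omega> m - k) (\<omega> m)
        (\<lambda>i. \<zeta> (n * g div r) powi (h * ?\<delta> * int q ^ i))) (r * k))"
      by (rule elem_sym_expansion)
    also have "\<dots> = (\<Sum>k\<le>\<omega> m. monom ((- 1) ^ (\<omega> m - k) * elem_sym (\<omega> m - k) (\<omega> m)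
        (\<lambda>i. \<zeta> (d x m) powi (h * ?\<delta> * int q ^ i))) (\<tau> x m * k div \<omega> m))"
    proof -
      have "r * k = \<tau> x m * k div \<omega> m" for k
      proof -
        have e: "\<tau> x m * k = (r * k) * \<omega> m" by (simp add: \<tau>r mult_ac)
        show ?thesis unfolding e using ordf(1) by simp
      qed
      then show ?thesis by (simp only: d)
    qed
    finally show ?thesis using ordf(2) rng \<tau>r by (simp add: mult_dvd_mono)
  qed
  show ?thesis
  proof (intro conjI exI[of _ F] ballI)
    show "inj_on (\<lambda>(x, I). F x I) ?S" by (rule inj)
    show "monom 1 N - [:lam:] = (\<Prod>x\<in>\<X>. \<Prod>I\<in>\<I> x. F x I ^ (p ^ v))" by (rule part1)
  qed (use irr F part2 in auto)
qed

end
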